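(* Let $0<\alpha<2$ and let $k:\mathbb{R}^n\to[0,\infty)$ be a non-negative smooth function that is not identically zero. Assume that for each $x\in\mathbb{R}^n$, $$\int_{\mathbb{R}^n} g_\alpha(x,y)\,k(y)\,dy<\infty .$$ Then there exists a non-negative function $u\in E$, not identically zero, such that $$(-\Delta)^{\alpha/2}u+k(x)u=0\quad\text{in } \mathbb{R}^n .$$
   Context: For $0<\alpha<2$, $$L_\alpha=\Big\{u\in L^1_{loc}(\mathbb{R}^n):\ \int_{\mathbb{R}^n}\frac{|u(x)|}{1+|x|^{n+\alpha}}\,dx<\infty\Big\},\qquad E=C^{1,1}_{loc}(\mathbb{R}^n)\cap L_\alpha .$$ Here $C^{1,1}_{loc}(\mathbb{R}^n)$ is the set of $C^1$ functions whose first derivatives are locally Lipschitz. For $u\in E$ the fractional Laplacian is defined pointwise by $$(-\Delta)^{\alpha/2}u(x)=C_{n,\alpha}\,\mathrm{P.V.}\int_{\mathbb{R}^n}\frac{u(x)-u(y)}{|x-y|^{n+\alpha}}\,dy=C_{n,\alpha}\lim_{\varepsilon\to0^+}\int_{|x-y|>\varepsilon}\frac{u(x)-u(y)}{|x-y|^{n+\alpha}}\,dy,$$ where $C_{n,\alpha}>0$ is the usual normalization constant $C_{n,\alpha}=\dfrac{2^\alpha\,\Gamma((n+\alpha)/2)}{\pi^{n/2}\,|\Gamma(-\alpha/2)|}$ (so that $(-\Delta)^{\alpha/2}$ has Fourier symbol $|\xi|^\alpha$). The kernel $g_\alpha$ is the Riesz kernel $$g_\alpha(x,y)=\frac{C_{n,-\alpha}}{|x-y|^{n-\alpha}},\qquad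 C_{n,-\alpha}=\frac{\Gamma((n-\alpha)/2)}{2^\alpha\pi^{n/2}\Gamma(\alpha/2)}>0,$$ i.e. the fundamental solution of $(-\Delta)^{\alpha/2}$ on $\mathbb{R}^n$; for this kernel to be defined with these properties it is understood that $\alpha<n$. *)

theory Defs
  imports "HOL-Analysis.Analysis"
begin

primrec C_k :: "nat \<Rightarrow> ('a::euclidean_space \<Rightarrow> real) \<Rightarrow> bool" where
  "C_k 0 f \<longleftrightarrow> continuous_on UNIV f"
| "C_k (Suc m) f \<longleftrightarrow>
     (\<forall>x. f differentiable (at x)) \<and>
     (\<forall>b\<in>Basis. C_k m (\<lambda>x. frechet_derivative f (at x) b))"

definition smooth :: "('a::euclidean_space \<Rightarrow> real) \<Rightarrow> bool" where
  "smooth f \<longleftrightarrow> (\<forall>m. C_k m f)"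

definition locally_Lipschitz :: "('a::metric_space \<Rightarrow> 'b::metric_space) \<Rightarrow> bool" where
  "locally_Lipschitz f \<longleftrightarrow> (\<forall>x. \<exists>r>0. \<exists>L. L-lipschitz_on (ball x r) f)"

definition C11_loc :: "('a::euclidean_space \<Rightarrow> real) set" where
  "C11_loc = {u. C_k 1 u \<and>
     (\<forall>b\<in>Basis. locally_Lipschitz (\<lambda>x. frechet_derivative u (at x) b))}"

definition L1_loc :: "('a::euclidean_space \<Rightarrow> real) set" where
  "L1_loc = {u. \<forall>K. compact K \<longrightarrow> set_integrable lebesgue K u}"

definition L_space :: "real \<Rightarrow> ('a::euclidean_space \<Rightarrow> real) set" where
  "L_space \<alpha> = {u \<in> L1_loc.
     (\<integral>\<^sup>+ x. ennreal (\<bar>u x\<bar> / (1 + norm x powr (real DIM('a) + \<alpha>))) \<partial>lebesgue) < \<infinity>}"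

definition E_space :: "real \<Rightarrow> ('a::euclidean_space \<Rightarrow> real) set" where
  "E_space \<alpha> = C11_loc \<inter> L_space \<alpha>"

definition frac_laplacian_const :: "nat \<Rightarrow> real \<Rightarrow> real" where
  "frac_laplacian_const n \<alpha> =
     2 powr \<alpha> * Gamma ((real n + \<alpha>) / 2) / (pi powr (real n / 2) * \<bar>Gamma (- \<alpha> / 2)\<bar>)"

definition frac_quotient ::
  "real \<Rightarrow> ('a::euclidean_space \<Rightarrow> real) \<Rightarrow> 'a \<Rightarrow> 'a \<Rightarrow> real" where
  "frac_quotient \<alpha> u x y = (u x - u y) / norm (x - y) powr (real DIM('a) + \<alpha>)"

definition frac_truncated ::
  "real \<Rightarrow> ('a::euclidean_space \<Rightarrow> real) \<Rightarrow> 'a \<Rightarrow> real \<Rightarrow> real" where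
  "frac_truncated \<alpha> u x \<epsilon> =
     set_lebesgue_integral lebesgue {y. norm (x - y) > \<epsilon>} (frac_quotient \<alpha> u x)"

(* The Bochner integral and Lim are total, so well-definedness of the principal value
   has to be asserted separately from its value. *)
definition frac_laplacian_exists ::
  "real \<Rightarrow> ('a::euclidean_space \<Rightarrow> real) \<Rightarrow> 'a \<Rightarrow> bool" where
  "frac_laplacian_exists \<alpha> u x \<longleftrightarrow>
     (\<forall>\<epsilon>>0. set_integrable lebesgue {y. norm (x - y) > \<epsilon>} (frac_quotient \<alpha> u x)) \<and>
     (\<exists>l. (frac_truncated \<alpha> u x \<longlongrightarrow> l) (at_right 0))"

definition frac_laplacian ::
  "real \<Rightarrow> ('a::euclidean_space \<Rightarrow> real) \<Rightarrow> 'a \<Rightarrow> real" where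
  "frac_laplacian \<alpha> u x =
     frac_laplacian_const DIM('a) \<alpha> * Lim (at_right 0) (frac_truncated \<alpha> u x)"

definition riesz_const :: "nat \<Rightarrow> real \<Rightarrow> real" where
  "riesz_const n \<alpha> =
     Gamma ((real n - \<alpha>) / 2) / (2 powr \<alpha> * pi powr (real n / 2) * Gamma (\<alpha> / 2))"

(* On the diagonal this kernel takes the value 0 instead of infinity; the diagonal point is
   a null set for every integral in which the kernel is used. *)
definition riesz_kernel :: "real \<Rightarrow> 'a::euclidean_space \<Rightarrow> 'a \<Rightarrow> real" where
  "riesz_kernel \<alpha> x y = riesz_const DIM('a) \<alpha> / norm (x - y) powr (real DIM('a) - \<alpha>)"

end

theory Submission
  imports Defs "HOL-Probability.Distributions"
begin

text \<open>
  The solution is \<open>u = 1 - G(k u)\<close>, where \<open>G\<close> is a suitable multiple of the convolution with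
  \<open>|x| powr (\<alpha> - n)\<close>; in particular the exact value of the Riesz constant is irrelevant.

  Writing \<open>\<beta> = \<alpha> / 2\<close>, both \<open>|x| powr (\<alpha> - n)\<close> and \<open>|x| powr (- n - \<alpha>)\<close> are mixtures of Gaussians
  \<open>p\<^sub>t\<close>, with weights \<open>t powr (\<beta> - 1)\<close> and \<open>t powr (- \<beta> - 1)\<close>. Truncating the second mixture to
  \<open>t > \<epsilon>\<close> gives an integrable jump kernel \<open>J\<^sub>\<epsilon>\<close>, and an explicit beta integral shows that
  \<open>(\<integral>J\<^sub>\<epsilon>) G f - J\<^sub>\<epsilon> * G f\<close> is \<open>f\<close> convolved with a positive approximate identity. Hence the truncated
  operators applied to \<open>G f\<close> converge to a positive multiple of \<open>f\<close> for merely continuous \<open>f\<close>.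

  This yields a maximum principle for \<open>G f\<close>, so \<open>u + t G(k u) = g\<close> has the a priori bound
  \<open>|u| \<le> 2 sup |g|\<close>; for compactly supported \<open>k\<close> the equation is solved by the method of continuity
  in \<open>t\<close>, and in general by exhausting \<open>k\<close> from below and passing to the decreasing limit of the
  solutions. The limit is not zero because \<open>0 + G 0 \<noteq> 1\<close>.

  For the regularity the kernel is split at scale \<open>\<delta>\<close> into a far part with bounded second differences
  and a near part supported in the ball of radius \<open>\<delta>\<close> with mass \<open>O(\<delta> powr \<alpha>)\<close>. First and second
  differences of \<open>u\<close> are then bounded by those of \<open>k\<close> plus a small multiple of the differences of \<open>u\<close>
  nearby; choosing \<open>\<delta>\<close> proportional to the distance from the boundary of a ball absorbs the last term.
\<close>

section \<open>Gaussian mixtures\<close>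

text \<open>The hypothesis makes \<open>G k\<close> finite at each point but neither small nor
  bounded, so a Neumann series or a direct contraction for \<open>u + G(k u) = 1\<close> fails; the
  sign of \<open>k\<close> has to replace smallness. The maximum principle that exploits this sign
  is needed while \<open>G(k u)\<close> is known to be continuous only, so it cannot be read off the
  singular integral. Truncating in the mixing parameter \<open>t\<close>, not in space, keeps all
  operators among Gaussian mixtures, where convolving kernels means convolving weights on the
  half-line: the key identity becomes a one-dimensional integral, free of Fourier analysis and of
  any regularity of \<open>f\<close>. These computations run in \<open>ennreal\<close> by Tonelli;
  signed functions enter by splitting into positive and negative parts. The price is a truncation
  different from the sharp one in the definition of the principal value; the two are compared for
  the final solution, whose second differences are controlled by then. That control cannot start
  from derivatives, because the limit solution is merely measurable with values in [0, 1]: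
  differences are bounded uniformly in the step before any derivative is formed.\<close>

lemma nn_integral_lborel_shift:
  fixes f :: "'a::euclidean_space \<Rightarrow> ennreal"
  assumes [measurable]: "f \<in> borel_measurable borel"
  shows "(\<integral>\<^sup>+x. f (x + c) \<partial>lborel) = (\<integral>\<^sup>+x. f x \<partial>lborel)"
proof -
  have "(\<integral>\<^sup>+x. f x \<partial>lborel) = (\<integral>\<^sup>+x. f x \<partial>distr lborel borel ((+) c))"
    by (simp add: lborel_distr_plus)
  also have "\<dots> = (\<integral>\<^sup>+x. f (x + c) \<partial>lborel)"
    by (subst nn_integral_distr) (auto simp: add.commute)
  finally show ?thesis by simp
qed

lemma nn_integral_lborel_reflect:
  fixes f :: "'a::euclidean_space \<Rightarrow> ennreal"
  assumes [measurable]: "f \<in> borel_measurable borel"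
  shows "(\<integral>\<^sup>+x. f (c - x) \<partial>lborel) = (\<integral>\<^sup>+x. f x \<partial>lborel)"
proof -
  have "lborel = density (distr lborel borel (\<lambda>x::'a. c - x)) (\<lambda>_. 1)"
    using lborel_affine[of "-1" c] by simp
  then have "(\<integral>\<^sup>+x. f x \<partial>lborel) = (\<integral>\<^sup>+x. f x \<partial>density (distr lborel borel (\<lambda>x::'a. c - x)) (\<lambda>_. 1))"
    by simp
  also have "\<dots> = (\<integral>\<^sup>+x. f (c - x) \<partial>lborel)"
    by (simp add: nn_integral_density nn_integral_distr)
  finally show ?thesis by simp
qed

lemma nn_integral_powr_Ioc:
  assumes "p > -1" "0 \<le> a"
  shows "(\<integral>\<^sup>+t. ennreal (t powr p) * indicator {0<..a} t \<partial>lborel) = ennreal (a powr (p + 1) / (p + 1))"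
proof -
  have "(\<integral>\<^sup>+t. ennreal (t powr p) * indicator {0<..a} t \<partial>lborel)
      = (\<integral>\<^sup>+t. ennreal (t powr p) * indicator {0..a} t \<partial>lborel)"
    \<comment> \<open>At \<open>t = 0\<close> both integrands vanish, since
      \<open>0 powr p = 0\<close>.\<close>
    by (rule nn_integral_cong) (simp add: indicator_def)
  also have "\<dots> = ennreal (a powr (p + 1) / (p + 1))"
    by (rule nn_integral_has_integral_lebesgue'[OF _ has_integral_powr_from_0[OF assms]]) (rule powr_ge_zero)
  finally show ?thesis .
qed

lemma nn_integral_powr_Ioi:
  assumes "p < -1" "0 < a"
  shows "(\<integral>\<^sup>+t. ennreal (t powr p) * indicator {a<..} t \<partial>lborel) = ennreal (- (a powr (p + 1)) / (p + 1))"
proof -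
  have "(\<integral>\<^sup>+t. ennreal (t powr p) * indicator {a<..} t \<partial>lborel)
      = (\<integral>\<^sup>+t. ennreal (t powr p) * indicator {a..} t \<partial>lborel)"
  proof (rule nn_integral_cong_AE)
    show "AE t in lborel. ennreal (t powr p) * indicator {a<..} t = ennreal (t powr p) * indicator {a..} t"
      using AE_lborel_singleton[of a] by eventually_elim (simp add: indicator_def)
  qed
  also have "\<dots> = ennreal (- (a powr (p + 1)) / (p + 1))"
    by (rule nn_integral_has_integral_lebesgue'[OF _ has_integral_powr_to_inf[OF assms]]) (rule powr_ge_zero)
  finally show ?thesis .
qed

text \<open>The heat kernel of the Laplacian at time \<open>t / 4\<close>, that is, the density of
  independent centred normals of variance \<open>t / 2\<close>; with this parameter, convolution
  adds the values of \<open>t\<close>. The value 0 for \<open>t \<le> 0\<close> confines every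
  mixture below to positive \<open>t\<close> without an indicator.\<close>

definition heat :: "real \<Rightarrow> 'a::euclidean_space \<Rightarrow> real" where
  "heat t x = (if 0 < t then exp (- (norm x)\<^sup>2 / t) / sqrt (pi * t) ^ DIM('a) else 0)"

lemma heat_nonneg [simp]: "0 \<le> heat t x"
  by (simp add: heat_def)

lemma heat_pos: "0 < t \<Longrightarrow> 0 < heat t x"
  by (simp add: heat_def)

lemma heat_eq_0 [simp]: "t \<le> 0 \<Longrightarrow> heat t x = 0"
  by (simp add: heat_def)

lemma borel_measurable_heat [measurable]:
  fixes g :: "'b \<Rightarrow> 'a::euclidean_space"
  assumes [measurable]: "f \<in> borel_measurable M" "g \<in> borel_measurable M"
  shows "(\<lambda>p. heat (f p) (g p)) \<in> borel_measurable M"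
  unfolding heat_def by measurable

lemma heat_minus [simp]: "heat t (- x) = heat t x"
  by (simp add: heat_def)

text \<open>The density factors over the coordinates into one-dimensional normal densities, each of
  mass 1.\<close>

lemma nn_integral_heat:
  assumes "0 < t"
  shows "(\<integral>\<^sup>+x. ennreal (heat t (x::'a::euclidean_space)) \<partial>lborel) = 1"
proof -
  have eq: "heat t x = (\<Prod>b\<in>Basis. normal_density 0 (sqrt (t / 2)) (x \<bullet> b))" for x :: 'a
  proof -
    have "(norm x)\<^sup>2 = (\<Sum>b\<in>Basis. (x \<bullet> b)\<^sup>2)"
      by (subst power2_norm_eq_inner, subst euclidean_inner) (simp add: power2_eq_square)
    then show ?thesis
      using assms
      by (simp add: heat_def normal_density_def prod.distrib prod_dividef exp_sum sum_divide_distrib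
          sum_negf[symmetric] mult.commute)
  qed
  have one: "(\<integral>\<^sup>+x. ennreal (normal_density 0 (sqrt (t / 2)) x) \<partial>lborel) = 1"
    using assms by (subst nn_integral_eq_integral) auto
  have "(\<integral>\<^sup>+x. ennreal (heat t (x::'a)) \<partial>lborel)
      = (\<integral>\<^sup>+x. (\<Prod>b\<in>Basis. ennreal (normal_density 0 (sqrt (t / 2)) ((x::'a) \<bullet> b))) \<partial>lborel)"
    by (intro nn_integral_cong) (simp add: eq prod_ennreal)
  also have "\<dots> = (\<Prod>b\<in>(Basis::'a set). \<integral>\<^sup>+x. ennreal (normal_density 0 (sqrt (t / 2)) x) \<partial>lborel)"
    by (rule nn_integral_lborel_prod[where f = "\<lambda>_ x. ennreal (normal_density 0 (sqrt (t / 2)) x)"]) auto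
  also have "\<dots> = 1"
    by (simp add: one)
  finally show ?thesis .
qed

text \<open>Completing the square in \<open>y\<close>: the product is again Gaussian in
  \<open>y\<close>, and the factor left over is the Gaussian in \<open>x\<close> whose parameter is
  the sum. Integrating over \<open>y\<close> gives the semigroup law.\<close>

lemma heat_product:
  fixes x y :: "'a::euclidean_space"
  assumes "0 < s" "0 < t"
  shows "heat s (x - y) * heat t y = heat (s + t) x * heat (s * t / (s + t)) (y - (t / (s + t)) *\<^sub>R x)"
proof -
  have st: "s + t > 0" "s \<noteq> 0" "t \<noteq> 0" "s + t \<noteq> 0" using assms by auto
  have nx: "(norm (x - y))\<^sup>2 = (norm x)\<^sup>2 - 2 * (x \<bullet> y) + (norm y)\<^sup>2"
    by (simp add: power2_norm_eq_inner inner_diff algebra_simps inner_commute)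
  have ny: "(norm (y - c *\<^sub>R x))\<^sup>2 = (norm y)\<^sup>2 - 2 * c * (x \<bullet> y) + c * (c * (norm x)\<^sup>2)" for c
    by (simp add: power2_norm_eq_inner inner_diff algebra_simps inner_commute)
  have "(norm (x - y))\<^sup>2 / s + (norm y)\<^sup>2 / t
      = (norm x)\<^sup>2 / (s + t) + (norm (y - (t / (s + t)) *\<^sub>R x))\<^sup>2 / (s * t / (s + t))"
    unfolding nx ny using st by (simp add: divide_simps) (simp add: algebra_simps)
  then have e: "exp (- (norm (x - y))\<^sup>2 / s) * exp (- (norm y)\<^sup>2 / t)
      = exp (- (norm x)\<^sup>2 / (s + t)) * exp (- (norm (y - (t / (s + t)) *\<^sub>R x))\<^sup>2 / (s * t / (s + t)))"
    by (simp add: exp_add[symmetric])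
  have "sqrt (pi * s) * sqrt (pi * t) = sqrt (pi * (s + t)) * sqrt (pi * (s * t / (s + t)))"
    using st by (simp add: real_sqrt_mult[symmetric])
  then have "sqrt (pi * s) ^ DIM('a) * sqrt (pi * t) ^ DIM('a)
      = sqrt (pi * (s + t)) ^ DIM('a) * sqrt (pi * (s * t / (s + t))) ^ DIM('a)"
    by (metis power_mult_distrib)
  with e show ?thesis
    using assms by (simp add: heat_def times_divide_times_eq del: times_divide_eq_right times_divide_eq_left)
qed

lemma nn_integral_heat_conv:
  fixes x :: "'a::euclidean_space"
  assumes "0 < s" "0 < t"
  shows "(\<integral>\<^sup>+y. ennreal (heat s (x - y) * heat t y) \<partial>lborel) = ennreal (heat (s + t) x)"
proof -
  have "(\<integral>\<^sup>+y. ennreal (heat s (x - y) * heat t y) \<partial>lborel)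
      = (\<integral>\<^sup>+y. ennreal (heat (s + t) x) * ennreal (heat (s * t / (s + t)) (y + (- (t / (s + t)) *\<^sub>R x))) \<partial>lborel)"
    using heat_product[OF assms, of x] by (intro nn_integral_cong) (simp add: ennreal_mult')
  also have "\<dots> = ennreal (heat (s + t) x) * (\<integral>\<^sup>+y. ennreal (heat (s * t / (s + t)) (y + (- (t / (s + t)) *\<^sub>R x))) \<partial>lborel)"
    by (rule nn_integral_cmult) measurable
  also have "\<dots> = ennreal (heat (s + t) x)"
    using assms by (subst nn_integral_lborel_shift) (simp_all add: nn_integral_heat)
  finally show ?thesis .
qed

text \<open>Mixture of Gaussians with weight \<open>h\<close>, as in the subordination of Brownian
  motion. Values in \<open>ennreal\<close> allow Tonelli before any finiteness is known; in
  exchange, negative weights are cut off at 0.\<close>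

definition subord :: "(real \<Rightarrow> real) \<Rightarrow> 'a::euclidean_space \<Rightarrow> ennreal" where
  "subord h x = (\<integral>\<^sup>+t. ennreal (h t) * ennreal (heat t x) \<partial>lborel)"

lemma borel_measurable_subord [measurable]:
  assumes [measurable]: "h \<in> borel_measurable borel"
  shows "subord h \<in> borel_measurable borel"
  unfolding subord_def by measurable

lemma subord_minus [simp]: "subord h (- x) = subord h x"
  by (simp add: subord_def)

lemma subord_mono:
  assumes "\<And>t. 0 < t \<Longrightarrow> h t \<le> h' t"
  shows "subord h x \<le> subord h' x"
  unfolding subord_def
proof (rule nn_integral_mono)
  fix t
  show "ennreal (h t) * ennreal (heat t x) \<le> ennreal (h' t) * ennreal (heat t x)"
    by (cases "0 < t") (auto intro!: mult_right_mono ennreal_leI assms)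
qed

lemma subord_cmult:
  assumes [measurable]: "h \<in> borel_measurable borel" and "0 \<le> c"
  shows "subord (\<lambda>t. c * h t) x = ennreal c * subord h x"
  unfolding subord_def using assms(2)
  by (subst nn_integral_cmult[symmetric]) (auto intro!: nn_integral_cong simp: ennreal_mult' mult.assoc)

text \<open>The signs matter because \<open>ennreal\<close> sends negative weights to 0 and is not
  additive on reals of mixed sign.\<close>

lemma subord_add:
  assumes [measurable]: "h \<in> borel_measurable borel" "h' \<in> borel_measurable borel"
    and "\<And>t. 0 < t \<Longrightarrow> 0 \<le> h t" "\<And>t. 0 < t \<Longrightarrow> 0 \<le> h' t"
  shows "subord (\<lambda>t. h t + h' t) x = subord h x + subord h' x"
proof -
  have "subord (\<lambda>t. h t + h' t) x
      = (\<integral>\<^sup>+t. ennreal (h t) * ennreal (heat t x) + ennreal (h' t) * ennreal (heat t x) \<partial>lborel)"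
    unfolding subord_def
  proof (intro nn_integral_cong)
    fix t
    show "ennreal (h t + h' t) * ennreal (heat t x) =
        ennreal (h t) * ennreal (heat t x) + ennreal (h' t) * ennreal (heat t x)"
      by (cases "0 < t") (simp_all add: assms(3,4) distrib_right)
  qed
  then show ?thesis
    unfolding subord_def by (simp add: nn_integral_add)
qed

lemma subord_cong:
  assumes "\<And>t. 0 < t \<Longrightarrow> h t = h' t"
  shows "subord h x = subord h' x"
  unfolding subord_def
proof (rule nn_integral_cong)
  fix t
  show "ennreal (h t) * ennreal (heat t x) = ennreal (h' t) * ennreal (heat t x)"
    by (cases "0 < t") (simp_all add: assms)
qed

lemma nn_integral_subord:
  assumes [measurable]: "h \<in> borel_measurable borel"
  shows "(\<integral>\<^sup>+x. subord h (x::'a::euclidean_space) \<partial>lborel) = (\<integral>\<^sup>+t. ennreal (h t) * indicator {0<..} t \<partial>lborel)"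
proof -
  have "(\<integral>\<^sup>+x. subord h (x::'a) \<partial>lborel)
      = (\<integral>\<^sup>+t. (\<integral>\<^sup>+x. ennreal (h t) * ennreal (heat t (x::'a)) \<partial>lborel) \<partial>lborel)"
    unfolding subord_def by (rule lborel_pair.Fubini') simp
  also have "\<dots> = (\<integral>\<^sup>+t. ennreal (h t) * indicator {0<..} t \<partial>lborel)"
  proof (intro nn_integral_cong)
    fix t
    show "(\<integral>\<^sup>+x. ennreal (h t) * ennreal (heat t (x::'a)) \<partial>lborel) = ennreal (h t) * indicator {0<..} t"
      by (cases "0 < t") (simp_all add: nn_integral_cmult nn_integral_heat)
  qed
  finally show ?thesis .
qed

text \<open>By the semigroup law the pair \<open>s\<close>, \<open>t\<close> contributes the
  Gaussian with parameter \<open>s + t\<close>, so convolving two mixtures amounts to convolving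
  their weights on the half-line.\<close>

lemma subord_conv:
  fixes x :: "'a::euclidean_space"
  assumes [measurable]: "h \<in> borel_measurable borel" "h' \<in> borel_measurable borel"
  shows "(\<integral>\<^sup>+y. subord h (x - y) * subord h' y \<partial>lborel)
    = (\<integral>\<^sup>+\<tau>. (\<integral>\<^sup>+s. ennreal (h s) * ennreal (h' (\<tau> - s)) * indicator {0<..<\<tau>} s \<partial>lborel) * ennreal (heat \<tau> x) \<partial>lborel)"
proof -
  have "(\<integral>\<^sup>+y. subord h (x - y) * subord h' y \<partial>lborel)
      = (\<integral>\<^sup>+y. \<integral>\<^sup>+s. \<integral>\<^sup>+t. ennreal (h s) * ennreal (heat s (x - y)) * (ennreal (h' t) * ennreal (heat t y)) \<partial>lborel \<partial>lborel \<partial>lborel)"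
    unfolding subord_def
    by (simp add: nn_integral_cmult nn_integral_multc)
  also have "\<dots> = (\<integral>\<^sup>+s. \<integral>\<^sup>+y. \<integral>\<^sup>+t. ennreal (h s) * ennreal (heat s (x - y)) * (ennreal (h' t) * ennreal (heat t y)) \<partial>lborel \<partial>lborel \<partial>lborel)"
    by (rule lborel_pair.Fubini') simp
  also have "\<dots> = (\<integral>\<^sup>+s. \<integral>\<^sup>+t. \<integral>\<^sup>+y. ennreal (h s) * ennreal (heat s (x - y)) * (ennreal (h' t) * ennreal (heat t y)) \<partial>lborel \<partial>lborel \<partial>lborel)"
    by (intro nn_integral_cong lborel_pair.Fubini') simp
  also have "\<dots> = (\<integral>\<^sup>+s. \<integral>\<^sup>+t. ennreal (h s) * ennreal (h' t) * ennreal (heat (s + t) x) * (indicator {0<..} s * indicator {0<..} t) \<partial>lborel \<partial>lborel)"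
  proof (intro nn_integral_cong)
    fix s t :: real
    have "(\<integral>\<^sup>+y. ennreal (h s) * ennreal (heat s (x - y)) * (ennreal (h' t) * ennreal (heat t y)) \<partial>lborel)
        = (\<integral>\<^sup>+y. ennreal (h s) * ennreal (h' t) * ennreal (heat s (x - y) * heat t y) \<partial>lborel)"
      by (intro nn_integral_cong) (simp add: ennreal_mult' mult_ac)
    also have "\<dots> = ennreal (h s) * ennreal (h' t) * (\<integral>\<^sup>+y. ennreal (heat s (x - y) * heat t y) \<partial>lborel)"
      by (rule nn_integral_cmult) simp
    also have "\<dots> = ennreal (h s) * ennreal (h' t) * ennreal (heat (s + t) x) * (indicator {0<..} s * indicator {0<..} t)"
      by (cases "0 < s"; cases "0 < t") (simp_all add: nn_integral_heat_conv)
    finally show "(\<integral>\<^sup>+y. ennreal (h s) * ennreal (heat s (x - y)) * (ennreal (h' t) * ennreal (heat t y)) \<partial>lborel)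
        = ennreal (h s) * ennreal (h' t) * ennreal (heat (s + t) x) * (indicator {0<..} s * indicator {0<..} t)" .
  qed
  also have "\<dots> = (\<integral>\<^sup>+s. \<integral>\<^sup>+\<tau>. ennreal (h s) * ennreal (h' (\<tau> - s)) * ennreal (heat \<tau> x) * (indicator {0<..} s * indicator {0<..} (\<tau> - s)) \<partial>lborel \<partial>lborel)"
  \<comment> \<open>Substitution \<open>\<tau> = s + t\<close> for fixed \<open>s\<close>.\<close>
  proof (rule nn_integral_cong)
    fix s :: real
    define F where "F = (\<lambda>\<tau>. ennreal (h s) * ennreal (h' (\<tau> - s)) * ennreal (heat \<tau> x) * (indicator {0<..} s * indicator {0<..} (\<tau> - s)))"
    have [measurable]: "F \<in> borel_measurable borel" unfolding F_def by measurable
    have "(\<integral>\<^sup>+t. F (t + s) \<partial>lborel) = (\<integral>\<^sup>+\<tau>. F \<tau> \<partial>lborel)"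
      by (rule nn_integral_lborel_shift) measurable
    then show "(\<integral>\<^sup>+t. ennreal (h s) * ennreal (h' t) * ennreal (heat (s + t) x) * (indicator {0<..} s * indicator {0<..} t) \<partial>lborel)
      = (\<integral>\<^sup>+\<tau>. ennreal (h s) * ennreal (h' (\<tau> - s)) * ennreal (heat \<tau> x) * (indicator {0<..} s * indicator {0<..} (\<tau> - s)) \<partial>lborel)"
      by (simp add: F_def add.commute)
  qed
  also have "\<dots> = (\<integral>\<^sup>+\<tau>. \<integral>\<^sup>+s. ennreal (h s) * ennreal (h' (\<tau> - s)) * ennreal (heat \<tau> x) * (indicator {0<..} s * indicator {0<..} (\<tau> - s)) \<partial>lborel \<partial>lborel)"
    by (rule lborel_pair.Fubini') simp
  also have "\<dots> = (\<integral>\<^sup>+\<tau>. (\<integral>\<^sup>+s. ennreal (h s) * ennreal (h' (\<tau> - s)) * indicator {0<..<\<tau>} s \<partial>lborel) * ennreal (heat \<tau> x) \<partial>lborel)"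
  proof (rule nn_integral_cong)
    fix \<tau> :: real
    have "(\<integral>\<^sup>+s. ennreal (h s) * ennreal (h' (\<tau> - s)) * indicator {0<..<\<tau>} s * ennreal (heat \<tau> x) \<partial>lborel)
      = (\<integral>\<^sup>+s. ennreal (h s) * ennreal (h' (\<tau> - s)) * indicator {0<..<\<tau>} s \<partial>lborel) * ennreal (heat \<tau> x)"
      by (rule nn_integral_multc) measurable
    moreover have "ennreal (h s) * ennreal (h' (\<tau> - s)) * ennreal (heat \<tau> x) * (indicator {0<..} s * indicator {0<..} (\<tau> - s))
       = ennreal (h s) * ennreal (h' (\<tau> - s)) * indicator {0<..<\<tau>} s * ennreal (heat \<tau> x)" for s
      by (simp add: indicator_def)
    ultimately show "(\<integral>\<^sup>+s. ennreal (h s) * ennreal (h' (\<tau> - s)) * ennreal (heat \<tau> x) * (indicator {0<..} s * indicator {0<..} (\<tau> - s)) \<partial>lborel)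
      = (\<integral>\<^sup>+s. ennreal (h s) * ennreal (h' (\<tau> - s)) * indicator {0<..<\<tau>} s \<partial>lborel) * ennreal (heat \<tau> x)"
      by simp
  qed
  finally show ?thesis .
qed

text \<open>The value on the unit sphere of the mixture with weight
  \<open>t powr (\<gamma> - 1)\<close>. Substituting \<open>1 / s\<close> identifies it, for
  \<open>\<gamma> < n / 2\<close>, as \<open>Gamma (n / 2 - \<gamma>) / pi powr (n / 2)\<close>; the
  proof works with its finiteness and positivity alone.\<close>

definition subord_const :: "nat \<Rightarrow> real \<Rightarrow> real" where
  "subord_const n \<gamma> = enn2real (\<integral>\<^sup>+s. ennreal (s powr (\<gamma> - 1) * exp (- 1 / s) / sqrt (pi * s) ^ n) * indicator {0<..} s \<partial>lborel)"

lemma sqrt_power_powr: "0 < s \<Longrightarrow> sqrt s ^ n = s powr (real n / 2)"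
  by (simp add: powr_half_sqrt[symmetric] powr_realpow[symmetric] powr_powr)

text \<open>At infinity the integrand decays like \<open>s powr (\<gamma> - 1 - n / 2)\<close>,
  which is integrable because \<open>\<gamma> < n / 2\<close>; near 0 the factor
  \<open>exp (- 1 / s)\<close> beats every power, so negative \<open>\<gamma>\<close> are covered as
  well. The values \<open>\<beta>\<close>, \<open>- \<beta>\<close> and \<open>\<beta> - 1\<close>
  all occur later.\<close>

lemma subord_const_aux:
  assumes "\<gamma> < real n / 2"
  shows "(\<integral>\<^sup>+s. ennreal (s powr (\<gamma> - 1) * exp (- 1 / s) / sqrt (pi * s) ^ n) * indicator {0<..} s \<partial>lborel) < \<infinity>" (is "?I < _")
    and "0 < (\<integral>\<^sup>+s. ennreal (s powr (\<gamma> - 1) * exp (- 1 / s) / sqrt (pi * s) ^ n) * indicator {0<..} s \<partial>lborel)"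
proof -
  define p where "p = \<gamma> - 1 - real n / 2"
  \<comment> \<open>The least natural number with \<open>p + m \<ge> 0\<close>: the \<open>m\<close>
    powers of \<open>s\<close> gained from \<open>exp (- 1 / s)\<close> then outweigh
    \<open>s powr p\<close> on (0, 1].\<close>
  define m where "m = nat \<lceil>- p\<rceil>"
  have p: "p < -1" using assms by (simp add: p_def)
  have m: "0 \<le> p + real m" "0 < m" using p by (simp_all add: m_def) linarith
  have le: "s powr (\<gamma> - 1) * exp (- 1 / s) / sqrt (pi * s) ^ n \<le> s powr p * exp (- 1 / s)" if "0 < s" for s
  proof -
    have "s powr (real n / 2) \<le> sqrt (pi * s) ^ n"
      unfolding sqrt_power_powr[OF that, symmetric]
      using that pi_ge_two by (intro power_mono) auto
    then have "s powr (\<gamma> - 1) * exp (- 1 / s) / sqrt (pi * s) ^ n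
        \<le> s powr (\<gamma> - 1) * exp (- 1 / s) / s powr (real n / 2)"
      using that by (intro divide_left_mono) auto
    also have "\<dots> = s powr p * exp (- 1 / s)"
      by (simp add: p_def powr_diff)
    finally show ?thesis .
  qed
  \<comment> \<open>\<open>(1 + y / m) ^ m \<le> exp y\<close> with \<open>y = 1 / s\<close> yields
    \<open>exp (- 1 / s) \<le> m ^ m * s ^ m\<close>.\<close>
  have near: "s powr p * exp (- 1 / s) \<le> real m ^ m" if "0 < s" "s \<le> 1" for s
  proof -
    have "(1 / (real m * s)) ^ m \<le> (1 + (1 / s) / real m) ^ m"
      using that m by (intro power_mono) (auto simp: field_simps)
    also have "\<dots> \<le> exp (1 / s)"
    proof (rule exp_ge_one_plus_x_over_n_power_n)
      show "- real m \<le> 1 / s" using that by (simp add: order_trans[of _ 0])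
    qed (use m in simp)
    finally have "exp (- 1 / s) \<le> real m ^ m * s ^ m"
      using that m by (simp add: exp_minus field_simps)
    then have "s powr p * exp (- 1 / s) \<le> s powr p * (real m ^ m * s ^ m)"
      by (intro mult_left_mono) auto
    also have "\<dots> = real m ^ m * s powr (p + real m)"
      using that by (simp add: powr_add powr_realpow)
    also have "\<dots> \<le> real m ^ m * 1"
      using that m by (intro mult_left_mono powr_le1) auto
    finally show ?thesis by simp
  qed
  have "?I \<le> (\<integral>\<^sup>+s. ennreal (real m ^ m) * indicator {0<..1} s + ennreal (s powr p) * indicator {1<..} s \<partial>lborel)"
  proof (rule nn_integral_mono)
    fix s :: real
    have "s powr p * exp (- (1 / s)) \<le> s powr p" if "0 < s"
      using that by (intro mult_left_le) auto
    then have "s powr (\<gamma> - 1) * exp (- 1 / s) / sqrt (pi * s) ^ n \<le> s powr p" if "0 < s"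
      using le[of s] that by (auto intro: order_trans)
    with le[of s] near[of s]
    show "ennreal (s powr (\<gamma> - 1) * exp (- 1 / s) / sqrt (pi * s) ^ n) * indicator {0<..} s
        \<le> ennreal (real m ^ m) * indicator {0<..1} s + ennreal (s powr p) * indicator {1<..} s"
      by (cases "s \<le> 0"; cases "s \<le> 1") (auto simp: indicator_def intro!: ennreal_leI)
  qed
  also have "\<dots> = ennreal (real m ^ m) + ennreal (- (1 powr (p + 1)) / (p + 1))"
    by (subst nn_integral_add) (simp_all add: nn_integral_powr_Ioi[OF p] nn_integral_cmult)
  finally show "?I < \<infinity>"
    by (auto simp: top_unique less_top[symmetric])
  show "0 < ?I"
  proof (rule ccontr)
    assume "\<not> 0 < ?I"
    then have "?I = 0" by simp
    then have "AE s in lborel. ennreal (s powr (\<gamma> - 1) * exp (- 1 / s) / sqrt (pi * s) ^ n) * indicator {0<..} s = 0"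
      by (subst (asm) nn_integral_0_iff_AE) auto
    then have "AE s in lborel. s \<notin> {0<..<1::real}"
    proof eventually_elim
      case (elim s)
      define E where "E = s powr (\<gamma> - 1) * exp (- 1 / s) / sqrt (pi * s) ^ n"
      have "0 < E" if "0 < s"
        using that by (simp add: E_def)
      with elim[folded E_def] show ?case
        by (auto simp: indicator_def ennreal_eq_0_iff split: if_splits)
    qed
    then have "emeasure lborel {0<..<1::real} = 0"
      by (subst (asm) AE_iff_measurable[where N = "{0<..<1}"]) auto
    then show False by simp
  qed
qed

lemma subord_const_pos: "\<gamma> < real n / 2 \<Longrightarrow> 0 < subord_const n \<gamma>"
  using subord_const_aux[of \<gamma> n] by (simp add: subord_const_def enn2real_positive_iff)

text \<open>Scaling \<open>t = c * s\<close> with \<open>c\<close> the squared norm reduces the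
  mixture at \<open>x\<close> to the one on the unit sphere. Taking
  \<open>\<gamma> = \<beta>\<close> gives the Riesz kernel, \<open>\<gamma> = - \<beta>\<close> the
  kernel of the fractional Laplacian, and \<open>\<gamma> = \<beta> - 1\<close> the off-diagonal
  bound for the residual.\<close>

lemma subord_powr:
  fixes x :: "'a::euclidean_space"
  assumes "\<gamma> < real DIM('a) / 2" "x \<noteq> 0"
  shows "subord (\<lambda>t. t powr (\<gamma> - 1)) x = ennreal (subord_const DIM('a) \<gamma> * norm x powr (2 * \<gamma> - real DIM('a)))"
proof -
  define c where "c = (norm x)\<^sup>2"
  have c: "0 < c" "sqrt c = norm x" using assms by (auto simp: c_def)
  let ?n = "DIM('a)"
  have eq: "c * ((c * s) powr (\<gamma> - 1) * heat (c * s) x)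
      = norm x powr (2 * \<gamma> - real ?n) * (s powr (\<gamma> - 1) * exp (- 1 / s) / sqrt (pi * s) ^ ?n)" if s: "0 < s" for s
  proof -
    have "c * ((c * s) powr (\<gamma> - 1) * heat (c * s) x)
        = c * c powr (\<gamma> - 1) / sqrt c ^ ?n * (s powr (\<gamma> - 1) * exp (- 1 / s) / sqrt (pi * s) ^ ?n)"
      using s c by (simp add: heat_def powr_mult real_sqrt_mult power_mult_distrib mult_ac c_def[symmetric])
    moreover have "c * c powr (\<gamma> - 1) / sqrt c ^ ?n = norm x powr (2 * \<gamma> - real ?n)"
    proof -
      have "c * c powr (\<gamma> - 1) = c powr \<gamma>"
        using c by (simp add: powr_diff)
      also have "\<dots> = norm x powr (2 * \<gamma>)"
        using assms unfolding c_def by (simp add: powr_powr flip: powr_numeral)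
      finally show ?thesis
        using assms c by (simp add: powr_diff powr_realpow)
    qed
    ultimately show ?thesis by simp
  qed
  have "subord (\<lambda>t. t powr (\<gamma> - 1)) x
      = ennreal c * (\<integral>\<^sup>+s. ennreal ((c * s) powr (\<gamma> - 1)) * ennreal (heat (c * s) x) \<partial>lborel)"
    unfolding subord_def
    by (subst nn_integral_real_affine[where c = c and t = 0]) (use c in auto)
  also have "\<dots> = (\<integral>\<^sup>+s. ennreal c * (ennreal ((c * s) powr (\<gamma> - 1)) * ennreal (heat (c * s) x)) \<partial>lborel)"
    by (rule nn_integral_cmult[symmetric]) measurable
  also have "\<dots> = (\<integral>\<^sup>+s. ennreal (norm x powr (2 * \<gamma> - real ?n)) * (ennreal (s powr (\<gamma> - 1) * exp (- 1 / s) / sqrt (pi * s) ^ ?n) * indicator {0<..} s) \<partial>lborel)"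
  proof (rule nn_integral_cong)
    fix s :: real
    show "ennreal c * (ennreal ((c * s) powr (\<gamma> - 1)) * ennreal (heat (c * s) x))
      = ennreal (norm x powr (2 * \<gamma> - real ?n)) * (ennreal (s powr (\<gamma> - 1) * exp (- 1 / s) / sqrt (pi * s) ^ ?n) * indicator {0<..} s)"
    proof (cases "0 < s")
      case True
      then show ?thesis
        using eq[OF True] c by (simp add: ennreal_mult'[symmetric] ennreal_mult''[symmetric])
    next
      case False
      then have "c * s \<le> 0" using c by (simp add: mult_nonneg_nonpos)
      then show ?thesis using False by simp
    qed
  qed
  also have "\<dots> = ennreal (norm x powr (2 * \<gamma> - real ?n)) * (\<integral>\<^sup>+s. ennreal (s powr (\<gamma> - 1) * exp (- 1 / s) / sqrt (pi * s) ^ ?n) * indicator {0<..} s \<partial>lborel)"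
    by (rule nn_integral_cmult) measurable
  also have "(\<integral>\<^sup>+s. ennreal (s powr (\<gamma> - 1) * exp (- 1 / s) / sqrt (pi * s) ^ ?n) * indicator {0<..} s \<partial>lborel) = ennreal (subord_const ?n \<gamma>)"
    unfolding subord_const_def using subord_const_aux(1)[OF assms(1)] by simp
  finally show ?thesis
    by (simp add: ennreal_mult'[symmetric] ennreal_mult''[symmetric] mult.commute)
qed

section \<open>Green kernel, truncated jump kernel and their residual\<close>

locale riesz_order =
  fixes \<beta> :: real and dim :: "'a::euclidean_space itself"
  assumes beta: "0 < \<beta>" "\<beta> < 1" "2 * \<beta> < real DIM('a)"
begin

text \<open>Off the origin a constant multiple of the Riesz kernel of order
  \<open>\<alpha> = 2 * \<beta>\<close>; the third condition of the locale is
  \<open>\<alpha> < n\<close>.\<close>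

definition green :: "'a \<Rightarrow> ennreal" where
  "green = subord (\<lambda>t. t powr (\<beta> - 1))"

text \<open>Cutting the weight at \<open>t = \<epsilon>\<close> keeps the kernel positive everywhere
  but makes its mass finite; without the cut the mixture is a multiple of
  \<open>norm x powr (- n - 2 * \<beta>)\<close>.\<close>

definition jump :: "real \<Rightarrow> 'a \<Rightarrow> ennreal" where
  "jump \<epsilon> = subord (\<lambda>t. indicator {\<epsilon><..} t * t powr (- \<beta> - 1))"

text \<open>The weight of the mixture \<open>(\<integral>J\<^sub>\<epsilon>) G - J\<^sub>\<epsilon> * G\<close>, obtained from the beta integral below.\<close>

definition resid_density :: "real \<Rightarrow> real \<Rightarrow> real" where
  "resid_density \<epsilon> t = (t powr \<beta> - max 0 (t - \<epsilon>) powr \<beta>) / (\<beta> * t * \<epsilon> powr \<beta>)"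

definition resid :: "real \<Rightarrow> 'a \<Rightarrow> ennreal" where
  "resid \<epsilon> = subord (resid_density \<epsilon>)"

lemma borel_measurable_green [measurable]: "green \<in> borel_measurable borel"
  unfolding green_def by measurable

lemma borel_measurable_jump [measurable]: "jump \<epsilon> \<in> borel_measurable borel"
  unfolding jump_def by measurable

lemma borel_measurable_resid_density [measurable]: "resid_density \<epsilon> \<in> borel_measurable borel"
  unfolding resid_density_def[abs_def] by measurable

lemma borel_measurable_resid [measurable]: "resid \<epsilon> \<in> borel_measurable borel"
  unfolding resid_def by measurable

lemma jump_minus [simp]: "jump \<epsilon> (- x) = jump \<epsilon> x"
  by (simp add: jump_def)

lemma resid_density_nonneg: "0 \<le> \<epsilon> \<Longrightarrow> 0 < t \<Longrightarrow> 0 \<le> resid_density \<epsilon> t"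
  unfolding resid_density_def using beta
  by (intro divide_nonneg_nonneg mult_nonneg_nonneg) (auto intro!: powr_mono2)

lemma nn_integral_jump:
  assumes "0 < \<epsilon>"
  shows "(\<integral>\<^sup>+x. jump \<epsilon> x \<partial>lborel) = ennreal (\<epsilon> powr (- \<beta>) / \<beta>)"
proof -
  have "(\<integral>\<^sup>+x. jump \<epsilon> x \<partial>lborel) = (\<integral>\<^sup>+t. ennreal (t powr (- \<beta> - 1)) * indicator {\<epsilon><..} t \<partial>lborel)"
    unfolding jump_def using assms
    by (subst nn_integral_subord) (auto intro!: nn_integral_cong simp: indicator_def)
  also have "\<dots> = ennreal (\<epsilon> powr (- \<beta>) / \<beta>)"
    using beta assms by (subst nn_integral_powr_Ioi) auto
  finally show ?thesis .
qed

text \<open>The substitution \<open>v = (\<tau> - s) / s\<close> turns the integrand into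
  \<open>- v powr (\<beta> - 1) / \<tau>\<close>, which explains the antiderivative
  \<open>F\<close>. Since \<open>\<beta> < 1\<close> the integrand is singular at
  \<open>s = \<tau>\<close>, so the fundamental theorem is applied on the open interval with
  one-sided limits of \<open>F\<close>.\<close>

lemma beta_integral:
  assumes "0 < \<epsilon>" "0 < \<tau>"
  shows "(\<integral>\<^sup>+s. ennreal (indicator {\<epsilon><..} s * s powr (- \<beta> - 1)) * ennreal ((\<tau> - s) powr (\<beta> - 1)) * indicator {0<..<\<tau>} s \<partial>lborel)
    = ennreal (max 0 (\<tau> - \<epsilon>) powr \<beta> / (\<beta> * \<tau> * \<epsilon> powr \<beta>))"
proof (cases "\<epsilon> < \<tau>")
  case False
  then have "(\<integral>\<^sup>+s. ennreal (indicator {\<epsilon><..} s * s powr (- \<beta> - 1)) * ennreal ((\<tau> - s) powr (\<beta> - 1)) * indicator {0<..<\<tau>} s \<partial>lborel)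
      = (\<integral>\<^sup>+s. 0 \<partial>(lborel :: real measure))"
    by (intro nn_integral_cong) (auto simp: indicator_def)
  then show ?thesis using False by simp
next
  case True
  define f where "f s = s powr (- \<beta> - 1) * (\<tau> - s) powr (\<beta> - 1)" for s
  define F where "F s = - (((\<tau> - s) / s) powr \<beta> / (\<beta> * \<tau>))" for s
  have D: "DERIV F s :> f s" if "\<epsilon> < s" "s < \<tau>" for s
  proof -
    have pos: "0 < s" "0 < (\<tau> - s) / s" "0 < \<tau>" using that assms by auto
    have "(F has_real_derivative - ((\<beta> * ((\<tau> - s) / s) powr (\<beta> - 1) * (((0 - 1) * s - (\<tau> - s) * 1) / (s * s))) / (\<beta> * \<tau>))) (at s)"
      unfolding F_def using pos beta
      by (auto intro!: derivative_eq_intros simp: powr_diff divide_simps)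
    also have "- ((\<beta> * ((\<tau> - s) / s) powr (\<beta> - 1) * (((0 - 1) * s - (\<tau> - s) * 1) / (s * s))) / (\<beta> * \<tau>))
        = ((\<tau> - s) / s) powr (\<beta> - 1) / s powr 2"
      using pos beta by (simp add: divide_simps powr_numeral power2_eq_square)
    also have "\<dots> = f s"
    proof -
      have "s powr (-\<beta> - 1) = 1 / s powr (\<beta> - 1) / s powr 2"
        using pos by (simp add: powr_diff powr_minus powr_numeral power2_eq_square field_simps)
      then show ?thesis
        using pos that by (simp add: f_def powr_divide)
    qed
    finally show ?thesis .
  qed
  have cont: "isCont f s" if "\<epsilon> < s" "s < \<tau>" for s
    unfolding f_def using that assms by (intro continuous_intros) auto
  have A: "((F \<circ> real_of_ereal) \<longlongrightarrow> F \<epsilon>) (at_right (ereal \<epsilon>))"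
    unfolding ereal_tendsto_simps F_def using assms True beta
    by (intro tendsto_intros) auto
  have B: "((F \<circ> real_of_ereal) \<longlongrightarrow> 0) (at_left (ereal \<tau>))"
  proof -
    have "(F \<longlongrightarrow> - (((\<tau> - \<tau>) / \<tau>) powr \<beta> / (\<beta> * \<tau>))) (at_left \<tau>)"
      unfolding F_def using assms True beta
      by (intro tendsto_minus tendsto_divide tendsto_const tendsto_powr2 tendsto_diff tendsto_ident_at)
         (auto simp: eventually_at_left intro!: exI[of _ 0] exI[of _ \<epsilon>])
    then show ?thesis unfolding ereal_tendsto_simps by simp
  qed
  have lt: "ereal \<epsilon> < ereal \<tau>" using True by simp
  have fnn: "AE x in lborel. ereal \<epsilon> < ereal x \<longrightarrow> ereal x < ereal \<tau> \<longrightarrow> 0 \<le> f x"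
    by (simp add: f_def)
  note ftc = interval_integral_FTC_nonneg[OF lt _ _ fnn A B]
  have int: "set_integrable lborel {\<epsilon><..<\<tau>} f"
    using ftc(1) D cont by simp
  have val: "(LBINT x:{\<epsilon><..<\<tau>}. f x) = 0 - F \<epsilon>"
    using ftc(2) D cont True by (simp add: interval_lebesgue_integral_def)
  have "(\<integral>\<^sup>+s. ennreal (indicator {\<epsilon><..} s * s powr (- \<beta> - 1)) * ennreal ((\<tau> - s) powr (\<beta> - 1)) * indicator {0<..<\<tau>} s \<partial>lborel)
      = (\<integral>\<^sup>+s. ennreal (indicator {\<epsilon><..<\<tau>} s *\<^sub>R f s) \<partial>lborel)"
    using assms by (intro nn_integral_cong) (auto simp: indicator_def f_def ennreal_mult')
  also have "\<dots> = ennreal (LBINT x:{\<epsilon><..<\<tau>}. f x)"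
    unfolding set_lebesgue_integral_def using int
    by (intro nn_integral_eq_integral) (auto simp: set_integrable_def f_def indicator_def)
  also have "\<dots> = ennreal (max 0 (\<tau> - \<epsilon>) powr \<beta> / (\<beta> * \<tau> * \<epsilon> powr \<beta>))"
    using True assms by (simp add: val F_def powr_divide mult.commute)
  finally show ?thesis .
qed

text \<open>The convolved weight from \<open>beta_integral\<close> and \<open>resid_density\<close>
  add up to a multiple of \<open>t powr (\<beta> - 1)\<close>. The residual stands on the left
  because subtraction in \<open>ennreal\<close> is truncated.\<close>

lemma jump_green:
  assumes "0 < \<epsilon>"
  shows "(\<integral>\<^sup>+y. jump \<epsilon> (x - y) * green y \<partial>lborel) + resid \<epsilon> x = ennreal (\<epsilon> powr (- \<beta>) / \<beta>) * green x"
proof -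
  let ?c = "\<lambda>t. max 0 (t - \<epsilon>) powr \<beta> / (\<beta> * t * \<epsilon> powr \<beta>)"
  have "(\<integral>\<^sup>+y. jump \<epsilon> (x - y) * green y \<partial>lborel) = subord ?c x"
  proof -
    have "(\<integral>\<^sup>+y. jump \<epsilon> (x - y) * green y \<partial>lborel)
        = (\<integral>\<^sup>+t. (\<integral>\<^sup>+s. ennreal (indicator {\<epsilon><..} s * s powr (- \<beta> - 1)) * ennreal ((t - s) powr (\<beta> - 1)) * indicator {0<..<t} s \<partial>lborel) * ennreal (heat t x) \<partial>lborel)"
      unfolding jump_def green_def by (rule subord_conv) measurable
    also have "\<dots> = subord ?c x"
      unfolding subord_def
    proof (rule nn_integral_cong)
      fix t :: real
      show "(\<integral>\<^sup>+s. ennreal (indicator {\<epsilon><..} s * s powr (- \<beta> - 1)) * ennreal ((t - s) powr (\<beta> - 1)) * indicator {0<..<t} s \<partial>lborel) * ennreal (heat t x)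
         = ennreal (?c t) * ennreal (heat t x)"
        by (cases "0 < t") (simp_all add: beta_integral assms)
    qed
    finally show ?thesis .
  qed
  then have "(\<integral>\<^sup>+y. jump \<epsilon> (x - y) * green y \<partial>lborel) + resid \<epsilon> x = subord (\<lambda>t. ?c t + resid_density \<epsilon> t) x"
    unfolding resid_def using beta assms
    by (subst subord_add) (auto intro!: divide_nonneg_nonneg resid_density_nonneg)
  also have "\<dots> = subord (\<lambda>t. (\<epsilon> powr (- \<beta>) / \<beta>) * t powr (\<beta> - 1)) x"
    using beta assms
    by (intro subord_cong) (simp add: resid_density_def add_divide_distrib[symmetric] powr_minus_divide powr_diff)
  also have "\<dots> = ennreal (\<epsilon> powr (- \<beta>) / \<beta>) * green x"
    unfolding green_def using beta by (intro subord_cmult) auto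
  finally show ?thesis .
qed

text \<open>The increment of \<open>t powr \<beta>\<close> over a step of length
  \<open>\<epsilon>\<close> is at most \<open>\<epsilon> * t powr (\<beta> - 1)\<close>; for
  \<open>t > \<epsilon>\<close> this amounts to \<open>\<theta> \<le> \<theta> powr \<beta>\<close>
  for the ratio \<open>\<theta> = (t - \<epsilon>) / t\<close>, which is at most 1.\<close>

lemma resid_density_le:
  assumes "0 < \<epsilon>" "0 < t"
  shows "resid_density \<epsilon> t \<le> \<epsilon> powr (1 - \<beta>) / \<beta> * t powr (\<beta> - 2)"
proof -
  have "t powr \<beta> - max 0 (t - \<epsilon>) powr \<beta> \<le> \<epsilon> * t powr (\<beta> - 1)"
  proof (cases "t \<le> \<epsilon>")
    case True
    have "t powr \<beta> = t * t powr (\<beta> - 1)" using assms by (simp add: powr_diff)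
    also have "\<dots> \<le> \<epsilon> * t powr (\<beta> - 1)" using True by (intro mult_right_mono) auto
    finally show ?thesis using True by simp
  next
    case False
    have "t powr \<beta> * ((t - \<epsilon>) / t) powr 1 \<le> t powr \<beta> * ((t - \<epsilon>) / t) powr \<beta>"
      using False assms beta by (intro mult_left_mono powr_mono') auto
    also have "\<dots> = (t - \<epsilon>) powr \<beta>"
      using False assms by (simp add: powr_divide)
    finally show ?thesis
      using False assms by (simp add: powr_diff field_simps)
  qed
  then have "resid_density \<epsilon> t \<le> \<epsilon> * t powr (\<beta> - 1) / (\<beta> * t * \<epsilon> powr \<beta>)"
    unfolding resid_density_def using assms beta by (intro divide_right_mono) auto
  also have "\<dots> = \<epsilon> powr (1 - \<beta>) / \<beta> * t powr (\<beta> - 2)"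
    using assms by (simp add: powr_diff powr_numeral power2_eq_square)
  finally show ?thesis .
qed

text \<open>Away from the origin the residual is \<open>O(\<epsilon> powr (1 - \<beta>))\<close>,
  while its mass does not depend on \<open>\<epsilon>\<close> (\<open>nn_integral_resid\<close>):
  together these make it an approximate identity.\<close>

lemma resid_le:
  assumes "0 < \<epsilon>" "x \<noteq> 0"
  shows "resid \<epsilon> x \<le> ennreal (\<epsilon> powr (1 - \<beta>) / \<beta> * subord_const DIM('a) (\<beta> - 1) * norm x powr (2 * \<beta> - 2 - real DIM('a)))"
proof -
  have "resid \<epsilon> x \<le> subord (\<lambda>t. \<epsilon> powr (1 - \<beta>) / \<beta> * t powr ((\<beta> - 1) - 1)) x"
    unfolding resid_def by (intro subord_mono) (use resid_density_le[OF assms(1)] in simp)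
  also have "\<dots> = ennreal (\<epsilon> powr (1 - \<beta>) / \<beta>) * subord (\<lambda>t. t powr ((\<beta> - 1) - 1)) x"
    using beta by (intro subord_cmult) auto
  also have "\<dots> = ennreal (\<epsilon> powr (1 - \<beta>) / \<beta> * subord_const DIM('a) (\<beta> - 1) * norm x powr (2 * \<beta> - 2 - real DIM('a)))"
    using beta assms
    by (subst subord_powr) (auto simp: ennreal_mult'[symmetric] algebra_simps)
  finally show ?thesis .
qed

definition resid_mass :: real where
  "resid_mass = enn2real (\<integral>\<^sup>+t. ennreal (resid_density 1 t) * indicator {0<..} t \<partial>lborel)"

lemma resid_mass_aux:
  shows "(\<integral>\<^sup>+t. ennreal (resid_density 1 t) * indicator {0<..} t \<partial>lborel) < \<infinity>" (is "?I < _")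
    and "0 < (\<integral>\<^sup>+t. ennreal (resid_density 1 t) * indicator {0<..} t \<partial>lborel)"
proof -
  have small: "resid_density 1 t = (1 / \<beta>) * t powr (\<beta> - 1)" if "0 < t" "t \<le> 1" for t
    using that beta by (simp add: resid_density_def powr_diff)
  have "?I \<le> (\<integral>\<^sup>+t. ennreal (1 / \<beta>) * (ennreal (t powr (\<beta> - 1)) * indicator {0<..1} t) + ennreal (1 / \<beta>) * (ennreal (t powr (\<beta> - 2)) * indicator {1<..} t) \<partial>lborel)"
  proof (rule nn_integral_mono)
    fix t :: real
    show "ennreal (resid_density 1 t) * indicator {0<..} t
      \<le> ennreal (1 / \<beta>) * (ennreal (t powr (\<beta> - 1)) * indicator {0<..1} t) + ennreal (1 / \<beta>) * (ennreal (t powr (\<beta> - 2)) * indicator {1<..} t)"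
      using resid_density_le[of 1 t] small[of t] beta
      by (cases "t \<le> 0"; cases "t \<le> 1") (auto simp: indicator_def ennreal_mult'[symmetric] intro!: ennreal_leI)
  qed
  also have "\<dots> = ennreal (1 / \<beta>) * ennreal (1 powr (\<beta> - 1 + 1) / (\<beta> - 1 + 1)) + ennreal (1 / \<beta>) * ennreal (- (1 powr (\<beta> - 2 + 1)) / (\<beta> - 2 + 1))"
    using beta by (subst nn_integral_add) (simp_all add: nn_integral_powr_Ioi nn_integral_powr_Ioc nn_integral_cmult)
  also have "\<dots> < \<infinity>"
    by (simp add: ennreal_mult_less_top)
  finally show "?I < \<infinity>" .
  have "0 < ennreal (1 / \<beta>) * ennreal (1 powr (\<beta> - 1 + 1) / (\<beta> - 1 + 1))"
    using beta by (simp add: ennreal_mult'[symmetric])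
  also have "\<dots> = (\<integral>\<^sup>+t. ennreal (1 / \<beta>) * (ennreal (t powr (\<beta> - 1)) * indicator {0<..1} t) \<partial>lborel)"
    using beta by (simp add: nn_integral_powr_Ioc nn_integral_cmult)
  also have "\<dots> \<le> ?I"
    using small beta by (intro nn_integral_mono) (auto simp: indicator_def ennreal_mult'[symmetric])
  finally show "0 < ?I" .
qed

lemma resid_mass_pos: "0 < resid_mass"
  using resid_mass_aux by (simp add: resid_mass_def enn2real_positive_iff)

text \<open>Substituting \<open>\<epsilon> * t\<close> for \<open>t\<close> removes
  \<open>\<epsilon>\<close>, because \<open>\<epsilon> * resid_density \<epsilon> (\<epsilon> * t) =
  resid_density 1 t\<close>.\<close>

lemma nn_integral_resid:
  assumes "0 < \<epsilon>"
  shows "(\<integral>\<^sup>+x. resid \<epsilon> x \<partial>lborel) = ennreal resid_mass"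
proof -
  have "(\<integral>\<^sup>+x. resid \<epsilon> x \<partial>lborel) = (\<integral>\<^sup>+t. ennreal (resid_density \<epsilon> t) * indicator {0<..} t \<partial>lborel)"
    unfolding resid_def by (rule nn_integral_subord) measurable
  also have "\<dots> = ennreal \<epsilon> * (\<integral>\<^sup>+t. ennreal (resid_density \<epsilon> (\<epsilon> * t)) * indicator {0<..} (\<epsilon> * t) \<partial>lborel)"
    by (subst nn_integral_real_affine[where c = \<epsilon> and t = 0]) (use assms in auto)
  also have "\<dots> = (\<integral>\<^sup>+t. ennreal \<epsilon> * (ennreal (resid_density \<epsilon> (\<epsilon> * t)) * indicator {0<..} (\<epsilon> * t)) \<partial>lborel)"
    by (rule nn_integral_cmult[symmetric]) measurable
  also have "\<dots> = (\<integral>\<^sup>+t. ennreal (resid_density 1 t) * indicator {0<..} t \<partial>lborel)"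
  proof (rule nn_integral_cong)
    fix t :: real
    show "ennreal \<epsilon> * (ennreal (resid_density \<epsilon> (\<epsilon> * t)) * indicator {0<..} (\<epsilon> * t)) = ennreal (resid_density 1 t) * indicator {0<..} t"
    proof (cases "0 < t")
      case True
      have "max 0 (\<epsilon> * t - \<epsilon>) = \<epsilon> * max 0 (t - 1)"
        using assms by (simp add: max_mult_distrib_left algebra_simps)
      then have "\<epsilon> * resid_density \<epsilon> (\<epsilon> * t) = resid_density 1 t"
        using True assms
        by (simp add: resid_density_def powr_mult right_diff_distrib[symmetric] del: max_mult_distrib_left)
      then show ?thesis
        using True assms by (simp add: ennreal_mult'[symmetric])
    qed (use assms in \<open>auto simp: indicator_def zero_less_mult_iff\<close>)
  qed
  also have "\<dots> = ennreal resid_mass"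
    unfolding resid_mass_def using resid_mass_aux by simp
  finally show ?thesis .
qed

end

text \<open>Gaussian mixtures replace polar coordinates. For \<open>t \<le> r\<^sup>2\<close> the
  Gaussian has mass at most 1 in the ball; for larger \<open>t\<close> it is at most
  \<open>t powr (- n / 2)\<close>, to be multiplied by the volume of the ball. Both contributions
  scale like \<open>r powr (2 * \<gamma>)\<close>.\<close>

lemma nn_integral_power_ball:
  fixes r \<gamma> :: real
  assumes "0 < \<gamma>" "\<gamma> < real DIM('a::euclidean_space) / 2"
  obtains A where "0 < A" "\<And>r. 0 < r \<Longrightarrow>
    (\<integral>\<^sup>+z. ennreal (norm (z::'a) powr (2 * \<gamma> - real DIM('a))) * indicator {z. norm z < r} z \<partial>lborel) \<le> ennreal (A * r powr (2 * \<gamma>))"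
proof -
  have ball_0_norm: "ball 0 r = {z::'a. norm z < r}" for r
    by (auto simp: dist_norm)
  let ?n = "real DIM('a)" and ?c = "subord_const DIM('a) \<gamma>"
  define V where "V = unit_ball_vol ?n"
  have vol: "emeasure lborel {z::'a. norm z < r} = ennreal (V * r powr ?n)" if "0 < r" for r
    using that emeasure_ball[of r "0::'a"] by (simp add: ball_0_norm V_def powr_realpow)
  have V: "0 \<le> V" by (simp add: V_def)
  have c: "0 < ?c" using assms by (intro subord_const_pos)
  \<comment> \<open>The two summands are the contributions of the two ranges of \<open>t\<close>,
    without the common factor \<open>r powr (2 * \<gamma>)\<close>; dividing by \<open>?c\<close>
    converts the mixture back into the power.\<close>
  define A where "A = (1 / \<gamma> + V / (?n / 2 - \<gamma>)) / ?c"
  have "0 < 1 / \<gamma> + V / (?n / 2 - \<gamma>)"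
    using assms V by (intro add_pos_nonneg divide_nonneg_nonneg) auto
  then have A: "0 < A" using c by (simp add: A_def)
  have "(\<integral>\<^sup>+z. ennreal (norm (z::'a) powr (2 * \<gamma> - ?n)) * indicator {z. norm z < r} z \<partial>lborel) \<le> ennreal (A * r powr (2 * \<gamma>))"
    if r: "0 < r" for r
  proof -
    have "ennreal ?c * (\<integral>\<^sup>+z. ennreal (norm (z::'a) powr (2 * \<gamma> - ?n)) * indicator {z. norm z < r} z \<partial>lborel)
        = (\<integral>\<^sup>+z. ennreal ?c * (ennreal (norm (z::'a) powr (2 * \<gamma> - ?n)) * indicator {z. norm z < r} z) \<partial>lborel)"
      by (rule nn_integral_cmult[symmetric]) measurable
    also have "\<dots> = (\<integral>\<^sup>+z. (\<integral>\<^sup>+t. ennreal (t powr (\<gamma> - 1)) * ennreal (heat t z) * indicator {z. norm z < r} z \<partial>lborel) \<partial>(lborel::'a measure))"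
    proof (rule nn_integral_cong_AE)
      show "AE z::'a in lborel. ennreal ?c * (ennreal (norm z powr (2 * \<gamma> - ?n)) * indicator {z. norm z < r} z)
         = (\<integral>\<^sup>+t. ennreal (t powr (\<gamma> - 1)) * ennreal (heat t z) * indicator {z. norm z < r} z \<partial>lborel)"
        using AE_lborel_singleton[of "0::'a"]
      proof eventually_elim
        case (elim z)
        have "(\<integral>\<^sup>+t. ennreal (t powr (\<gamma> - 1)) * ennreal (heat t z) * indicator {z. norm z < r} z \<partial>lborel)
            = subord (\<lambda>t. t powr (\<gamma> - 1)) z * indicator {z. norm z < r} z"
          unfolding subord_def by (rule nn_integral_multc) measurable
        also have "\<dots> = ennreal ?c * (ennreal (norm z powr (2 * \<gamma> - ?n)) * indicator {z. norm z < r} z)"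
          using subord_powr[OF assms(2) elim] c by (simp add: ennreal_mult' mult.assoc)
        finally show ?case by simp
      qed
    qed
    also have "\<dots> = (\<integral>\<^sup>+t. (\<integral>\<^sup>+z. ennreal (t powr (\<gamma> - 1)) * ennreal (heat t z) * indicator {z. norm z < r} z \<partial>(lborel::'a measure)) \<partial>lborel)"
      by (rule lborel_pair.Fubini') measurable
    also have "\<dots> \<le> (\<integral>\<^sup>+t. ennreal (t powr (\<gamma> - 1)) * indicator {0<..r\<^sup>2} t
        + ennreal (V * r powr ?n) * (ennreal (t powr (\<gamma> - 1 - ?n / 2)) * indicator {r\<^sup>2<..} t) \<partial>lborel)"
    proof (rule nn_integral_mono)
      fix t :: real
      have eq: "(\<integral>\<^sup>+z. ennreal (t powr (\<gamma> - 1)) * ennreal (heat t z) * indicator {z. norm z < r} z \<partial>(lborel::'a measure))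
          = ennreal (t powr (\<gamma> - 1)) * (\<integral>\<^sup>+z. ennreal (heat t z) * indicator {z. norm z < r} z \<partial>(lborel::'a measure))"
        by (simp add: mult.assoc nn_integral_cmult)
      consider "t \<le> 0" | "0 < t" "t \<le> r\<^sup>2" | "0 < t" "r\<^sup>2 < t" by linarith
      then show "(\<integral>\<^sup>+z. ennreal (t powr (\<gamma> - 1)) * ennreal (heat t z) * indicator {z. norm z < r} z \<partial>(lborel::'a measure))
        \<le> ennreal (t powr (\<gamma> - 1)) * indicator {0<..r\<^sup>2} t
        + ennreal (V * r powr ?n) * (ennreal (t powr (\<gamma> - 1 - ?n / 2)) * indicator {r\<^sup>2<..} t)"
      proof cases
        case 1
        then show ?thesis by simp
      next
        case 2
        have "(\<integral>\<^sup>+z. ennreal (heat t z) * indicator {z. norm z < r} z \<partial>(lborel::'a measure)) \<le> (\<integral>\<^sup>+z. ennreal (heat t z) \<partial>(lborel::'a measure))"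
          by (intro nn_integral_mono) (auto simp: indicator_def)
        then have "ennreal (t powr (\<gamma> - 1)) * (\<integral>\<^sup>+z. ennreal (heat t z) * indicator {z. norm z < r} z \<partial>(lborel::'a measure)) \<le> ennreal (t powr (\<gamma> - 1)) * 1"
          using 2 by (intro mult_left_mono) (simp_all add: nn_integral_heat)
        then show ?thesis unfolding eq using 2 by simp
      next
        case 3
        have "(\<integral>\<^sup>+z. ennreal (heat t z) * indicator {z. norm z < r} z \<partial>(lborel::'a measure))
            \<le> (\<integral>\<^sup>+z. ennreal (t powr (- ?n / 2)) * indicator {z. norm z < r} z \<partial>(lborel::'a measure))"
        proof (intro nn_integral_mono mult_right_mono ennreal_leI)
          fix z :: 'a
          have "heat t z \<le> 1 / sqrt t ^ DIM('a)"
            unfolding heat_def using 3 pi_ge_two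
            by (auto intro!: frac_le power_mono)
          also have "\<dots> = t powr (- ?n / 2)"
            using 3 by (simp add: sqrt_power_powr powr_minus_divide)
          finally show "heat t z \<le> t powr (- ?n / 2)" .
        qed auto
        also have "\<dots> = ennreal (t powr (- ?n / 2)) * ennreal (V * r powr ?n)"
          by (subst nn_integral_cmult_indicator) (simp_all add: vol[OF r])
        finally have "ennreal (t powr (\<gamma> - 1)) * (\<integral>\<^sup>+z. ennreal (heat t z) * indicator {z. norm z < r} z \<partial>(lborel::'a measure))
          \<le> ennreal (t powr (\<gamma> - 1)) * (ennreal (t powr (- ?n / 2)) * ennreal (V * r powr ?n))"
          by (intro mult_left_mono) auto
        also have "\<dots> = ennreal (V * r powr ?n) * ennreal (t powr (\<gamma> - 1 - ?n / 2))"
        proof -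
          have "t powr (\<gamma> - 1) * t powr (- ?n / 2) = t powr (\<gamma> - 1 - ?n / 2)"
            by (simp add: powr_add[symmetric])
          then show ?thesis
            by (metis ennreal_mult'' mult.assoc mult.commute powr_ge_zero)
        qed
        finally show ?thesis unfolding eq using 3 by simp
      qed
    qed
    also have "\<dots> = ennreal (r\<^sup>2 powr \<gamma> / \<gamma>) + ennreal (V * r powr ?n) * ennreal (- (r\<^sup>2 powr (\<gamma> - ?n / 2)) / (\<gamma> - ?n / 2))"
      using assms r by (subst nn_integral_add) (simp_all add: nn_integral_cmult nn_integral_powr_Ioi nn_integral_powr_Ioc)
    also have "\<dots> = ennreal (?c * (A * r powr (2 * \<gamma>)))"
    proof -
      have pw: "r\<^sup>2 powr q = r powr (2 * q)" for q
      proof -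
        have "r\<^sup>2 = r powr 2" using r by simp
        then show ?thesis by (simp only: powr_powr)
      qed
      have "V * r powr ?n * (- (r\<^sup>2 powr (\<gamma> - ?n / 2)) / (\<gamma> - ?n / 2)) = V * (r powr ?n * r powr (2 * (\<gamma> - ?n / 2))) / (?n / 2 - \<gamma>)"
      proof -
        have "- x / (\<gamma> - ?n / 2) = x / (?n / 2 - \<gamma>)" for x
          by (metis minus_diff_eq minus_divide_left minus_divide_right)
        then show ?thesis by (simp only: pw times_divide_eq_right mult.assoc)
      qed
      also have "r powr ?n * r powr (2 * (\<gamma> - ?n / 2)) = r powr (2 * \<gamma>)"
        by (simp add: powr_add[symmetric])
      finally have "r\<^sup>2 powr \<gamma> / \<gamma> + V * r powr ?n * (- (r\<^sup>2 powr (\<gamma> - ?n / 2)) / (\<gamma> - ?n / 2)) = ?c * (A * r powr (2 * \<gamma>))"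
        using c by (simp only: pw A_def) (simp add: distrib_right)
      moreover have "ennreal a + ennreal b * ennreal d = ennreal (a + b * d)" if "0 \<le> a" "0 \<le> b" "0 \<le> d" for a b d
        using that by (simp add: ennreal_mult)
      moreover have "0 \<le> - (r\<^sup>2 powr (\<gamma> - ?n / 2)) / (\<gamma> - ?n / 2)" "0 \<le> r\<^sup>2 powr \<gamma> / \<gamma>" "0 \<le> V * r powr ?n"
        using assms V by (auto intro!: divide_nonpos_neg simp del: minus_divide_left[symmetric])
      ultimately show ?thesis by metis
    qed
    also have "\<dots> = ennreal ?c * ennreal (A * r powr (2 * \<gamma>))"
      using c A by (simp add: ennreal_mult')
    finally show ?thesis
      using c by (subst (asm) ennreal_mult_le_mult_iff) auto
  qed
  with A that show ?thesis by blast
qed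

text \<open>The power is dominated by a mixture of finite mass: at distance \<open>R\<close> from
  the origin the parameters between \<open>R\<^sup>2\<close> and \<open>2 * R\<^sup>2\<close> alone
  contribute \<open>B * R powr (- n - p)\<close>.\<close>

lemma nn_integral_power_outside:
  assumes "0 < p" "0 < r"
  shows "(\<integral>\<^sup>+z. ennreal (norm (z::'a::euclidean_space) powr (- real DIM('a) - p)) * indicator {z. r \<le> norm z} z \<partial>lborel) < \<infinity>"
proof -
  let ?n = "real DIM('a)"
  define q where "q = - p / 2 - 1"
  \<comment> \<open>On that window the weight is at least \<open>(2 * R\<^sup>2) powr q\<close>, the
    Gaussian at least \<open>exp (-1) / sqrt (pi * (2 * R\<^sup>2)) ^ n\<close>, and the length is
    \<open>R\<^sup>2\<close>; \<open>B\<close> is what remains once the powers of \<open>R\<close>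
    are collected.\<close>
  define B where "B = 2 powr q * exp (-1) / sqrt (2 * pi) ^ DIM('a)"
  have B: "0 < B" by (simp add: B_def)
  let ?h = "\<lambda>t. indicator {r\<^sup>2<..} t * t powr q"
  have low: "ennreal (B * norm z powr (- ?n - p)) \<le> subord ?h z" if z: "r \<le> norm z" for z :: 'a
  proof -
    define R where "R = norm z"
    have R: "0 < R" "r \<le> R" using assms z by (auto simp: R_def)
    have sq: "r\<^sup>2 \<le> R\<^sup>2" using R assms by (intro power_mono) auto
    have "B * R powr (- ?n - p) = R\<^sup>2 * ((2 * R\<^sup>2) powr q * (exp (-1) / sqrt (pi * (2 * R\<^sup>2)) ^ DIM('a)))"
    proof -
      have "R\<^sup>2 * (R\<^sup>2) powr q / R ^ DIM('a) = R powr (- p - ?n)"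
        using R by (simp add: q_def powr_powr powr_realpow[symmetric] powr_add[symmetric] powr_diff[symmetric] del: powr_numeral)
      then have "B * R powr (- ?n - p) = B * (R\<^sup>2 * (R\<^sup>2) powr q / R ^ DIM('a))"
        by (simp add: minus_diff_commute)
      also have "\<dots> = R\<^sup>2 * ((2 * R\<^sup>2) powr q * (exp (-1) / sqrt (pi * (2 * R\<^sup>2)) ^ DIM('a)))"
        using R by (simp add: B_def powr_mult real_sqrt_mult power_mult_distrib mult_ac)
      finally show ?thesis .
    qed
    also have "ennreal \<dots> = (\<integral>\<^sup>+t. ennreal ((2 * R\<^sup>2) powr q * (exp (-1) / sqrt (pi * (2 * R\<^sup>2)) ^ DIM('a))) * indicator {R\<^sup>2<..<2 * R\<^sup>2} t \<partial>lborel)"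
      by (subst nn_integral_cmult_indicator) (use R in \<open>simp_all add: ennreal_mult''[symmetric] mult_ac\<close>)
    also have "\<dots> \<le> subord ?h z"
      unfolding subord_def
    proof (rule nn_integral_mono)
      fix t :: real
      show "ennreal ((2 * R\<^sup>2) powr q * (exp (-1) / sqrt (pi * (2 * R\<^sup>2)) ^ DIM('a))) * indicator {R\<^sup>2<..<2 * R\<^sup>2} t
          \<le> ennreal (?h t) * ennreal (heat t z)"
      proof (cases "t \<in> {R\<^sup>2<..<2 * R\<^sup>2}")
        case True
        then have t: "0 < t" "R\<^sup>2 < t" "t < 2 * R\<^sup>2" using zero_le_power2[of R] by auto
        have h1: "(2 * R\<^sup>2) powr q \<le> t powr q"
          using t assms by (intro powr_mono2') (auto simp: q_def)
        have e: "exp (-1) \<le> exp (- (norm z)\<^sup>2 / t)"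
          using t R_def by (simp add: divide_le_eq)
        have s: "sqrt (pi * t) ^ DIM('a) \<le> sqrt (pi * (2 * R\<^sup>2)) ^ DIM('a)"
          using t by (intro power_mono) auto
        have s0: "0 < sqrt (pi * t) ^ DIM('a)" using t by simp
        have "exp (-1) / sqrt (pi * (2 * R\<^sup>2)) ^ DIM('a) \<le> heat t z"
          unfolding heat_def using t by (simp only: if_True) (intro frac_le e s s0, simp)
        then have "(2 * R\<^sup>2) powr q * (exp (-1) / sqrt (pi * (2 * R\<^sup>2)) ^ DIM('a)) \<le> t powr q * heat t z"
          using h1 t by (intro mult_mono) auto
        then show ?thesis using True t sq
          by (simp add: ennreal_mult'[symmetric] ennreal_leI)
      qed simp
    qed
    finally show ?thesis by (simp add: R_def)
  qed
  have "ennreal B * (\<integral>\<^sup>+z. ennreal (norm (z::'a) powr (- ?n - p)) * indicator {z. r \<le> norm z} z \<partial>lborel)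
      = (\<integral>\<^sup>+z. ennreal B * (ennreal (norm (z::'a) powr (- ?n - p)) * indicator {z. r \<le> norm z} z) \<partial>lborel)"
    by (rule nn_integral_cmult[symmetric]) measurable
  also have "\<dots> \<le> (\<integral>\<^sup>+z. subord ?h (z::'a) \<partial>lborel)"
    using low B by (intro nn_integral_mono) (auto simp: indicator_def ennreal_mult')
  also have "\<dots> = (\<integral>\<^sup>+t. ennreal (t powr q) * indicator {r\<^sup>2<..} t \<partial>lborel)"
  proof (subst nn_integral_subord)
    show "(\<integral>\<^sup>+t. ennreal (?h t) * indicator {0<..} t \<partial>lborel) = (\<integral>\<^sup>+t. ennreal (t powr q) * indicator {r\<^sup>2<..} t \<partial>lborel)"
      using assms by (intro nn_integral_cong) (auto simp: indicator_def not_less dest: less_le_trans[OF zero_less_power[of r 2]])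
  qed measurable
  also have "\<dots> < \<infinity>"
    using assms by (subst nn_integral_powr_Ioi) (auto simp: q_def)
  finally show ?thesis
    using B by (auto simp: ennreal_mult_less_top)
qed

context riesz_order
begin

section \<open>Riesz potentials\<close>

definition rker :: "'a \<Rightarrow> real" where
  "rker z = norm z powr (2 * \<beta> - real DIM('a))"

definition pot :: "('a \<Rightarrow> real) \<Rightarrow> 'a \<Rightarrow> real" where
  "pot f x = (\<integral>y. rker (x - y) * f y \<partial>lborel)"

text \<open>Integrability is demanded at every \<open>x\<close>, because \<open>pot\<close> takes
  the default value 0 wherever the integral does not exist.\<close>

definition potable :: "('a \<Rightarrow> real) \<Rightarrow> bool" where
  "potable f \<longleftrightarrow> f \<in> borel_measurable borel \<and> (\<forall>x. integrable lborel (\<lambda>y. rker (x - y) * f y))"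

lemma gc_pos: "0 < subord_const DIM('a) \<beta>"
  using beta by (intro subord_const_pos) auto

lemma borel_measurable_rker [measurable]: "rker \<in> borel_measurable borel"
  unfolding rker_def[abs_def] by measurable

lemma rker_nonneg [simp]: "0 \<le> rker z"
  by (simp add: rker_def)

lemma green_eq: "z \<noteq> 0 \<Longrightarrow> green z = ennreal (subord_const DIM('a) \<beta> * rker z)"
  unfolding green_def rker_def using beta by (intro subord_powr) auto

lemma borel_measurable_pot [measurable]:
  assumes [measurable]: "f \<in> borel_measurable borel"
  shows "pot f \<in> borel_measurable borel"
  unfolding pot_def[abs_def] by measurable

lemma potableD: "potable f \<Longrightarrow> f \<in> borel_measurable borel" "potable f \<Longrightarrow> integrable lborel (\<lambda>y. rker (x - y) * f y)"
  by (auto simp: potable_def)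

lemma potable_bound:
  assumes "potable k" "f \<in> borel_measurable borel" "\<And>x. \<bar>f x\<bar> \<le> \<bar>k x\<bar>"
  shows "potable f"
  unfolding potable_def
proof (intro conjI allI)
  fix x
  show "integrable lborel (\<lambda>y. rker (x - y) * f y)"
    using assms(2)
    by (intro Bochner_Integration.integrable_bound[OF potableD(2)[OF assms(1), of x]])
       (auto simp: abs_mult assms(3) mult_left_mono)
qed fact

lemma pot_nonneg: "(\<And>x. 0 \<le> f x) \<Longrightarrow> 0 \<le> pot f x"
  by (simp add: pot_def)

lemma pot_mono: "potable f \<Longrightarrow> potable g \<Longrightarrow> (\<And>x. f x \<le> g x) \<Longrightarrow> pot f x \<le> pot g x"
  unfolding pot_def by (intro integral_mono potableD) (auto intro: mult_left_mono)

lemma nn_integral_green: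
  assumes "potable f" "\<And>x. 0 \<le> f x"
  shows "(\<integral>\<^sup>+y. green (x - y) * ennreal (f y) \<partial>lborel) = ennreal (subord_const DIM('a) \<beta> * pot f x)"
proof -
  have "(\<integral>\<^sup>+y. green (x - y) * ennreal (f y) \<partial>lborel) = (\<integral>\<^sup>+y. ennreal (subord_const DIM('a) \<beta> * (rker (x - y) * f y)) \<partial>lborel)"
  proof (rule nn_integral_cong_AE)
    show "AE y in lborel. green (x - y) * ennreal (f y) = ennreal (subord_const DIM('a) \<beta> * (rker (x - y) * f y))"
      using AE_lborel_singleton[of x]
      by eventually_elim (use assms gc_pos in \<open>simp add: green_eq ennreal_mult'[symmetric] ennreal_mult''[symmetric] mult.assoc\<close>)
  qed
  also have "\<dots> = ennreal (\<integral>y. (subord_const DIM('a) \<beta>) * (rker (x - y) * f y) \<partial>lborel)"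
    using assms gc_pos by (intro nn_integral_eq_integral integrable_mult_right potableD(2)) auto
  finally show ?thesis by (simp add: pot_def)
qed

text \<open>Tonelli moves the integral over \<open>y\<close> inside, and a translation by
  \<open>z\<close> reduces it to the identity \<open>jump_green\<close> between kernels.\<close>

lemma jump_green_conv:
  assumes [measurable]: "f \<in> borel_measurable borel" and "0 < \<epsilon>"
  shows "(\<integral>\<^sup>+y. jump \<epsilon> (x - y) * (\<integral>\<^sup>+z. green (y - z) * f z \<partial>lborel) \<partial>lborel) + (\<integral>\<^sup>+z. resid \<epsilon> (x - z) * f z \<partial>lborel)
    = ennreal (\<epsilon> powr (- \<beta>) / \<beta>) * (\<integral>\<^sup>+z. green (x - z) * f z \<partial>lborel)"
proof -
  have "(\<integral>\<^sup>+y. jump \<epsilon> (x - y) * (\<integral>\<^sup>+z. green (y - z) * f z \<partial>lborel) \<partial>lborel)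
      = (\<integral>\<^sup>+y. \<integral>\<^sup>+z. jump \<epsilon> (x - y) * (green (y - z) * f z) \<partial>lborel \<partial>lborel)"
    by (intro nn_integral_cong nn_integral_cmult[symmetric]) measurable
  also have "\<dots> = (\<integral>\<^sup>+z. \<integral>\<^sup>+y. jump \<epsilon> (x - y) * (green (y - z) * f z) \<partial>lborel \<partial>lborel)"
    by (rule lborel_pair.Fubini') measurable
  also have "\<dots> = (\<integral>\<^sup>+z. (\<integral>\<^sup>+y. jump \<epsilon> ((x - z) - y) * green y \<partial>lborel) * f z \<partial>lborel)"
  proof (rule nn_integral_cong)
    fix z
    have "(\<integral>\<^sup>+y. jump \<epsilon> (x - y) * (green (y - z) * f z) \<partial>lborel)
        = (\<integral>\<^sup>+y. jump \<epsilon> (x - y) * green (y - z) \<partial>lborel) * f z"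
      unfolding mult.assoc[symmetric] by (rule nn_integral_multc) measurable
    also have "(\<integral>\<^sup>+y. jump \<epsilon> (x - y) * green (y - z) \<partial>lborel) = (\<integral>\<^sup>+y. jump \<epsilon> (x - (y + z)) * green ((y + z) - z) \<partial>lborel)"
      by (rule nn_integral_lborel_shift[symmetric]) measurable
    finally show "(\<integral>\<^sup>+y. jump \<epsilon> (x - y) * (green (y - z) * f z) \<partial>lborel)
        = (\<integral>\<^sup>+y. jump \<epsilon> ((x - z) - y) * green y \<partial>lborel) * f z"
      by (simp add: algebra_simps)
  qed
  finally have "(\<integral>\<^sup>+y. jump \<epsilon> (x - y) * (\<integral>\<^sup>+z. green (y - z) * f z \<partial>lborel) \<partial>lborel) + (\<integral>\<^sup>+z. resid \<epsilon> (x - z) * f z \<partial>lborel)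
      = (\<integral>\<^sup>+z. ((\<integral>\<^sup>+y. jump \<epsilon> ((x - z) - y) * green y \<partial>lborel) + resid \<epsilon> (x - z)) * f z \<partial>lborel)"
    by (simp add: distrib_right nn_integral_add)
  also have "\<dots> = (\<integral>\<^sup>+z. ennreal (\<epsilon> powr (- \<beta>) / \<beta>) * (green (x - z) * f z) \<partial>lborel)"
    by (simp add: jump_green[OF assms(2)] mult.assoc)
  also have "\<dots> = ennreal (\<epsilon> powr (- \<beta>) / \<beta>) * (\<integral>\<^sup>+z. green (x - z) * f z \<partial>lborel)"
    by (rule nn_integral_cmult) measurable
  finally show ?thesis .
qed

section \<open>Truncated operators applied to potentials, and their limit\<close>

definition jumpr :: "real \<Rightarrow> 'a \<Rightarrow> real" where
  "jumpr \<epsilon> z = enn2real (jump \<epsilon> z)"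

lemma jumpr_nonneg [simp]: "0 \<le> jumpr \<epsilon> z"
  by (simp add: jumpr_def)

lemma jumpr_minus [simp]: "jumpr \<epsilon> (- z) = jumpr \<epsilon> z"
  by (simp add: jumpr_def)

lemma borel_measurable_jumpr [measurable]: "jumpr \<epsilon> \<in> borel_measurable borel"
  unfolding jumpr_def[abs_def] by measurable

lemma jump_finite:
  assumes "0 < \<epsilon>" "z \<noteq> 0"
  shows "jump \<epsilon> z < \<infinity>"
proof -
  have "jump \<epsilon> z \<le> subord (\<lambda>t. t powr (- \<beta> - 1)) z"
    unfolding jump_def by (intro subord_mono) (auto simp: indicator_def)
  also have "\<dots> < \<infinity>"
    using subord_powr[of "-\<beta>" z] beta assms by simp
  finally show ?thesis .
qed

lemma ennreal_jumpr: "0 < \<epsilon> \<Longrightarrow> z \<noteq> 0 \<Longrightarrow> ennreal (jumpr \<epsilon> z) = jump \<epsilon> z"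
  using jump_finite by (simp add: jumpr_def)

lemma nn_integral_jumpr_mult:
  assumes "0 < \<epsilon>" and [measurable]: "f \<in> borel_measurable borel"
  shows "(\<integral>\<^sup>+y. ennreal (jumpr \<epsilon> (x - y)) * f y \<partial>lborel) = (\<integral>\<^sup>+y. jump \<epsilon> (x - y) * f y \<partial>lborel)"
proof (rule nn_integral_cong_AE)
  show "AE y in lborel. ennreal (jumpr \<epsilon> (x - y)) * f y = jump \<epsilon> (x - y) * f y"
    using AE_lborel_singleton[of x] by eventually_elim (simp add: ennreal_jumpr assms)
qed

lemma jumpr_integral:
  assumes "0 < \<epsilon>"
  shows "integrable lborel (\<lambda>y. jumpr \<epsilon> (x - y))" "(\<integral>y. jumpr \<epsilon> (x - y) \<partial>lborel) = \<epsilon> powr (- \<beta>) / \<beta>"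
proof -
  have "(\<integral>\<^sup>+y. ennreal (jumpr \<epsilon> (x - y)) \<partial>lborel) = (\<integral>\<^sup>+y. jump \<epsilon> (x - y) \<partial>lborel)"
    using nn_integral_jumpr_mult[OF assms, of "\<lambda>_. 1" x] by simp
  also have "\<dots> = (\<integral>\<^sup>+y. jump \<epsilon> y \<partial>lborel)"
    by (rule nn_integral_lborel_reflect) measurable
  finally have eq: "(\<integral>\<^sup>+y. ennreal (jumpr \<epsilon> (x - y)) \<partial>lborel) = ennreal (\<epsilon> powr (- \<beta>) / \<beta>)"
    using nn_integral_jump[OF assms] by simp
  show int: "integrable lborel (\<lambda>y. jumpr \<epsilon> (x - y))"
    by (intro integrableI_nonneg) (auto simp: eq)
  show "(\<integral>y. jumpr \<epsilon> (x - y) \<partial>lborel) = \<epsilon> powr (- \<beta>) / \<beta>"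
    using beta by (intro integral_eq_nn_integral[THEN trans]) (auto simp: eq)
qed

definition residual :: "('a \<Rightarrow> real) \<Rightarrow> 'a \<Rightarrow> real \<Rightarrow> real" where
  "residual f x \<epsilon> = enn2real (\<integral>\<^sup>+y. resid \<epsilon> (x - y) * ennreal (f y) \<partial>lborel)"

text \<open>For \<open>f \<ge> 0\<close> both summands on the left of \<open>jump_green_conv\<close>
  are nonnegative and their total is finite, so each is finite and the identity descends to the
  reals.\<close>

lemma jumpr_pot_nonneg:
  assumes "potable f" "\<And>x. 0 \<le> f x" "0 < \<epsilon>"
  shows "integrable lborel (\<lambda>y. jumpr \<epsilon> (x - y) * pot f y)" (is ?A)
    and "(\<integral>y. jumpr \<epsilon> (x - y) * pot f y \<partial>lborel) = \<epsilon> powr (- \<beta>) / \<beta> * pot f x - residual f x \<epsilon> / subord_const DIM('a) \<beta>" (is ?B)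
    and "(\<integral>\<^sup>+y. resid \<epsilon> (x - y) * ennreal (f y) \<partial>lborel) = ennreal (residual f x \<epsilon>)" (is ?C)
proof -
  have [measurable]: "f \<in> borel_measurable borel" using assms by (simp add: potable_def)
  let ?J = "\<integral>\<^sup>+y. ennreal (jumpr \<epsilon> (x - y) * pot f y) \<partial>lborel"
  let ?R = "\<integral>\<^sup>+y. resid \<epsilon> (x - y) * ennreal (f y) \<partial>lborel"
  have p0: "0 \<le> pot f y" for y using assms by (intro pot_nonneg)
  have "(\<integral>\<^sup>+y. jump \<epsilon> (x - y) * (\<integral>\<^sup>+z. green (y - z) * ennreal (f z) \<partial>lborel) \<partial>lborel)
      = (\<integral>\<^sup>+y. jump \<epsilon> (x - y) * ennreal (subord_const DIM('a) \<beta> * pot f y) \<partial>lborel)"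
    using assms by (simp add: nn_integral_green)
  also have "\<dots> = (\<integral>\<^sup>+y. ennreal (jumpr \<epsilon> (x - y)) * ennreal (subord_const DIM('a) \<beta> * pot f y) \<partial>lborel)"
    using assms by (intro nn_integral_jumpr_mult[symmetric]) auto
  also have "\<dots> = (\<integral>\<^sup>+y. ennreal (subord_const DIM('a) \<beta>) * ennreal (jumpr \<epsilon> (x - y) * pot f y) \<partial>lborel)"
    using gc_pos p0 by (intro nn_integral_cong) (simp add: ennreal_mult'[symmetric] ennreal_mult''[symmetric] mult.left_commute)
  also have "\<dots> = ennreal (subord_const DIM('a) \<beta>) * ?J"
    by (rule nn_integral_cmult) measurable
  finally have eq: "ennreal (subord_const DIM('a) \<beta>) * ?J + ?R = ennreal (\<epsilon> powr (- \<beta>) / \<beta> * (subord_const DIM('a) \<beta> * pot f x))"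
    using jump_green_conv[of "\<lambda>y. ennreal (f y)" \<epsilon> x] assms beta gc_pos p0
    by (simp add: nn_integral_green ennreal_mult'[symmetric] ennreal_mult''[symmetric])
  have "ennreal (subord_const DIM('a) \<beta>) * ?J + ?R < \<infinity>"
    unfolding eq by simp
  then have fin: "ennreal (subord_const DIM('a) \<beta>) * ?J < \<infinity>" "?R < \<infinity>"
    by (auto intro: le_less_trans[rotated])
  then have J: "?J < \<infinity>"
    using gc_pos by (auto simp: ennreal_mult_less_top)
  show C: ?C using fin by (simp add: residual_def)
  show A: ?A
    using J p0 by (intro integrableI_nonneg) auto
  have Jr: "?J = ennreal (\<integral>y. jumpr \<epsilon> (x - y) * pot f y \<partial>lborel)"
    using A p0 by (intro nn_integral_eq_integral) auto
  have I0: "0 \<le> (\<integral>y. jumpr \<epsilon> (x - y) * pot f y \<partial>lborel)"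
    using p0 by (intro integral_nonneg_AE) auto
  have "0 \<le> residual f x \<epsilon>" by (simp add: residual_def)
  then have "subord_const DIM('a) \<beta> * (\<integral>y. jumpr \<epsilon> (x - y) * pot f y \<partial>lborel) + residual f x \<epsilon> = \<epsilon> powr (- \<beta>) / \<beta> * (subord_const DIM('a) \<beta> * pot f x)"
    using eq unfolding Jr C using I0 gc_pos p0 beta
    by (simp add: ennreal_mult'[symmetric] flip: ennreal_plus)
  then show ?B
    using gc_pos by (simp add: eq_diff_eq add_divide_eq_iff) (simp add: field_simps)
qed

text \<open>Near \<open>x\<close> the continuity of \<open>f\<close> and the fixed mass of the
  residual kernel decide. Away from \<open>x\<close> the kernel is
  \<open>O(\<epsilon> powr (1 - \<beta>))\<close>; there \<open>f\<close> may be unbounded, but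
  \<open>norm (x - y) powr q\<close> is at most a multiple of the Riesz kernel, so potability
  controls the integral.\<close>

lemma residual_tendsto:
  assumes f: "potable f" "\<And>x. 0 \<le> f x" and cont: "isCont f x"
  shows "(residual f x \<longlongrightarrow> resid_mass * f x) (at_right 0)"
proof -
  have [measurable]: "f \<in> borel_measurable borel" using f by (simp add: potable_def)
  define C where "C = subord_const DIM('a) (\<beta> - 1) / \<beta>"
  have C: "0 \<le> C" using beta subord_const_pos[of "\<beta> - 1" "DIM('a)"] by (simp add: C_def)
  define q where "q = 2 * \<beta> - 2 - real DIM('a)"
  \<comment> \<open>\<open>M\<close> depends on \<open>e\<close> through the radius
    \<open>r\<close>, but not on \<open>\<epsilon>\<close>; letting \<open>\<epsilon>\<close> tend
    to 0 with \<open>e\<close> fixed leaves only the first term.\<close>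
  have est: "\<exists>M. \<forall>\<epsilon>>0. \<bar>residual f x \<epsilon> - resid_mass * f x\<bar> \<le> e * resid_mass + \<epsilon> powr (1 - \<beta>) * M" if e: "0 < e" for e
  proof -
    obtain r where r: "0 < r" "\<And>y. norm (x - y) < r \<Longrightarrow> \<bar>f y - f x\<bar> < e"
      using cont e unfolding continuous_at_eps_delta by (metis dist_commute dist_norm dist_real_def)
    let ?O = "\<lambda>y. indicator {y. r \<le> norm (x - y)} y :: ennreal"
    define M1 where "M1 = (\<integral>\<^sup>+y. ennreal (norm (x - y) powr q * f y) * ?O y \<partial>lborel)"
    define M2 where "M2 = (\<integral>\<^sup>+y. ennreal (norm (x - y) powr q) * ?O y \<partial>lborel)"
    have M2: "M2 < \<infinity>"
    proof -
      have "M2 = (\<integral>\<^sup>+z. ennreal (norm (z::'a) powr q) * indicator {z. r \<le> norm z} z \<partial>lborel)"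
        unfolding M2_def
        by (subst nn_integral_lborel_reflect[symmetric, where c = x]) (auto intro!: nn_integral_cong simp: indicator_def)
      then show ?thesis
        using nn_integral_power_outside[of "2 - 2 * \<beta>" r, where 'a = 'a] beta r by (simp add: q_def algebra_simps)
    qed
    have M1: "M1 < \<infinity>"
    proof -
      have "M1 \<le> (\<integral>\<^sup>+y. ennreal (r powr (-2)) * ennreal (rker (x - y) * f y) \<partial>lborel)"
        unfolding M1_def
      proof (rule nn_integral_mono)
        fix y
        have "norm (x - y) powr q \<le> r powr (-2) * rker (x - y)" if "r \<le> norm (x - y)"
        proof -
          have "norm (x - y) powr q = norm (x - y) powr (-2) * rker (x - y)"
            by (simp add: rker_def q_def powr_add[symmetric] algebra_simps)
          also have "\<dots> \<le> r powr (-2) * rker (x - y)"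
            using that r by (intro mult_right_mono powr_mono2') auto
          finally show ?thesis .
        qed
        then have "norm (x - y) powr q * f y \<le> r powr (-2) * (rker (x - y) * f y)" if "r \<le> norm (x - y)"
          using that f(2)[of y] by (metis mult.assoc mult_right_mono)
        then show "ennreal (norm (x - y) powr q * f y) * ?O y \<le> ennreal (r powr (-2)) * ennreal (rker (x - y) * f y)"
          by (auto simp: indicator_def ennreal_mult'[symmetric] intro!: ennreal_leI)
      qed
      also have "\<dots> = ennreal (r powr (-2)) * (\<integral>\<^sup>+y. ennreal (rker (x - y) * f y) \<partial>lborel)"
        by (rule nn_integral_cmult) measurable
      also have "\<dots> < \<infinity>"
        using f by (simp add: nn_integral_eq_integral potableD ennreal_mult_less_top)
      finally show ?thesis .
    qed
    define M where "M = C * enn2real M1 + f x * C * enn2real M2"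
    have "\<bar>residual f x \<epsilon> - resid_mass * f x\<bar> \<le> e * resid_mass + \<epsilon> powr (1 - \<beta>) * M" if ep: "0 < \<epsilon>" for \<epsilon>
    proof -
      define D where "D = \<epsilon> powr (1 - \<beta>) * C"
      have D: "0 \<le> D" using C by (simp add: D_def)
      have Req: "(\<integral>\<^sup>+y. resid \<epsilon> (x - y) * ennreal (f y) \<partial>lborel) = ennreal (residual f x \<epsilon>)"
        by (rule jumpr_pot_nonneg(3)[OF f ep])
      have mass: "(\<integral>\<^sup>+y. resid \<epsilon> (x - y) \<partial>lborel) = ennreal resid_mass"
        using nn_integral_lborel_reflect[of "resid \<epsilon>" x] nn_integral_resid[OF ep] by simp
      have far: "resid \<epsilon> (x - y) \<le> ennreal (D * norm (x - y) powr q)" if "r \<le> norm (x - y)" for y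
      proof -
        have "x - y \<noteq> 0" using that r by auto
        from resid_le[OF ep this] show ?thesis by (simp add: D_def C_def q_def mult.assoc)
      qed
      have c0: "0 < resid_mass" by (rule resid_mass_pos)
      have "ennreal (residual f x \<epsilon>)
          \<le> (\<integral>\<^sup>+y. resid \<epsilon> (x - y) * ennreal (f x + e) + ennreal D * (ennreal (norm (x - y) powr q * f y) * ?O y) \<partial>lborel)"
        unfolding Req[symmetric]
      proof (rule nn_integral_mono)
        fix y
        show "resid \<epsilon> (x - y) * ennreal (f y) \<le> resid \<epsilon> (x - y) * ennreal (f x + e) + ennreal D * (ennreal (norm (x - y) powr q * f y) * ?O y)"
        proof (cases "r \<le> norm (x - y)")
          case True
          have "resid \<epsilon> (x - y) * ennreal (f y) \<le> ennreal (D * norm (x - y) powr q) * ennreal (f y)"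
            by (intro mult_right_mono far True) auto
          also have "\<dots> = ennreal D * ennreal (norm (x - y) powr q * f y)"
            using D f(2)[of y] by (simp add: ennreal_mult'[symmetric] ennreal_mult''[symmetric] mult.assoc)
          finally show ?thesis using True by (simp add: add_increasing)
        next
          case False
          then have "f y \<le> f x + e" using r(2)[of y] by auto
          then have "resid \<epsilon> (x - y) * ennreal (f y) \<le> resid \<epsilon> (x - y) * ennreal (f x + e)"
            by (intro mult_left_mono ennreal_leI) auto
          then show ?thesis using False by simp
        qed
      qed
      also have "\<dots> = ennreal resid_mass * ennreal (f x + e) + ennreal D * M1"
        unfolding M1_def by (simp add: nn_integral_add nn_integral_multc nn_integral_cmult mass)
      also have "\<dots> = ennreal (resid_mass * (f x + e) + D * enn2real M1)"
        using M1 c0 D e f(2)[of x]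
        by (cases M1) (auto simp: ennreal_mult'[symmetric] simp flip: ennreal_plus)
      finally have up: "residual f x \<epsilon> \<le> resid_mass * (f x + e) + D * enn2real M1"
        using c0 D e f(2)[of x] by (subst (asm) ennreal_le_iff) auto
      \<comment> \<open>The lower bound starts from \<open>f x \<le> f y + e\<close> near
        \<open>x\<close>, so that only sums occur in \<open>ennreal\<close>.\<close>
      have "ennreal (resid_mass * f x) = (\<integral>\<^sup>+y. resid \<epsilon> (x - y) * ennreal (f x) \<partial>lborel)"
        using c0 f(2)[of x] by (simp add: nn_integral_multc mass ennreal_mult')
      also have "\<dots> \<le> (\<integral>\<^sup>+y. (resid \<epsilon> (x - y) * ennreal (f y) + resid \<epsilon> (x - y) * ennreal e) + ennreal (f x * D) * (ennreal (norm (x - y) powr q) * ?O y) \<partial>lborel)"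
      proof (rule nn_integral_mono)
        fix y
        show "resid \<epsilon> (x - y) * ennreal (f x) \<le> (resid \<epsilon> (x - y) * ennreal (f y) + resid \<epsilon> (x - y) * ennreal e) + ennreal (f x * D) * (ennreal (norm (x - y) powr q) * ?O y)"
        proof (cases "r \<le> norm (x - y)")
          case True
          have "resid \<epsilon> (x - y) * ennreal (f x) \<le> ennreal (D * norm (x - y) powr q) * ennreal (f x)"
            by (intro mult_right_mono far True) auto
          also have "\<dots> = ennreal (f x * D) * ennreal (norm (x - y) powr q)"
            using D f(2)[of x] by (simp add: ennreal_mult'[symmetric] ennreal_mult''[symmetric] mult_ac)
          finally show ?thesis using True by (simp add: add_increasing)
        next
          case False
          then have "f x \<le> f y + e" using r(2)[of y] by auto
          then have "resid \<epsilon> (x - y) * ennreal (f x) \<le> resid \<epsilon> (x - y) * ennreal (f y + e)"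
            by (intro mult_left_mono ennreal_leI) auto
          then show ?thesis using False f(2)[of y] e by (simp add: distrib_left)
        qed
      qed
      also have "\<dots> = (ennreal (residual f x \<epsilon>) + ennreal resid_mass * ennreal e) + ennreal (f x * D) * M2"
        unfolding M2_def by (simp add: nn_integral_add nn_integral_multc nn_integral_cmult mass Req)
      also have "\<dots> = ennreal (residual f x \<epsilon> + resid_mass * e + f x * D * enn2real M2)"
        using M2 c0 D e f(2)[of x]
        by (cases M2) (auto simp: residual_def ennreal_mult'[symmetric] simp flip: ennreal_plus)
      finally have lo: "resid_mass * f x \<le> residual f x \<epsilon> + resid_mass * e + f x * D * enn2real M2"
        using c0 D e f(2)[of x] by (subst (asm) ennreal_le_iff) (auto simp: residual_def intro!: add_nonneg_nonneg mult_nonneg_nonneg)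
      have n1: "0 \<le> D * enn2real M1" "0 \<le> f x * D * enn2real M2" using D f(2)[of x] by auto
      have "\<epsilon> powr (1 - \<beta>) * M = D * enn2real M1 + f x * D * enn2real M2"
        by (simp add: M_def D_def algebra_simps)
      with up lo n1 show ?thesis by (simp add: abs_le_iff algebra_simps)
    qed
    then show ?thesis by blast
  qed
  show ?thesis
  proof (rule tendstoI)
    fix e :: real assume e: "0 < e"
    define e' where "e' = e / (2 * resid_mass)"
    have e': "0 < e'" "e' * resid_mass = e / 2" using e resid_mass_pos by (auto simp: e'_def)
    obtain M where M: "\<And>\<epsilon>. 0 < \<epsilon> \<Longrightarrow> \<bar>residual f x \<epsilon> - resid_mass * f x\<bar> \<le> e' * resid_mass + \<epsilon> powr (1 - \<beta>) * M"
      using est[OF e'(1)] by blast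
    have "((\<lambda>\<epsilon>. \<epsilon> powr (1 - \<beta>) * M) \<longlongrightarrow> 0 powr (1 - \<beta>) * M) (at_right 0)"
      using beta by (intro tendsto_intros tendsto_powr2) (auto simp: eventually_at_right_less[of 0] intro: eventually_mono[OF eventually_at_right_less])
    then have "eventually (\<lambda>\<epsilon>. \<epsilon> powr (1 - \<beta>) * M < e / 2) (at_right 0)"
      using e by (intro order_tendstoD(2)[of _ "0 powr (1 - \<beta>) * M"]) auto
    moreover have "eventually (\<lambda>\<epsilon>. 0 < \<epsilon>) (at_right (0::real))"
      by (rule eventually_at_right_less)
    ultimately show "eventually (\<lambda>\<epsilon>. dist (residual f x \<epsilon>) (resid_mass * f x) < e) (at_right 0)"
    proof eventually_elim
      case (elim \<epsilon>)
      then show ?case using M[of \<epsilon>] e' by (simp add: dist_real_def)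
    qed
  qed
qed

lemma pot_diff:
  assumes "potable f" "potable g"
  shows "pot (\<lambda>x. f x - g x) x = pot f x - pot g x"
  unfolding pot_def using assms by (simp add: right_diff_distrib potableD)

text \<open>The mass \<open>\<epsilon> powr (- \<beta>) / \<beta>\<close> of the jump kernel blows
  up, but it cancels between the two terms of the difference and leaves the residuals of the
  positive and negative parts of \<open>f\<close>.\<close>

lemma jumpr_pot_tendsto:
  assumes f: "potable f" and cont: "isCont f x"
  shows "0 < \<epsilon> \<Longrightarrow> integrable lborel (\<lambda>y. jumpr \<epsilon> (x - y) * (pot f x - pot f y))"
    and "((\<lambda>\<epsilon>. \<integral>y. jumpr \<epsilon> (x - y) * (pot f x - pot f y) \<partial>lborel) \<longlongrightarrow> resid_mass / subord_const DIM('a) \<beta> * f x) (at_right 0)"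
proof -
  have [measurable]: "f \<in> borel_measurable borel" using f by (simp add: potable_def)
  define fp where "fp y = max 0 (f y)" for y
  define fm where "fm y = max 0 (- f y)" for y
  have fp: "potable fp" "\<And>y. 0 \<le> fp y" and fm: "potable fm" "\<And>y. 0 \<le> fm y"
    by (auto intro!: potable_bound[OF f] simp: fp_def[abs_def] fm_def[abs_def])
  have f_eq: "f = (\<lambda>y. fp y - fm y)" by (auto simp: fp_def fm_def)
  have pf: "pot f y = pot fp y - pot fm y" for y
    unfolding f_eq by (rule pot_diff[OF fp(1) fm(1)])
  have expand: "jumpr \<epsilon> (x - y) * (pot f x - pot f y)
      = pot f x * jumpr \<epsilon> (x - y) - (jumpr \<epsilon> (x - y) * pot fp y - jumpr \<epsilon> (x - y) * pot fm y)" for \<epsilon> y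
    by (simp add: pf algebra_simps)
  show "integrable lborel (\<lambda>y. jumpr \<epsilon> (x - y) * (pot f x - pot f y))" if "0 < \<epsilon>" for \<epsilon>
    unfolding expand
    using jumpr_integral(1)[OF that] jumpr_pot_nonneg(1)[OF fp that] jumpr_pot_nonneg(1)[OF fm that]
    by (intro Bochner_Integration.integrable_diff integrable_mult_right) auto
  have val: "(\<integral>y. jumpr \<epsilon> (x - y) * (pot f x - pot f y) \<partial>lborel) = (residual fp x \<epsilon> - residual fm x \<epsilon>) / subord_const DIM('a) \<beta>" if "0 < \<epsilon>" for \<epsilon>
    unfolding expand
    using jumpr_integral[OF that, of x] jumpr_pot_nonneg(1,2)[OF fp that, of x] jumpr_pot_nonneg(1,2)[OF fm that, of x]
    by (simp add: pf algebra_simps diff_divide_distrib)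
  have "((\<lambda>\<epsilon>. (residual fp x \<epsilon> - residual fm x \<epsilon>) / subord_const DIM('a) \<beta>) \<longlongrightarrow> (resid_mass * fp x - resid_mass * fm x) / subord_const DIM('a) \<beta>) (at_right 0)"
    using cont gc_pos unfolding fp_def[abs_def] fm_def[abs_def]
    by (intro tendsto_intros residual_tendsto fp[unfolded fp_def[abs_def]] fm[unfolded fm_def[abs_def]] continuous_intros) auto
  moreover have "(resid_mass * fp x - resid_mass * fm x) / subord_const DIM('a) \<beta> = resid_mass / subord_const DIM('a) \<beta> * f x"
    by (simp add: f_eq algebra_simps diff_divide_distrib)
  ultimately show "((\<lambda>\<epsilon>. \<integral>y. jumpr \<epsilon> (x - y) * (pot f x - pot f y) \<partial>lborel) \<longlongrightarrow> resid_mass / subord_const DIM('a) \<beta> * f x) (at_right 0)"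
    by (subst tendsto_cong[OF eventually_mono[OF eventually_at_right_less[of 0]]])
       (auto simp: val)
qed

end

section \<open>Near and far part of the Riesz kernel\<close>

text \<open>The second derivative of \<open>x powr (- q)\<close> is
  \<open>q * (q + 1) * x powr (- q - 2)\<close>, which on \<open>{\<mu>..}\<close> is largest at
  \<open>\<mu>\<close>. The second bound is the mean value inequality for
  \<open>x powr (- q) + q * a powr (- q - 1) * x\<close>, whose derivative the first bound controls;
  it loses only the factor 2 of the sharp Taylor remainder.\<close>

lemma powr_neg_taylor:
  fixes q \<mu> a b :: real
  assumes "0 < q" "0 < \<mu>" "\<mu> \<le> a" "\<mu> \<le> b"
  shows "\<bar>q * a powr (- q - 1) - q * b powr (- q - 1)\<bar> \<le> q * (q + 1) * \<mu> powr (- q - 2) * \<bar>a - b\<bar>" (is ?A)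
    and "\<bar>b powr (- q) - a powr (- q) + q * a powr (- q - 1) * (b - a)\<bar> \<le> q * (q + 1) * \<mu> powr (- q - 2) * (b - a)\<^sup>2" (is ?B)
proof -
  have lip: "\<bar>q * a powr (- q - 1) - q * b powr (- q - 1)\<bar> \<le> q * (q + 1) * \<mu> powr (- q - 2) * \<bar>a - b\<bar>"
    if "\<mu> \<le> a" "\<mu> \<le> b" for a b
  proof -
    have "norm (q * a powr (- q - 1) - q * b powr (- q - 1)) \<le> q * (q + 1) * \<mu> powr (- q - 2) * norm (a - b)"
    proof (rule field_differentiable_bound[where S = "{\<mu>..}" and f' = "\<lambda>x. q * ((- q - 1) * x powr (- q - 2))"])
      fix x :: real assume x: "x \<in> {\<mu>..}"
      then have x0: "0 < x" using assms by auto
      have "((\<lambda>x. x powr (- q - 1)) has_real_derivative (- q - 1) * x powr (- q - 1 - 1)) (at x)"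
        by (rule has_real_derivative_powr) (fact x0)
      then show "((\<lambda>x. q * x powr (- q - 1)) has_real_derivative q * ((- q - 1) * x powr (- q - 2))) (at x within {\<mu>..})"
        by (intro DERIV_subset[OF DERIV_cmult]) (auto simp: algebra_simps)
      have "norm (q * ((- q - 1) * x powr (- q - 2))) = q * (q + 1) * x powr (- q - 2)"
        using assms by (simp add: abs_mult)
      also have "\<dots> \<le> q * (q + 1) * \<mu> powr (- q - 2)"
        using assms x by (intro mult_left_mono powr_mono2') auto
      finally show "norm (q * ((- q - 1) * x powr (- q - 2))) \<le> q * (q + 1) * \<mu> powr (- q - 2)" .
    qed (use that in auto)
    then show ?thesis by simp
  qed
  show ?A using lip assms by blast
  have "norm ((b powr (- q) + q * a powr (- q - 1) * b) - (a powr (- q) + q * a powr (- q - 1) * a))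
      \<le> q * (q + 1) * \<mu> powr (- q - 2) * \<bar>b - a\<bar> * norm (b - a)"
  proof (rule field_differentiable_bound[where S = "{min a b..max a b}" and f' = "\<lambda>x. (- q) * x powr (- q - 1) + q * a powr (- q - 1)"])
    fix x :: real assume x: "x \<in> {min a b..max a b}"
    then have x0: "0 < x" "\<mu> \<le> x" using assms by auto
    have "((\<lambda>x. x powr (- q)) has_real_derivative (- q) * x powr (- q - 1)) (at x)"
      by (rule has_real_derivative_powr) (fact x0)
    then have "((\<lambda>x. x powr (- q) + q * a powr (- q - 1) * x) has_real_derivative (- q) * x powr (- q - 1) + q * a powr (- q - 1) * 1) (at x)"
      by (rule DERIV_add[OF _ DERIV_cmult[OF DERIV_ident]])
    then show "((\<lambda>x. x powr (- q) + q * a powr (- q - 1) * x) has_real_derivative (- q) * x powr (- q - 1) + q * a powr (- q - 1)) (at x within {min a b..max a b})"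
      by (auto intro: DERIV_subset)
    have "\<bar>q * a powr (- q - 1) - q * x powr (- q - 1)\<bar> \<le> q * (q + 1) * \<mu> powr (- q - 2) * \<bar>a - x\<bar>"
      using lip[of a x] x0 assms by simp
    also have "\<dots> \<le> q * (q + 1) * \<mu> powr (- q - 2) * \<bar>b - a\<bar>"
      using x assms by (intro mult_left_mono) auto
    finally show "norm (- q * x powr (- q - 1) + q * a powr (- q - 1)) \<le> q * (q + 1) * \<mu> powr (- q - 2) * \<bar>b - a\<bar>"
      by simp
  qed auto
  moreover have "(b powr (- q) + q * a powr (- q - 1) * b) - (a powr (- q) + q * a powr (- q - 1) * a)
      = b powr (- q) - a powr (- q) + q * a powr (- q - 1) * (b - a)"
    by (simp only: algebra_simps)
  moreover have "\<bar>b - a\<bar> * norm (b - a) = (b - a)\<^sup>2"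
    by (simp only: real_norm_def power2_eq_square abs_mult_self_eq)
  ultimately show ?B by (simp only: real_norm_def mult.assoc)
qed

text \<open>\<open>tail q d\<close> follows \<open>r powr - q\<close> above \<open>d\<close> and its tangent line at \<open>d\<close> below \<open>d\<close>.\<close>

definition tail :: "real \<Rightarrow> real \<Rightarrow> real \<Rightarrow> real" where
  "tail q d r = max d r powr (- q) - q * d powr (- q - 1) * min 0 (r - d)"

text \<open>The tangent continuation makes the derivative of \<open>tail\<close> Lipschitz across
  \<open>d\<close>. With \<open>r = a + b\<close>, where \<open>a = max d r\<close> and
  \<open>b = min 0 (r - d)\<close>, \<open>tail\<close> is a power of \<open>a\<close> plus a linear
  term in \<open>b\<close>. The third hypothesis keeps both points where the second derivative is
  comparable to its value at \<open>max d r\<close>.\<close>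

lemma tail_taylor:
  assumes "0 < q" "0 < d" "max d r / 4 \<le> max d r'"
  shows "\<bar>tail q d r' - tail q d r + q * max d r powr (- q - 1) * (r' - r)\<bar>
    \<le> 2 * (q * (q + 1) * (max d r / 4) powr (- q - 2)) * (r' - r)\<^sup>2"
proof -
  define L where "L = q * (q + 1) * (max d r / 4) powr (- q - 2)"
  define a where "a = max d r"
  define a' where "a' = max d r'"
  define b where "b = min 0 (r - d)"
  define b' where "b' = min 0 (r' - d)"
  have L: "0 \<le> L" using assms by (simp add: L_def)
  have a: "0 < a" "a / 4 \<le> a" "a / 4 \<le> a'" "0 < a / 4" using assms by (auto simp: a_def a'_def)
  have ra: "r = a + b" "r' = a' + b'" by (auto simp: a_def a'_def b_def b'_def)
  have "\<bar>a' powr (- q) - a powr (- q) + q * a powr (- q - 1) * (a' - a)\<bar> \<le> L * (a' - a)\<^sup>2"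
    using powr_neg_taylor(2)[OF assms(1) a(4) a(2) a(3)] by (simp add: L_def a_def)
  also have "\<dots> \<le> L * (r' - r)\<^sup>2"
    using L by (intro mult_left_mono abs_le_square_iff[THEN iffD1]) (auto simp: a_def a'_def)
  finally have 1: "\<bar>a' powr (- q) - a powr (- q) + q * a powr (- q - 1) * (a' - a)\<bar> \<le> L * (r' - r)\<^sup>2" .
  \<comment> \<open>Nonzero only for \<open>r' < d < r\<close>, and then both \<open>a - d\<close>
    and \<open>\<bar>b' - b\<bar>\<close> are bounded by \<open>\<bar>r' - r\<bar>\<close>.\<close>
  have 2: "\<bar>(q * a powr (- q - 1) - q * d powr (- q - 1)) * (b' - b)\<bar> \<le> L * (r' - r)\<^sup>2"
  proof (cases "r \<le> d \<or> d \<le> r'")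
    case True
    then have "(q * a powr (- q - 1) - q * d powr (- q - 1)) * (b' - b) = 0"
      by (auto simp: a_def b_def b'_def)
    then show ?thesis using L by (simp only: abs_zero) simp
  next
    case False
    then have "\<bar>q * a powr (- q - 1) - q * d powr (- q - 1)\<bar> \<le> L * \<bar>a - d\<bar>"
      unfolding L_def a_def[symmetric]
      by (intro powr_neg_taylor(1)) (use a assms False in \<open>auto simp: a_def\<close>)
    then have "\<bar>q * a powr (- q - 1) - q * d powr (- q - 1)\<bar> * \<bar>b' - b\<bar> \<le> L * \<bar>a - d\<bar> * \<bar>b' - b\<bar>"
      by (intro mult_right_mono) auto
    also have "\<dots> \<le> L * (\<bar>r' - r\<bar> * \<bar>r' - r\<bar>)"
      unfolding mult.assoc using False L by (intro mult_left_mono mult_mono) (auto simp: a_def b_def b'_def)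
    finally show ?thesis by (simp add: abs_mult power2_eq_square)
  qed
  have "tail q d r' - tail q d r + q * max d r powr (- q - 1) * (r' - r)
      = (a' powr (- q) - a powr (- q) + q * a powr (- q - 1) * (a' - a)) + (q * a powr (- q - 1) - q * d powr (- q - 1)) * (b' - b)"
  proof -
    have "r' - r = (a' - a) + (b' - b)" using ra by simp
    then show ?thesis
      unfolding tail_def a_def[symmetric] a'_def[symmetric] b_def[symmetric] b'_def[symmetric]
      by (simp only:) (simp only: algebra_simps)
  qed
  then show ?thesis
    using 1 2 unfolding L_def[symmetric] by linarith
qed

lemma tail_nonneg: "0 < q \<Longrightarrow> 0 < d \<Longrightarrow> 0 \<le> tail q d r"
proof -
  assume "0 < q" "0 < d"
  then have "q * d powr (- q - 1) * min 0 (r - d) \<le> 0"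
    by (intro mult_nonneg_nonpos) auto
  then show ?thesis
    using powr_ge_zero[of "max d r" "- q"] unfolding tail_def by linarith
qed

text \<open>Below \<open>d\<close> this is convexity: the tangent at \<open>d\<close> lies under the
  graph of the power.\<close>

lemma tail_le:
  assumes "0 < q" "0 < d" "0 < r"
  shows "tail q d r \<le> r powr (- q)"
proof (cases "d \<le> r")
  case True
  then show ?thesis by (simp add: tail_def max_absorb2)
next
  case False
  obtain \<xi> where \<xi>: "r < \<xi>" "\<xi> < d" "d powr (- q) - r powr (- q) = (d - r) * ((- q) * \<xi> powr (- q - 1))"
  proof (rule MVT2[THEN exE])
    show "r < d" using False by simp
    show "((\<lambda>x. x powr (- q)) has_real_derivative (- q) * x powr (- q - 1)) (at x)" if "r \<le> x" "x \<le> d" for x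
      by (rule has_real_derivative_powr) (use assms that in simp)
  qed (use that in blast)
  have "q * d powr (- q - 1) * (d - r) \<le> q * \<xi> powr (- q - 1) * (d - r)"
    using \<xi> False assms by (intro mult_right_mono mult_left_mono powr_mono2') auto
  with \<xi> False show ?thesis
    by (simp add: tail_def algebra_simps)
qed

lemma tail_eq: "d \<le> r \<Longrightarrow> tail q d r = r powr (- q)"
  by (simp add: tail_def max_absorb2)

context riesz_order
begin

text \<open>Taken in the squared norm, which is polynomial: no singularity remains at the origin,
  and symmetric differences obey the parallelogram law. The exponent is half that of the Riesz
  kernel because of the square.\<close>

definition far :: "real \<Rightarrow> 'a \<Rightarrow> real" where
  "far \<delta> z = tail (real DIM('a) / 2 - \<beta>) (\<delta>\<^sup>2) ((norm z)\<^sup>2)"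

lemma borel_measurable_far [measurable]: "far \<delta> \<in> borel_measurable borel"
  unfolding far_def[abs_def] tail_def by measurable

lemma far_nonneg: "0 < \<delta> \<Longrightarrow> 0 \<le> far \<delta> z"
  unfolding far_def using beta by (intro tail_nonneg) auto

lemma rker_eq: "rker z = ((norm z)\<^sup>2) powr (- (real DIM('a) / 2 - \<beta>))"
proof (cases "z = 0")
  case False
  have "(norm z)\<^sup>2 = norm z powr 2" using False by simp
  then show ?thesis by (simp only: powr_powr rker_def) (simp add: algebra_simps)
qed (simp add: rker_def)

lemma far_le: "0 < \<delta> \<Longrightarrow> z \<noteq> 0 \<Longrightarrow> far \<delta> z \<le> rker z"
  unfolding far_def rker_eq using beta by (intro tail_le) auto

lemma far_eq: "0 < \<delta> \<Longrightarrow> \<delta> \<le> norm z \<Longrightarrow> far \<delta> z = rker z"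
  unfolding far_def rker_eq by (intro tail_eq) auto

text \<open>With \<open>M = max \<delta> (norm z)\<close>, each increment by \<open>h\<close> costs
  a factor \<open>norm h / M \<le> norm h / \<delta>\<close> relative to the natural size
  \<open>M powr (- 2 * q)\<close>, which is at most \<open>rker z\<close>. Bounding by
  \<open>rker z\<close> is what later turns the integral against \<open>\<bar>f\<bar>\<close> into a
  potential.\<close>

lemma far_differences:
  obtains C where "0 < C"
    "\<And>\<delta> h z. 0 < \<delta> \<Longrightarrow> 2 * norm h \<le> \<delta> \<Longrightarrow> z \<noteq> 0 \<Longrightarrow> \<bar>far \<delta> (z + h) - far \<delta> z\<bar> \<le> C * (norm h / \<delta>) * rker z"
    "\<And>\<delta> h z. 0 < \<delta> \<Longrightarrow> 2 * norm h \<le> \<delta> \<Longrightarrow> z \<noteq> 0 \<Longrightarrow> \<bar>far \<delta> (z + h) + far \<delta> (z - h) - 2 * far \<delta> z\<bar> \<le> C * (norm h / \<delta>)\<^sup>2 * rker z"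
proof -
  define q where "q = real DIM('a) / 2 - \<beta>"
  have q: "0 < q" using beta by (simp add: q_def)
  define K where "K = 2 * (q * (q + 1) * (1 / 4) powr (- q - 2))"
  have K: "0 < K" using q by (simp add: K_def)
  \<comment> \<open>\<open>3 * q\<close> covers the term linear in the increment of the squared
    norm, and each Taylor remainder costs \<open>9 * K\<close>; the second difference has two of
    them.\<close>
  define C where "C = 3 * q + 18 * K"
  have C: "0 < C" using q K by (simp add: C_def)
  have main: "\<bar>far \<delta> (z + h) - far \<delta> z\<bar> \<le> C * (norm h / \<delta>) * rker z \<and> \<bar>far \<delta> (z + h) + far \<delta> (z - h) - 2 * far \<delta> z\<bar> \<le> C * (norm h / \<delta>)\<^sup>2 * rker z"
    if d: "0 < \<delta>" and h: "2 * norm h \<le> \<delta>" and z: "z \<noteq> 0" for \<delta> h z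
  proof -
    define M where "M = max \<delta> (norm z)"
    have M: "0 < M" "\<delta> \<le> M" "norm z \<le> M" "2 * norm h \<le> M" using d h by (auto simp: M_def)
    define m where "m = max (\<delta>\<^sup>2) ((norm z)\<^sup>2)"
    have m: "m = M\<^sup>2" using d unfolding m_def M_def by (auto simp: max_def power_mono dest: power2_le_imp_le)
    define P where "P = M powr (- 2 * q)"
    have P: "0 < P" using M by (simp add: P_def)
    have Pr: "P \<le> rker z"
    proof -
      have "P \<le> norm z powr (- 2 * q)" unfolding P_def using M z q by (intro powr_mono2') auto
      then show ?thesis by (simp add: rker_def q_def)
    qed
    have m1: "m powr (- q - 1) = P / M\<^sup>2" and m2: "m powr (- q - 2) = P / M ^ 4"
    proof -
      have M2: "m = M powr 2" using M m by simp
      have "m powr (- q - 1) = M powr (- 2 * q - 2)" "m powr (- q - 2) = M powr (- 2 * q - 4)"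
        unfolding M2 powr_powr by (simp_all add: algebra_simps)
      then show "m powr (- q - 1) = P / M\<^sup>2" "m powr (- q - 2) = P / M ^ 4"
        using M by (simp_all add: P_def powr_diff powr_numeral)
    qed
    have tay: "\<bar>far \<delta> (z + k) - far \<delta> z + q * (P / M\<^sup>2) * ((norm (z + k))\<^sup>2 - (norm z)\<^sup>2)\<bar> \<le> K * (P / M ^ 4) * ((norm (z + k))\<^sup>2 - (norm z)\<^sup>2)\<^sup>2"
      and sq: "\<bar>(norm (z + k))\<^sup>2 - (norm z)\<^sup>2\<bar> \<le> 3 * M * norm h"
      if k: "norm k = norm h" for k
    proof -
      have "norm z \<le> norm (z + k) + norm k" using norm_triangle_ineq4[of "z + k" k] by simp
      \<comment> \<open>A shift of length at most \<open>\<delta> / 2\<close> loses at most half of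
        \<open>M\<close>; squared, this is the factor 1/4 required by
        \<open>tail_taylor\<close>.\<close>
      then have "M / 2 \<le> max \<delta> (norm (z + k))"
        using k h d by (auto simp: M_def max_def)
      then have "(M / 2)\<^sup>2 \<le> (max \<delta> (norm (z + k)))\<^sup>2" using M by (intro power_mono) auto
      also have "\<dots> = max (\<delta>\<^sup>2) ((norm (z + k))\<^sup>2)"
        using d by (auto simp: max_def power_mono dest: power2_le_imp_le)
      finally have "m / 4 \<le> max (\<delta>\<^sup>2) ((norm (z + k))\<^sup>2)" by (simp add: m power_divide)
      from tail_taylor[OF q _ this[unfolded m_def]] d
      have "\<bar>far \<delta> (z + k) - far \<delta> z + q * m powr (- q - 1) * ((norm (z + k))\<^sup>2 - (norm z)\<^sup>2)\<bar>
          \<le> 2 * (q * (q + 1) * (m / 4) powr (- q - 2)) * ((norm (z + k))\<^sup>2 - (norm z)\<^sup>2)\<^sup>2"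
        unfolding far_def q_def[symmetric] m_def[symmetric] by simp
      moreover have "(m / 4) powr (- q - 2) = m powr (- q - 2) * (1 / 4) powr (- q - 2)"
        using M m powr_mult[of m "1/4" "- q - 2"] by simp
      ultimately show "\<bar>far \<delta> (z + k) - far \<delta> z + q * (P / M\<^sup>2) * ((norm (z + k))\<^sup>2 - (norm z)\<^sup>2)\<bar> \<le> K * (P / M ^ 4) * ((norm (z + k))\<^sup>2 - (norm z)\<^sup>2)\<^sup>2"
        unfolding m1 m2 K_def by (simp only: mult_ac)
      have "(norm (z + k))\<^sup>2 - (norm z)\<^sup>2 = 2 * (z \<bullet> k) + (norm h)\<^sup>2"
        by (simp add: power2_norm_eq_inner inner_add inner_commute flip: k)
      moreover have "\<bar>z \<bullet> k\<bar> \<le> M * norm h"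
        using Cauchy_Schwarz_ineq2[of z k] M(3) k by (metis mult_right_mono norm_ge_zero order_trans)
      moreover have "(norm h)\<^sup>2 \<le> M * norm h"
        unfolding power2_eq_square using M norm_ge_zero[of h] by (intro mult_right_mono) linarith+
      moreover have "0 \<le> (norm h)\<^sup>2" by simp
      ultimately show "\<bar>(norm (z + k))\<^sup>2 - (norm z)\<^sup>2\<bar> \<le> 3 * M * norm h"
        by linarith
    qed
    have lin1: "\<bar>D\<bar> \<le> A + B" if "\<bar>t\<bar> \<le> A" "\<bar>D + t\<bar> \<le> R" "R \<le> B" for A B D R t :: real
      using that by linarith
    have lin2: "\<bar>D1 + D2\<bar> \<le> T + B + B"
      if "\<bar>D1 + t1\<bar> \<le> R1" "R1 \<le> B" "\<bar>D2 + t2\<bar> \<le> R2" "R2 \<le> B" "t1 + t2 = T" "0 \<le> T"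
      for D1 D2 t1 t2 R1 R2 B T :: real
      using that by linarith
    define H where "H = norm h"
    have H: "0 \<le> H" "2 * H \<le> M" using M by (auto simp: H_def)
    have rem: "K * (P / M ^ 4) * ((norm (z + k))\<^sup>2 - (norm z)\<^sup>2)\<^sup>2 \<le> 9 * K * (P * (H / M)\<^sup>2)" if k: "norm k = norm h" for k
    proof -
      have "((norm (z + k))\<^sup>2 - (norm z)\<^sup>2)\<^sup>2 \<le> (3 * M * H)\<^sup>2"
        using sq[OF k] M H by (intro abs_le_square_iff[THEN iffD1]) (auto simp: H_def)
      then have "K * (P / M ^ 4) * ((norm (z + k))\<^sup>2 - (norm z)\<^sup>2)\<^sup>2 \<le> K * (P / M ^ 4) * (3 * M * H)\<^sup>2"
        using K P M by (intro mult_left_mono) auto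
      also have "\<dots> = 9 * K * (P * (H / M)\<^sup>2)"
        using M by (simp add: power_mult_distrib power_divide eval_nat_numeral)
      finally show ?thesis .
    qed
    have HM: "H / M \<le> H / \<delta>" using H M d by (intro divide_left_mono) auto
    have HM0: "0 \<le> H / M" "H / M \<le> 1" using H M by auto
    have HM2: "(H / M)\<^sup>2 \<le> H / M"
      using mult_left_le[OF HM0(2) HM0(1)] by (simp only: power2_eq_square)
    have "\<bar>q * (P / M\<^sup>2) * ((norm (z + h))\<^sup>2 - (norm z)\<^sup>2)\<bar> \<le> q * (P / M\<^sup>2) * (3 * M * H)"
    proof -
      have "\<bar>q * (P / M\<^sup>2)\<bar> = q * (P / M\<^sup>2)" using q P by simp
      then show ?thesis
        using q P unfolding abs_mult[of "q * (P / M\<^sup>2)"] H_def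
        by (simp only:) (intro mult_left_mono sq, auto)
    qed
    also have "\<dots> = 3 * q * (P * (H / M))"
      using M by (simp add: power2_eq_square)
    finally have "\<bar>far \<delta> (z + h) - far \<delta> z\<bar> \<le> 3 * q * (P * (H / M)) + 9 * K * (P * (H / M)\<^sup>2)"
      by (rule lin1[OF _ tay[of h, OF refl] rem[of h, OF refl]])
    also have "\<dots> \<le> 3 * q * (P * (H / M)) + 18 * K * (P * (H / M))"
    proof -
      have "P * (H / M)\<^sup>2 \<le> P * (H / M)" "0 \<le> P * (H / M)"
        by (rule mult_left_mono[OF HM2], use P in simp) (rule mult_nonneg_nonneg[OF _ HM0(1)], use P in simp)
      moreover have "9 * K * Y \<le> 18 * K * X" if "Y \<le> X" "0 \<le> X" for X Y
      proof -
        have "K * Y \<le> K * X" "0 \<le> K * X" using K that by auto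
        then show ?thesis by linarith
      qed
      ultimately show ?thesis by (metis add_left_mono)
    qed
    also have "\<dots> = C * (H / M) * P" by (simp add: C_def algebra_simps)
    also have "\<dots> \<le> C * (H / \<delta>) * rker z"
      using Pr P HM HM0 C d H by (intro mult_mono) auto
    finally have first: "\<bar>far \<delta> (z + h) - far \<delta> z\<bar> \<le> C * (norm h / \<delta>) * rker z"
      by (simp add: H_def)
    \<comment> \<open>Parallelogram law: the parts linear in \<open>h\<close> cancel in the
      symmetric difference.\<close>
    have par: "((norm (z + h))\<^sup>2 - (norm z)\<^sup>2) + ((norm (z + - h))\<^sup>2 - (norm z)\<^sup>2) = 2 * H\<^sup>2"
      by (simp add: power2_norm_eq_inner inner_add inner_diff inner_commute H_def)
    have "q * (P / M\<^sup>2) * ((norm (z + h))\<^sup>2 - (norm z)\<^sup>2) + q * (P / M\<^sup>2) * ((norm (z + - h))\<^sup>2 - (norm z)\<^sup>2) = 2 * q * (P * (H / M)\<^sup>2)"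
      unfolding distrib_left[symmetric] par by (simp add: power_divide)
    then have "\<bar>(far \<delta> (z + h) - far \<delta> z) + (far \<delta> (z + - h) - far \<delta> z)\<bar>
        \<le> 2 * q * (P * (H / M)\<^sup>2) + 9 * K * (P * (H / M)\<^sup>2) + 9 * K * (P * (H / M)\<^sup>2)"
      by (rule lin2[OF tay[of h, OF refl] rem[of h, OF refl] tay[of "- h", OF norm_minus_cancel] rem[of "- h", OF norm_minus_cancel]])
         (use q P in simp)
    also have "\<dots> \<le> C * (H / M)\<^sup>2 * P"
    proof -
      have "2 * q * (P * X) + 9 * K * (P * X) + 9 * K * (P * X) \<le> C * X * P" if "0 \<le> X" for X
      proof -
        have "C * X * P = 3 * (q * (P * X)) + 18 * (K * (P * X))" by (simp add: C_def algebra_simps)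
        moreover have "0 \<le> q * (P * X)" using q P that by simp
        ultimately show ?thesis by (simp only: mult.assoc)
      qed
      from this[OF zero_le_power2] show ?thesis .
    qed
    also have "\<dots> \<le> C * (H / \<delta>)\<^sup>2 * rker z"
      using Pr P HM HM0 C d H by (intro mult_mono power_mono) auto
    finally have "\<bar>(far \<delta> (z + h) - far \<delta> z) + (far \<delta> (z + - h) - far \<delta> z)\<bar> \<le> C * (norm h / \<delta>)\<^sup>2 * rker z"
      by (simp only: H_def)
    then show ?thesis using first by (simp add: algebra_simps)
  qed
  show ?thesis by (rule that[OF C]) (use main in blast)+
qed

end

lemma lborel_integrable_shift:
  fixes f :: "'a::euclidean_space \<Rightarrow> real"
  assumes "f \<in> borel_measurable borel"
  shows "integrable lborel (\<lambda>x. f (x + c)) \<longleftrightarrow> integrable lborel f"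
    and "(\<integral>x. f (x + c) \<partial>lborel) = (\<integral>x. f x \<partial>lborel)"
proof -
  have eq: "(lborel :: 'a measure) = distr lborel borel (\<lambda>x. x + c)"
  proof -
    have "(+) c = (\<lambda>x. x + c)" by (auto simp: add.commute)
    then show ?thesis using lborel_distr_plus[of c] by simp
  qed
  show "integrable lborel (\<lambda>x. f (x + c)) \<longleftrightarrow> integrable lborel f"
    by (subst (2) eq) (use assms in \<open>simp add: integrable_distr_eq\<close>)
  show "(\<integral>x. f (x + c) \<partial>lborel) = (\<integral>x. f x \<partial>lborel)"
    by (subst (2) eq) (use assms in \<open>simp add: integral_distr\<close>)
qed

lemma lborel_AE_not_open:
  fixes S :: "'a::euclidean_space set"
  assumes "open S" "S \<noteq> {}"
  shows "\<not> (AE x in lborel. x \<notin> S)"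
proof
  assume "AE x in lborel. x \<notin> S"
  then have "emeasure lborel S = 0"
    using assms by (subst (asm) AE_iff_measurable[where N = S]) auto
  then have "S \<in> null_sets lborel" using assms by auto
  then have "negligible S"
    by (simp add: negligible_iff_null_sets null_sets_completionI)
  then show False using open_not_negligible[OF assms] by simp
qed

context riesz_order
begin

section \<open>Difference estimates for potentials\<close>

definition near :: "real \<Rightarrow> 'a \<Rightarrow> real" where
  "near \<delta> z = rker z - far \<delta> z"

lemma borel_measurable_near [measurable]: "near \<delta> \<in> borel_measurable borel"
  unfolding near_def[abs_def] by measurable

lemma near_bounds:
  assumes "0 < \<delta>" "z \<noteq> 0"
  shows "0 \<le> near \<delta> z" "near \<delta> z \<le> rker z" "\<delta> \<le> norm z \<Longrightarrow> near \<delta> z = 0"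
  using assms far_nonneg[of \<delta> z] far_le[of \<delta> z] far_eq[of \<delta> z] by (auto simp: near_def)

lemma nn_integral_rker_ball:
  obtains A where "0 < A" "\<And>r x. 0 < r \<Longrightarrow>
    (\<integral>\<^sup>+y. ennreal (rker (x - y)) * indicator {y. norm (x - y) < r} y \<partial>lborel) \<le> ennreal (A * r powr (2 * \<beta>))"
proof -
  obtain A where A: "0 < A" "\<And>r. 0 < r \<Longrightarrow>
    (\<integral>\<^sup>+z. ennreal (norm (z::'a) powr (2 * \<beta> - real DIM('a))) * indicator {z. norm z < r} z \<partial>lborel) \<le> ennreal (A * r powr (2 * \<beta>))"
    using nn_integral_power_ball[of \<beta>, where 'a = 'a] beta by auto
  have "(\<integral>\<^sup>+y. ennreal (rker (x - y)) * indicator {y. norm (x - y) < r} y \<partial>lborel) \<le> ennreal (A * r powr (2 * \<beta>))"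
    if "0 < r" for r x
  proof -
    have "(\<integral>\<^sup>+y. ennreal (rker (x - y)) * indicator {y. norm (x - y) < r} y \<partial>lborel)
        = (\<integral>\<^sup>+y. (\<lambda>z. ennreal (rker z) * indicator {z. norm z < r} z) (x - y) \<partial>lborel)"
      by (intro nn_integral_cong) (simp add: indicator_def)
    also have "\<dots> = (\<integral>\<^sup>+z. ennreal (rker z) * indicator {z. norm z < r} z \<partial>lborel)"
      by (rule nn_integral_lborel_reflect) measurable
    finally show ?thesis using A(2)[OF that] by (simp add: rker_def)
  qed
  with A(1) that show ?thesis by blast
qed

lemma near_integral_le:
  obtains A where "0 < A"
    "\<And>\<delta> x \<phi> B. 0 < \<delta> \<Longrightarrow> integrable lborel (\<lambda>y. near \<delta> (x - y) * \<phi> y) \<Longrightarrow> 0 \<le> B \<Longrightarrow>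
      (\<And>y. norm (x - y) < \<delta> \<Longrightarrow> \<bar>\<phi> y\<bar> \<le> B) \<Longrightarrow> \<bar>\<integral>y. near \<delta> (x - y) * \<phi> y \<partial>lborel\<bar> \<le> A * \<delta> powr (2 * \<beta>) * B"
proof -
  obtain A where A: "0 < A" "\<And>r x. 0 < r \<Longrightarrow>
    (\<integral>\<^sup>+y. ennreal (rker (x - y)) * indicator {y. norm (x - y) < r} y \<partial>lborel) \<le> ennreal (A * r powr (2 * \<beta>))"
    using nn_integral_rker_ball by blast
  have "\<bar>\<integral>y. near \<delta> (x - y) * \<phi> y \<partial>lborel\<bar> \<le> A * \<delta> powr (2 * \<beta>) * B"
    if d: "0 < \<delta>" and int: "integrable lborel (\<lambda>y. near \<delta> (x - y) * \<phi> y)" and B: "0 \<le> B"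
      and bd: "\<And>y. norm (x - y) < \<delta> \<Longrightarrow> \<bar>\<phi> y\<bar> \<le> B" for \<delta> x \<phi> B
  proof -
    have "ennreal (norm (\<integral>y. near \<delta> (x - y) * \<phi> y \<partial>lborel)) \<le> (\<integral>\<^sup>+y. ennreal (norm (near \<delta> (x - y) * \<phi> y)) \<partial>lborel)"
      by (rule integral_norm_bound_ennreal[OF int])
    also have "\<dots> \<le> (\<integral>\<^sup>+y. (ennreal (rker (x - y)) * indicator {y. norm (x - y) < \<delta>} y) * ennreal B \<partial>lborel)"
    proof (rule nn_integral_mono_AE)
      show "AE y in lborel. ennreal (norm (near \<delta> (x - y) * \<phi> y)) \<le> (ennreal (rker (x - y)) * indicator {y. norm (x - y) < \<delta>} y) * ennreal B"
        using AE_lborel_singleton[of x]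
      proof eventually_elim
        case (elim y)
        then have z: "x - y \<noteq> 0" by simp
        show ?case
        proof (cases "norm (x - y) < \<delta>")
          case True
          then have "norm (near \<delta> (x - y) * \<phi> y) \<le> rker (x - y) * B"
            using near_bounds[OF d z] bd[of y] B by (auto simp: abs_mult intro!: mult_mono)
          then show ?thesis using True by (simp add: ennreal_mult'[symmetric] ennreal_leI)
        qed (use near_bounds(3)[OF d z] in simp)
      qed
    qed
    also have "\<dots> = (\<integral>\<^sup>+y. (ennreal (rker (x - y)) * indicator {y. norm (x - y) < \<delta>} y) \<partial>lborel) * ennreal B"
      by (rule nn_integral_multc) measurable
    also have "\<dots> \<le> ennreal (A * \<delta> powr (2 * \<beta>)) * ennreal B"
      by (intro mult_right_mono A(2) d) auto
    finally show ?thesis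
      using A(1) B by (simp add: ennreal_mult'[symmetric] ennreal_mult''[symmetric])
  qed
  with A(1) that show ?thesis by blast
qed

text \<open>The shift by \<open>h\<close> acts on the kernel in the far part, which is regular, and
  is moved onto \<open>f\<close> by translation in the near part, which is singular but of small
  mass.\<close>

lemma pot_split:
  assumes "potable f" "0 < \<delta>"
  shows "integrable lborel (\<lambda>y. far \<delta> (x - y) * f y)"
    and "integrable lborel (\<lambda>y. near \<delta> (x - y) * f (y + h))"
    and "pot f (x + h) = (\<integral>y. far \<delta> (x + h - y) * f y \<partial>lborel) + (\<integral>y. near \<delta> (x - y) * f (y + h) \<partial>lborel)"
proof -
  have [measurable]: "f \<in> borel_measurable borel" using assms by (simp add: potable_def)
  have F: "integrable lborel (\<lambda>y. far \<delta> (x - y) * f y)" for x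
  proof (rule Bochner_Integration.integrable_bound[OF potableD(2)[OF assms(1), of x]])
    show "AE y in lborel. norm (far \<delta> (x - y) * f y) \<le> norm (rker (x - y) * f y)"
      using AE_lborel_singleton[of x]
    proof eventually_elim
      case (elim y)
      then show ?case
        using far_le[of \<delta> "x - y"] far_nonneg[of \<delta> "x - y"] assms by (auto simp: abs_mult intro!: mult_right_mono)
    qed
  qed measurable
  show "integrable lborel (\<lambda>y. far \<delta> (x - y) * f y)" by (rule F)
  have N: "integrable lborel (\<lambda>y. near \<delta> (x - y) * f y)" for x
    unfolding near_def left_diff_distrib by (intro Bochner_Integration.integrable_diff F potableD(2) assms)
  have sh: "(\<lambda>y. near \<delta> (x - y) * f (y + h)) = (\<lambda>y. (\<lambda>y. near \<delta> (x + h - y) * f y) (y + h))"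
    by (simp add: algebra_simps)
  show "integrable lborel (\<lambda>y. near \<delta> (x - y) * f (y + h))"
    unfolding sh by (subst lborel_integrable_shift) (use N in auto)
  have "pot f (x + h) = (\<integral>y. far \<delta> (x + h - y) * f y + near \<delta> (x + h - y) * f y \<partial>lborel)"
    unfolding pot_def near_def by (simp add: algebra_simps)
  also have "\<dots> = (\<integral>y. far \<delta> (x + h - y) * f y \<partial>lborel) + (\<integral>y. near \<delta> (x + h - y) * f y \<partial>lborel)"
    by (intro Bochner_Integration.integral_add F N)
  also have "(\<integral>y. near \<delta> (x + h - y) * f y \<partial>lborel) = (\<integral>y. near \<delta> (x - y) * f (y + h) \<partial>lborel)"
    unfolding sh by (subst lborel_integrable_shift) auto
  finally show "pot f (x + h) = (\<integral>y. far \<delta> (x + h - y) * f y \<partial>lborel) + (\<integral>y. near \<delta> (x - y) * f (y + h) \<partial>lborel)" .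
qed

lemma potable_abs: "potable f \<Longrightarrow> potable (\<lambda>y. \<bar>f y\<bar>)"
  by (rule potable_bound) (auto simp: potable_def)

lemma integral_kernel_le:
  assumes f: "potable f" and int: "integrable lborel (\<lambda>y. g y * f y)"
    and bd: "\<And>y. y \<noteq> x \<Longrightarrow> \<bar>g y\<bar> \<le> D * rker (x - y)"
  shows "\<bar>\<integral>y. g y * f y \<partial>lborel\<bar> \<le> D * pot (\<lambda>y. \<bar>f y\<bar>) x"
proof -
  have "\<bar>\<integral>y. g y * f y \<partial>lborel\<bar> \<le> (\<integral>y. \<bar>g y * f y\<bar> \<partial>lborel)"
    by (rule integral_abs_bound)
  also have "\<dots> \<le> (\<integral>y. D * (rker (x - y) * \<bar>f y\<bar>) \<partial>lborel)"
  proof (rule integral_mono_AE)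
    show "AE y in lborel. \<bar>g y * f y\<bar> \<le> D * (rker (x - y) * \<bar>f y\<bar>)"
      using AE_lborel_singleton[of x]
      by eventually_elim (simp add: abs_mult mult.assoc[symmetric] mult_right_mono bd)
    show "integrable lborel (\<lambda>y. D * (rker (x - y) * \<bar>f y\<bar>))"
      by (intro integrable_mult_right potableD(2) potable_abs f)
  qed (use int in simp)
  finally show ?thesis by (simp add: pot_def)
qed

text \<open>\<open>C\<close> depends on \<open>\<beta>\<close> and the dimension only. Both
  \<open>\<delta>\<close> and \<open>B\<close> stay free, since the absorption argument picks
  \<open>\<delta>\<close> according to the position of \<open>x\<close> and takes \<open>B\<close>
  from a bound on the very differences that are being estimated.\<close>

lemma pot_differences:
  obtains C where "0 < C"
    "\<And>f x h \<delta> B. potable f \<Longrightarrow> 0 < \<delta> \<Longrightarrow> 2 * norm h \<le> \<delta> \<Longrightarrow> 0 \<le> B \<Longrightarrow>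
      (\<And>y. norm (x - y) < \<delta> \<Longrightarrow> \<bar>f (y + h) - f y\<bar> \<le> B) \<Longrightarrow>
      \<bar>pot f (x + h) - pot f x\<bar> \<le> C * (norm h / \<delta>) * pot (\<lambda>y. \<bar>f y\<bar>) x + C * \<delta> powr (2 * \<beta>) * B"
    "\<And>f x h \<delta> B. potable f \<Longrightarrow> 0 < \<delta> \<Longrightarrow> 2 * norm h \<le> \<delta> \<Longrightarrow> 0 \<le> B \<Longrightarrow>
      (\<And>y. norm (x - y) < \<delta> \<Longrightarrow> \<bar>f (y + h) + f (y - h) - 2 * f y\<bar> \<le> B) \<Longrightarrow>
      \<bar>pot f (x + h) + pot f (x - h) - 2 * pot f x\<bar> \<le> C * (norm h / \<delta>)\<^sup>2 * pot (\<lambda>y. \<bar>f y\<bar>) x + C * \<delta> powr (2 * \<beta>) * B"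
proof -
  obtain C1 where C1: "0 < C1"
    "\<And>\<delta> h z. 0 < \<delta> \<Longrightarrow> 2 * norm h \<le> \<delta> \<Longrightarrow> z \<noteq> 0 \<Longrightarrow> \<bar>far \<delta> (z + h) - far \<delta> z\<bar> \<le> C1 * (norm h / \<delta>) * rker z"
    "\<And>\<delta> h z. 0 < \<delta> \<Longrightarrow> 2 * norm h \<le> \<delta> \<Longrightarrow> z \<noteq> 0 \<Longrightarrow> \<bar>far \<delta> (z + h) + far \<delta> (z - h) - 2 * far \<delta> z\<bar> \<le> C1 * (norm h / \<delta>)\<^sup>2 * rker z"
    using far_differences by blast
  obtain A where A: "0 < A"
    "\<And>\<delta> x \<phi> B. 0 < \<delta> \<Longrightarrow> integrable lborel (\<lambda>y. near \<delta> (x - y) * \<phi> y) \<Longrightarrow> 0 \<le> B \<Longrightarrow>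
      (\<And>y. norm (x - y) < \<delta> \<Longrightarrow> \<bar>\<phi> y\<bar> \<le> B) \<Longrightarrow> \<bar>\<integral>y. near \<delta> (x - y) * \<phi> y \<partial>lborel\<bar> \<le> A * \<delta> powr (2 * \<beta>) * B"
    using near_integral_le by blast
  define C where "C = max C1 A"
  have C: "0 < C" "C1 \<le> C" "A \<le> C" using C1 A by (auto simp: C_def)
  have fin: "\<bar>I + J\<bar> \<le> C * t * P + C * \<delta> powr (2 * \<beta>) * B"
    if "\<bar>I\<bar> \<le> C1 * t * P" "\<bar>J\<bar> \<le> A * \<delta> powr (2 * \<beta>) * B" "0 \<le> t" "0 \<le> P" "0 \<le> B" for I J t P B \<delta> :: real
  proof -
    have "C1 * t * P \<le> C * t * P" "A * \<delta> powr (2 * \<beta>) * B \<le> C * \<delta> powr (2 * \<beta>) * B"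
      using C that by (auto intro!: mult_right_mono)
    with that show ?thesis by linarith
  qed
  have P0: "0 \<le> pot (\<lambda>y. \<bar>f y\<bar>) x" for f x by (rule pot_nonneg) simp
  have 1: "\<bar>pot f (x + h) - pot f x\<bar> \<le> C * (norm h / \<delta>) * pot (\<lambda>y. \<bar>f y\<bar>) x + C * \<delta> powr (2 * \<beta>) * B"
    if f: "potable f" and d: "0 < \<delta>" and h: "2 * norm h \<le> \<delta>" and B: "0 \<le> B"
      and bd: "\<And>y. norm (x - y) < \<delta> \<Longrightarrow> \<bar>f (y + h) - f y\<bar> \<le> B" for f x h \<delta> B
  proof -
    note s = pot_split[OF f d]
    have n0: "integrable lborel (\<lambda>y. near \<delta> (x - y) * f y)" using s(2)[of x 0] by simp
    have "pot f (x + h) - pot f x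
        = ((\<integral>y. far \<delta> (x + h - y) * f y \<partial>lborel) - (\<integral>y. far \<delta> (x - y) * f y \<partial>lborel))
        + ((\<integral>y. near \<delta> (x - y) * f (y + h) \<partial>lborel) - (\<integral>y. near \<delta> (x - y) * f y \<partial>lborel))"
      using s(3)[of x h] s(3)[of x 0] by simp
    also have "\<dots> = (\<integral>y. (far \<delta> (x + h - y) - far \<delta> (x - y)) * f y \<partial>lborel) + (\<integral>y. near \<delta> (x - y) * (f (y + h) - f y) \<partial>lborel)"
      unfolding left_diff_distrib right_diff_distrib
      by (simp add: s(1) s(2) n0)
    finally have eq: "pot f (x + h) - pot f x = \<dots>" .
    show ?thesis
      unfolding eq
    proof (rule fin)
      show "\<bar>\<integral>y. (far \<delta> (x + h - y) - far \<delta> (x - y)) * f y \<partial>lborel\<bar> \<le> C1 * (norm h / \<delta>) * pot (\<lambda>y. \<bar>f y\<bar>) x"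
      proof (rule integral_kernel_le[OF f])
        show "integrable lborel (\<lambda>y. (far \<delta> (x + h - y) - far \<delta> (x - y)) * f y)"
          unfolding left_diff_distrib by (simp add: s(1))
        show "\<bar>far \<delta> (x + h - y) - far \<delta> (x - y)\<bar> \<le> C1 * (norm h / \<delta>) * rker (x - y)" if "y \<noteq> x" for y
          using C1(2)[OF d h, of "x - y"] that by (simp add: algebra_simps)
      qed
      show "\<bar>\<integral>y. near \<delta> (x - y) * (f (y + h) - f y) \<partial>lborel\<bar> \<le> A * \<delta> powr (2 * \<beta>) * B"
        by (rule A(2)[OF d _ B bd]) (simp_all add: right_diff_distrib s(2) n0)
    qed (use d B P0 in auto)
  qed
  have 2: "\<bar>pot f (x + h) + pot f (x - h) - 2 * pot f x\<bar> \<le> C * (norm h / \<delta>)\<^sup>2 * pot (\<lambda>y. \<bar>f y\<bar>) x + C * \<delta> powr (2 * \<beta>) * B"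
    if f: "potable f" and d: "0 < \<delta>" and h: "2 * norm h \<le> \<delta>" and B: "0 \<le> B"
      and bd: "\<And>y. norm (x - y) < \<delta> \<Longrightarrow> \<bar>f (y + h) + f (y - h) - 2 * f y\<bar> \<le> B" for f x h \<delta> B
  proof -
    note s = pot_split[OF f d]
    have n0: "integrable lborel (\<lambda>y. near \<delta> (x - y) * f y)" using s(2)[of x 0] by simp
    have nm: "integrable lborel (\<lambda>y. near \<delta> (x - y) * f (y - h))" using s(2)[of x "- h"] by simp
    have expF: "(far \<delta> (x + h - y) + far \<delta> (x - h - y) - 2 * far \<delta> (x - y)) * f y
        = far \<delta> (x + h - y) * f y + far \<delta> (x - h - y) * f y - 2 * (far \<delta> (x - y) * f y)" for y
      by (simp add: algebra_simps)
    have expN: "near \<delta> (x - y) * (f (y + h) + f (y - h) - 2 * f y)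
        = near \<delta> (x - y) * f (y + h) + near \<delta> (x - y) * f (y - h) - 2 * (near \<delta> (x - y) * f y)" for y
      by (simp add: algebra_simps)
    have eq: "pot f (x + h) + pot f (x - h) - 2 * pot f x
        = (\<integral>y. (far \<delta> (x + h - y) + far \<delta> (x - h - y) - 2 * far \<delta> (x - y)) * f y \<partial>lborel)
        + (\<integral>y. near \<delta> (x - y) * (f (y + h) + f (y - h) - 2 * f y) \<partial>lborel)"
      unfolding expF expN
      using s(3)[of x h] s(3)[of x "- h"] s(3)[of x 0]
      by (simp add: s(1) s(2) n0 nm)
    show ?thesis
      unfolding eq
    proof (rule fin)
      show "\<bar>\<integral>y. (far \<delta> (x + h - y) + far \<delta> (x - h - y) - 2 * far \<delta> (x - y)) * f y \<partial>lborel\<bar> \<le> C1 * (norm h / \<delta>)\<^sup>2 * pot (\<lambda>y. \<bar>f y\<bar>) x"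
      proof (rule integral_kernel_le[OF f])
        show "integrable lborel (\<lambda>y. (far \<delta> (x + h - y) + far \<delta> (x - h - y) - 2 * far \<delta> (x - y)) * f y)"
          unfolding expF by (simp add: s(1))
        show "\<bar>far \<delta> (x + h - y) + far \<delta> (x - h - y) - 2 * far \<delta> (x - y)\<bar> \<le> C1 * (norm h / \<delta>)\<^sup>2 * rker (x - y)" if "y \<noteq> x" for y
          using C1(3)[OF d h, of "x - y"] that by (simp add: algebra_simps)
      qed
      show "\<bar>\<integral>y. near \<delta> (x - y) * (f (y + h) + f (y - h) - 2 * f y) \<partial>lborel\<bar> \<le> A * \<delta> powr (2 * \<beta>) * B"
        by (rule A(2)[OF d _ B bd]) (simp_all add: expN s(2) n0 nm)
    qed (use d B P0 in auto)
  qed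
  show ?thesis by (rule that[OF C(1) 1 2])
qed

text \<open>For bounded \<open>f\<close> the near part is small uniformly in \<open>h\<close> once
  \<open>\<delta>\<close> is small; with \<open>\<delta>\<close> fixed, the far part is small for
  small \<open>h\<close>.\<close>

lemma isCont_pot:
  assumes f: "potable f" and bd: "\<And>y. \<bar>f y\<bar> \<le> F"
  shows "isCont (pot f) x"
proof -
  obtain C where C: "0 < C"
    "\<And>h \<delta> B. 0 < \<delta> \<Longrightarrow> 2 * norm h \<le> \<delta> \<Longrightarrow> 0 \<le> B \<Longrightarrow>
      (\<And>y. norm (x - y) < \<delta> \<Longrightarrow> \<bar>f (y + h) - f y\<bar> \<le> B) \<Longrightarrow>
      \<bar>pot f (x + h) - pot f x\<bar> \<le> C * (norm h / \<delta>) * pot (\<lambda>y. \<bar>f y\<bar>) x + C * \<delta> powr (2 * \<beta>) * B"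
    using pot_differences f by metis
  define P where "P = pot (\<lambda>y. \<bar>f y\<bar>) x"
  have F: "0 \<le> F" using bd[of 0] by linarith
  have P: "0 \<le> P" unfolding P_def by (rule pot_nonneg) simp
  have est: "\<bar>pot f (x + h) - pot f x\<bar> \<le> C * (norm h / \<delta>) * P + C * \<delta> powr (2 * \<beta>) * (2 * F)"
    if "0 < \<delta>" "2 * norm h \<le> \<delta>" for h \<delta>
    unfolding P_def
  proof (rule C(2)[OF that])
    fix y
    show "\<bar>f (y + h) - f y\<bar> \<le> 2 * F" using bd[of y] bd[of "y + h"] by linarith
  qed (use F in simp)
  show ?thesis
    unfolding continuous_at_eps_delta
  proof (intro allI impI)
    fix e :: real assume e: "0 < e"
    \<comment> \<open>The summand 1 keeps the denominator positive when \<open>F = 0\<close>;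
      \<open>\<delta>\<close> is the radius at which the near term is at most
      \<open>e / 2\<close>.\<close>
    define X where "X = C * (2 * F) + 1"
    define \<delta> where "\<delta> = (e / (2 * X)) powr (1 / (2 * \<beta>))"
    have X: "0 < X" "C * (2 * F) \<le> X" using C F by (simp_all add: X_def add_nonneg_pos)
    have d: "0 < \<delta>" using e X by (simp add: \<delta>_def)
    have "\<delta> powr (2 * \<beta>) = e / (2 * X)"
      using e X beta by (simp add: \<delta>_def powr_powr)
    then have "C * \<delta> powr (2 * \<beta>) * (2 * F) = e / 2 * ((C * (2 * F)) / X)"
      by simp
    also have "\<dots> \<le> e / 2 * 1"
      using e X C F by (intro mult_left_mono) auto
    finally have t1: "C * \<delta> powr (2 * \<beta>) * (2 * F) \<le> e / 2" by simp
    define \<eta> where "\<eta> = min (\<delta> / 2) (\<delta> * e / (4 * (C * P + 1)))"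
    have Y: "0 < C * P + 1" using C P by (simp add: add_nonneg_pos)
    have eta: "0 < \<eta>" using d e Y by (simp add: \<eta>_def)
    show "\<exists>d>0. \<forall>x'. dist x' x < d \<longrightarrow> dist (pot f x') (pot f x) < e"
    proof (intro exI[of _ \<eta>] conjI allI impI eta)
      fix x' assume "dist x' x < \<eta>"
      define h where "h = x' - x"
      have h: "norm h < \<eta>" "x' = x + h" using \<open>dist x' x < \<eta>\<close> by (auto simp: h_def dist_norm)
      have h2: "2 * norm h \<le> \<delta>" using h by (auto simp: \<eta>_def)
      have "norm h * (4 * (C * P + 1)) \<le> \<delta> * e"
        using h Y unfolding \<eta>_def by (metis less_imp_le min_less_iff_conj pos_le_divide_eq mult_pos_pos zero_less_numeral)
      then have "norm h / \<delta> * (C * P + 1) \<le> e / 4"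
        using d by (simp add: field_simps)
      then have "C * (norm h / \<delta>) * P \<le> e / 4"
        using d by (simp add: algebra_simps) (smt (verit) divide_nonneg_pos norm_ge_zero)
      then show "dist (pot f x') (pot f x) < e"
        using est[OF d h2] t1 e unfolding h(2) dist_real_def by linarith
    qed
  qed
qed

text \<open>Within distance 1 of \<open>x\<close> the kernel has bounded mass, and beyond it the
  kernel is at most 1, so only the volume of the support counts: hence a bound uniform in
  \<open>x\<close>. The decay at infinity likewise comes from the negative exponent
  \<open>2 * \<beta> - n\<close>.\<close>

lemma pot_compact_support:
  assumes [measurable]: "f \<in> borel_measurable borel"
    and bd: "\<And>y. \<bar>f y\<bar> \<le> F" and supp: "\<And>y. R \<le> norm y \<Longrightarrow> f y = 0"
  shows "potable f"
    and "\<exists>P. \<forall>x. pot (\<lambda>y. \<bar>f y\<bar>) x \<le> P"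
    and "(pot f \<longlongrightarrow> 0) at_infinity"
proof -
  obtain A where A: "0 < A" "\<And>r x. 0 < r \<Longrightarrow>
    (\<integral>\<^sup>+y. ennreal (rker (x - y)) * indicator {y. norm (x - y) < r} y \<partial>lborel) \<le> ennreal (A * r powr (2 * \<beta>))"
    using nn_integral_rker_ball by blast
  have F: "0 \<le> F" using bd[of 0] by linarith
  define V where "V = measure lborel (ball (0::'a) R)"
  have V: "emeasure lborel {y::'a. norm y < R} = ennreal V"
  proof -
    have "{y::'a. norm y < R} = ball 0 R" by (auto simp: dist_norm)
    then show ?thesis by (simp add: V_def emeasure_eq_ennreal_measure[OF less_imp_neq[OF emeasure_bounded_finite[OF bounded_ball], unfolded infinity_ennreal_def]])
  qed
  have V0: "0 \<le> V" by (simp add: V_def)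
  define P where "P = F * A + F * V"
  have le: "(\<integral>\<^sup>+y. ennreal (rker (x - y) * \<bar>f y\<bar>) \<partial>lborel) \<le> ennreal P" for x
  proof -
    have "(\<integral>\<^sup>+y. ennreal (rker (x - y) * \<bar>f y\<bar>) \<partial>lborel)
        \<le> (\<integral>\<^sup>+y. ennreal F * (ennreal (rker (x - y)) * indicator {y. norm (x - y) < 1} y) + ennreal F * indicator {y. norm y < R} y \<partial>lborel)"
    proof (rule nn_integral_mono)
      fix y
      show "ennreal (rker (x - y) * \<bar>f y\<bar>) \<le> ennreal F * (ennreal (rker (x - y)) * indicator {y. norm (x - y) < 1} y) + ennreal F * indicator {y. norm y < R} y"
      proof (cases "norm (x - y) < 1")
        case True
        have "ennreal (rker (x - y) * \<bar>f y\<bar>) \<le> ennreal (F * rker (x - y))"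
          using bd[of y] by (intro ennreal_leI) (simp add: mult.commute mult_right_mono)
        then show ?thesis using True F by (simp add: ennreal_mult' add_increasing2)
      next
        case False
        then have "rker (x - y) \<le> 1" 
            unfolding rker_def using beta powr_mono2'[of "2 * \<beta> - real DIM('a)" 1 "norm (x - y)"] by simp
        then have "rker (x - y) * \<bar>f y\<bar> \<le> 1 * F" using bd[of y] F by (intro mult_mono) auto
        moreover have "rker (x - y) * \<bar>f y\<bar> = 0" if "\<not> norm y < R" using that supp[of y] by simp
        ultimately show ?thesis using False by (auto simp: indicator_def intro!: ennreal_leI)
      qed
    qed
    also have "\<dots> = ennreal F * (\<integral>\<^sup>+y. ennreal (rker (x - y)) * indicator {y. norm (x - y) < 1} y \<partial>lborel) + ennreal F * ennreal V"
      by (subst nn_integral_add) (simp_all add: nn_integral_cmult V)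
    also have "\<dots> \<le> ennreal F * ennreal (A * 1 powr (2 * \<beta>)) + ennreal F * ennreal V"
      by (intro add_right_mono mult_left_mono A(2)) auto
    also have "\<dots> = ennreal P"
      using F A V0 by (simp add: P_def ennreal_mult'[symmetric])
    finally show ?thesis .
  qed
  have int: "integrable lborel (\<lambda>y. rker (x - y) * \<bar>f y\<bar>)" for x
    using le[of x] by (intro integrableI_nonneg) (auto intro: le_less_trans)
  show pf: "potable f"
    unfolding potable_def
  proof (intro conjI allI)
    fix x
    show "integrable lborel (\<lambda>y. rker (x - y) * f y)"
      by (rule Bochner_Integration.integrable_bound[OF int[of x]]) (auto simp: abs_mult)
  qed measurable
  have P0: "0 \<le> P" using F A V0 by (simp add: P_def)
  have "pot (\<lambda>y. \<bar>f y\<bar>) x \<le> P" for x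
  proof -
    have "ennreal (pot (\<lambda>y. \<bar>f y\<bar>) x) = (\<integral>\<^sup>+y. ennreal (rker (x - y) * \<bar>f y\<bar>) \<partial>lborel)"
      unfolding pot_def using int by (intro nn_integral_eq_integral[symmetric]) auto
    with le[of x] have "ennreal (pot (\<lambda>y. \<bar>f y\<bar>) x) \<le> ennreal P" by simp
    with P0 show ?thesis by (simp add: ennreal_le_iff)
  qed
  then show "\<exists>P. \<forall>x. pot (\<lambda>y. \<bar>f y\<bar>) x \<le> P" by blast
  have bound: "norm (pot f x) \<le> F * V * (norm x - R) powr (2 * \<beta> - real DIM('a))" if x: "R < norm x" for x
  proof -
    have "ennreal (norm (pot f x)) \<le> (\<integral>\<^sup>+y. ennreal (norm (rker (x - y) * f y)) \<partial>lborel)"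
      unfolding pot_def by (rule integral_norm_bound_ennreal[OF potableD(2)[OF pf]])
    also have "\<dots> \<le> (\<integral>\<^sup>+y. ennreal ((norm x - R) powr (2 * \<beta> - real DIM('a)) * F) * indicator {y::'a. norm y < R} y \<partial>lborel)"
    proof (rule nn_integral_mono)
      fix y
      show "ennreal (norm (rker (x - y) * f y)) \<le> ennreal ((norm x - R) powr (2 * \<beta> - real DIM('a)) * F) * indicator {y. norm y < R} y"
      proof (cases "norm y < R")
        case True
        have "norm x - R \<le> norm (x - y)" using norm_triangle_ineq2[of x y] True by linarith
        then have "rker (x - y) \<le> (norm x - R) powr (2 * \<beta> - real DIM('a))"
          unfolding rker_def using x beta by (intro powr_mono2') auto
        then have "norm (rker (x - y) * f y) \<le> (norm x - R) powr (2 * \<beta> - real DIM('a)) * F"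
          using bd[of y] by (auto simp: abs_mult intro!: mult_mono)
        then show ?thesis using True by (simp add: ennreal_leI)
      qed (use supp[of y] in simp)
    qed
    also have "\<dots> = ennreal ((norm x - R) powr (2 * \<beta> - real DIM('a)) * F) * ennreal V"
      by (subst nn_integral_cmult_indicator) (auto simp: V)
    finally show ?thesis
      using F V0 by (simp add: ennreal_mult'[symmetric] ennreal_mult''[symmetric] mult_ac)
  qed
  have "((\<lambda>r. F * V * (r - R) powr (2 * \<beta> - real DIM('a))) \<longlongrightarrow> F * V * 0) at_top"
    using beta by (intro tendsto_mult_left tendsto_neg_powr filterlim_tendsto_add_at_top[where f = "\<lambda>_. - R", unfolded add.commute[of "- R"], simplified])
      (auto intro: filterlim_ident)
  then have lim: "((\<lambda>x. F * V * (norm x - R) powr (2 * \<beta> - real DIM('a))) \<longlongrightarrow> 0) (at_infinity :: 'a filter)"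
    using filterlim_at_infinity_imp_norm_at_top[OF filterlim_ident] by (auto intro: filterlim_compose)
  show "(pot f \<longlongrightarrow> 0) at_infinity"
  proof (rule Lim_null_comparison[OF _ lim])
    show "\<forall>\<^sub>F x in at_infinity. norm (pot f x) \<le> F * V * (norm x - R) powr (2 * \<beta> - real DIM('a))"
      unfolding eventually_at_infinity using bound by (intro exI[of _ "R + 1"]) auto
  qed
qed


section \<open>Maximum principle and the integral equation\<close>

text \<open>Positivity on the whole space, not just near the origin, is what forces a potential with
  vanishing jump integral at its minimum to be constant almost everywhere.\<close>

lemma jumpr_pos:
  assumes "0 < \<epsilon>" "z \<noteq> 0"
  shows "0 < jumpr \<epsilon> z"
proof -
  have "jump \<epsilon> z \<noteq> 0"
  proof
    assume "jump \<epsilon> z = 0"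
    then have "AE t in lborel. ennreal (indicator {\<epsilon><..} t * t powr (- \<beta> - 1)) * ennreal (heat t z) = 0"
      unfolding jump_def subord_def by (subst (asm) nn_integral_0_iff_AE) auto
    then have "AE t in lborel. t \<notin> {\<epsilon><..}"
    proof eventually_elim
      case (elim t)
      show ?case
      proof
        assume "t \<in> {\<epsilon><..}"
        then show False using elim assms heat_pos[of t z] by (auto simp: ennreal_eq_0_iff)
      qed
    qed
    moreover have "open {\<epsilon><..}" "{\<epsilon><..} \<noteq> {}" by (auto intro: gt_ex)
    ultimately show False using lborel_AE_not_open by blast
  qed
  then show ?thesis
    using jump_finite[OF assms] by (simp add: jumpr_def enn2real_positive_iff zero_less_iff_neq_zero)
qed

lemma jumpr_antimono:
  assumes "0 < \<epsilon>" "\<epsilon> \<le> \<epsilon>'" "z \<noteq> 0"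
  shows "jumpr \<epsilon>' z \<le> jumpr \<epsilon> z"
  unfolding jumpr_def
proof (rule enn2real_mono)
  show "jump \<epsilon>' z \<le> jump \<epsilon> z"
    unfolding jump_def using assms by (intro subord_mono) (auto simp: indicator_def)
qed (use jump_finite[OF assms(1,3)] in simp)

lemma bounded_compact_support:
  assumes "continuous_on UNIV (k :: 'a \<Rightarrow> real)" "\<And>y. R \<le> norm y \<Longrightarrow> k y = 0"
  obtains F where "\<And>y. \<bar>k y\<bar> \<le> F"
proof -
  have "bounded (k ` cball 0 R)"
    by (intro compact_imp_bounded compact_continuous_image continuous_on_subset[OF assms(1)]) auto
  then obtain F0 where "\<forall>z\<in>k ` cball 0 R. norm z \<le> F0"
    unfolding bounded_iff by blast
  then have F0: "\<bar>k y\<bar> \<le> F0" if "norm y \<le> R" for y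
    using that by auto
  have "\<bar>k y\<bar> \<le> max F0 0" for y
    using F0[of y] assms(2)[of y] by (cases "norm y \<le> R") auto
  with that show ?thesis by blast
qed

text \<open>At a negative global minimum the truncated operators applied to the potential are negative and
  bounded away from \<open>0\<close> uniformly in the truncation; their limit is a positive multiple of \<open>f\<close>.\<close>

lemma pot_minimum:
  assumes f: "continuous_on UNIV f" and supp: "\<And>y. R \<le> norm y \<Longrightarrow> f y = 0"
    and neg: "pot f y0 < 0"
  obtains x0 where "\<And>z. pot f x0 \<le> pot f z" "pot f x0 < 0" "f x0 < 0"
proof -
  have fm: "f \<in> borel_measurable borel"
    using f by (rule borel_measurable_continuous_onI)
  obtain F where F: "\<And>y. \<bar>f y\<bar> \<le> F"
    using bounded_compact_support[OF f supp] by blast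
  note comp = pot_compact_support[OF fm F supp]
  have pf: "potable f" by (rule comp(1))
  have cont: "continuous_on UNIV (pot f)"
    using isCont_pot[OF pf F] by (simp add: continuous_on_eq_continuous_at)
  have tail: "\<exists>B. \<forall>z. B \<le> norm z \<longrightarrow> \<bar>pot f z\<bar> < e" if "0 < e" for e
    using tendstoD[OF comp(3) that] by (auto simp: eventually_at_infinity dist_real_def)
  \<comment> \<open>The potential vanishes at infinity, so outside a ball it stays above its
    negative value at \<open>y0\<close>, and the minimum over the ball is global.\<close>
  obtain B where B: "\<And>z. B \<le> norm z \<Longrightarrow> \<bar>pot f z\<bar> < - pot f y0"
    using tail[of "- pot f y0"] neg by auto
  have yB: "norm y0 < B" using B[of y0] neg by (cases "B \<le> norm y0") auto
  have "\<exists>x0\<in>cball 0 B. \<forall>z\<in>cball 0 B. pot f x0 \<le> pot f z"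
    using yB by (intro continuous_attains_inf compact_cball continuous_on_subset[OF cont]) (auto simp: not_less dest: order_le_less_trans[OF norm_ge_zero])
  then obtain x0 where "\<forall>z\<in>cball 0 B. pot f x0 \<le> pot f z" by blast
  then have x0: "pot f x0 \<le> pot f z" if "norm z \<le> B" for z using that by auto
  have min: "pot f x0 \<le> pot f z" for z
  proof (cases "norm z \<le> B")
    case False
    then have "pot f y0 < pot f z" using B[of z] by auto
    with x0[of y0] yB show ?thesis by simp
  qed (rule x0)
  have n0: "pot f x0 < 0" using min[of y0] neg by simp
  define I where "I \<epsilon> = (\<integral>y. jumpr \<epsilon> (x0 - y) * (pot f x0 - pot f y) \<partial>lborel)" for \<epsilon>
  have cf: "isCont f x0" using f by (simp add: continuous_on_eq_continuous_at)
  have int: "integrable lborel (\<lambda>y. jumpr \<epsilon> (x0 - y) * (pot f x0 - pot f y))" if "0 < \<epsilon>" for \<epsilon>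
    by (rule jumpr_pot_tendsto(1)[OF pf cf that])
  have lim: "(I \<longlongrightarrow> resid_mass / subord_const DIM('a) \<beta> * f x0) (at_right 0)"
    unfolding I_def by (rule jumpr_pot_tendsto(2)[OF pf cf])
  \<comment> \<open>\<open>pot f x0 - pot f y \<le> 0\<close>, and the kernel grows as
    \<open>\<epsilon>\<close> shrinks; hence \<open>I 1\<close> bounds all later values and their
    limit from above.\<close>
  have mono: "I \<epsilon> \<le> I 1" if "0 < \<epsilon>" "\<epsilon> \<le> 1" for \<epsilon>
    unfolding I_def
  proof (rule integral_mono_AE)
    show "AE y in lborel. jumpr \<epsilon> (x0 - y) * (pot f x0 - pot f y) \<le> jumpr 1 (x0 - y) * (pot f x0 - pot f y)"
      using AE_lborel_singleton[of x0]
    proof eventually_elim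
      case (elim y)
      then show ?case
        using jumpr_antimono[of \<epsilon> 1 "x0 - y"] that min[of y] by (intro mult_right_mono_neg) auto
    qed
  qed (use int that in auto)
  \<comment> \<open>If \<open>I 1\<close> vanished, \<open>pot f\<close> would equal its negative
    minimum almost everywhere, against its decay at infinity.\<close>
  have "I 1 < 0"
  proof (rule ccontr)
    assume "\<not> I 1 < 0"
    moreover have "I 1 = - (\<integral>y. jumpr 1 (x0 - y) * (pot f y - pot f x0) \<partial>lborel)"
      unfolding I_def by (subst Bochner_Integration.integral_minus[symmetric]) (simp add: algebra_simps)
    moreover have nn: "AE y in lborel. 0 \<le> jumpr 1 (x0 - y) * (pot f y - pot f x0)"
      using min by simp
    moreover have "0 \<le> (\<integral>y. jumpr 1 (x0 - y) * (pot f y - pot f x0) \<partial>lborel)"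
      using min by (intro integral_nonneg_AE) simp
    ultimately have z: "(\<integral>y. jumpr 1 (x0 - y) * (pot f y - pot f x0) \<partial>lborel) = 0" by simp
    have "integrable lborel (\<lambda>y. jumpr 1 (x0 - y) * (pot f y - pot f x0))"
      using int[of 1, THEN integrable_minus] by (simp add: algebra_simps)
    with z nn have ae: "AE y in lborel. jumpr 1 (x0 - y) * (pot f y - pot f x0) = 0"
      by (simp add: integral_nonneg_eq_0_iff_AE)
    obtain B' where B': "\<And>z. B' \<le> norm z \<Longrightarrow> \<bar>pot f z\<bar> < - pot f x0"
      using tail[of "- pot f x0"] n0 by auto
    have "AE y in lborel. y \<notin> {y::'a. B' < norm y}"
      using ae AE_lborel_singleton[of x0]
    proof eventually_elim
      case (elim y)
      then show ?case using jumpr_pos[of 1 "x0 - y"] B'[of y] by auto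
    qed
    moreover have "open {y::'a. B' < norm y}"
      by (intro open_Collect_less continuous_intros)
    moreover obtain v :: 'a where "norm v = \<bar>B'\<bar> + 1"
      using vector_choose_size[of "\<bar>B'\<bar> + 1"] by auto
    then have "v \<in> {y::'a. B' < norm y}" by simp
    ultimately show False using lborel_AE_not_open by blast
  qed
  moreover have "resid_mass / subord_const DIM('a) \<beta> * f x0 \<le> I 1"
  proof (rule tendsto_upperbound[OF lim])
    show "\<forall>\<^sub>F \<epsilon> in at_right 0. I \<epsilon> \<le> I 1"
      using mono by (intro eventually_at_rightI[of 0 1]) auto
  qed simp
  ultimately have "resid_mass / subord_const DIM('a) \<beta> * f x0 < 0" by linarith
  then have "f x0 < 0"
    using resid_mass_pos gc_pos by (simp add: mult_less_0_iff divide_less_0_iff)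
  with that min n0 show ?thesis by blast
qed

lemma pot_cmult: "pot (\<lambda>y. c * f y) x = c * pot f x"
  unfolding pot_def by (simp add: mult.left_commute)

lemma pot_maximum:
  assumes f: "continuous_on UNIV f" and supp: "\<And>y. R \<le> norm y \<Longrightarrow> f y = 0"
    and pos: "0 < pot f y0"
  obtains x0 where "\<And>z. pot f z \<le> pot f x0" "0 < pot f x0" "0 < f x0"
proof -
  have eq: "pot (\<lambda>y. - f y) x = - pot f x" for x
    using pot_cmult[of "-1" f x] by simp
  obtain x0 where "\<And>z. pot (\<lambda>y. - f y) x0 \<le> pot (\<lambda>y. - f y) z" "pot (\<lambda>y. - f y) x0 < 0" "- f x0 < 0"
    by (rule pot_minimum[of "\<lambda>y. - f y" R y0]) (use assms in \<open>auto simp: eq intro: continuous_intros\<close>)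
  then show ?thesis by (intro that[of x0]) (simp_all add: eq)
qed

text \<open>If the potential of \<open>k u\<close> exceeded \<open>B\<close>, then at its maximum
  \<open>u = g - pot f\<close> would be at most 0, whereas \<open>pot_maximum\<close> makes
  \<open>k u\<close> positive there; symmetrically at a minimum. The bound does not involve the size
  of \<open>k\<close>, which lets the continuation in the coupling constant proceed by steps of
  fixed length.\<close>

lemma a_priori_bound:
  assumes k: "continuous_on UNIV k" "\<And>y. 0 \<le> k y" "\<And>y. R \<le> norm y \<Longrightarrow> k y = 0"
    and u: "continuous_on UNIV u" and eq: "\<And>x. u x + pot (\<lambda>y. k y * u y) x = g x"
    and g: "\<And>x. \<bar>g x\<bar> \<le> B"
  shows "\<bar>u x\<bar> \<le> 2 * B"
proof -
  define f where "f y = k y * u y" for y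
  have f: "continuous_on UNIV f" "\<And>y. R \<le> norm y \<Longrightarrow> f y = 0"
    unfolding f_def using k u by (auto intro: continuous_intros)
  have eq': "pot f x = g x - u x" for x
    using eq[of x] unfolding f_def[abs_def] by simp
  have up: "pot f x \<le> B"
  proof (rule ccontr)
    assume "\<not> pot f x \<le> B"
    moreover have "0 \<le> B" using g[of x] by linarith
    ultimately have "0 < pot f x" "B < pot f x" by auto
    from pot_maximum[OF f this(1)] obtain x0 where x0: "\<And>z. pot f z \<le> pot f x0" "0 < f x0" by metis
    have "B < g x0 - u x0" using x0(1)[of x] \<open>B < pot f x\<close> eq'[of x0] by simp
    then have "u x0 \<le> 0" using g[of x0] by linarith
    then have "f x0 \<le> 0" unfolding f_def using k(2) by (intro mult_nonneg_nonpos)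
    with x0 show False by simp
  qed
  have lo: "- B \<le> pot f x"
  proof (rule ccontr)
    assume "\<not> - B \<le> pot f x"
    moreover have "0 \<le> B" using g[of x] by linarith
    ultimately have "pot f x < 0" "pot f x < - B" by auto
    from pot_minimum[OF f this(1)] obtain x0 where x0: "\<And>z. pot f x0 \<le> pot f z" "f x0 < 0" by metis
    have "g x0 - u x0 < - B" using x0(1)[of x] \<open>pot f x < - B\<close> eq'[of x0] by simp
    then have "0 \<le> u x0" using g[of x0] by linarith
    then have "0 \<le> f x0" unfolding f_def using k(2) by (intro mult_nonneg_nonneg)
    with x0 show False by simp
  qed
  show ?thesis using up lo g[of x] eq'[of x] by linarith
qed

text \<open>Method of continuity in the coupling constant \<open>t\<close>.\<close>

lemma integral_equation_bcontfun:
  fixes g :: "'a \<Rightarrow>\<^sub>C real"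
  assumes k: "continuous_on UNIV k" "\<And>y. 0 \<le> k y" "\<And>y. R \<le> norm y \<Longrightarrow> k y = 0"
  shows "\<exists>u :: 'a \<Rightarrow>\<^sub>C real. \<forall>x. u x + pot (\<lambda>y. k y * u y) x = g x"
proof -
  obtain F where F: "\<And>y. \<bar>k y\<bar> \<le> F" using bounded_compact_support[OF k(1,3)] by blast
  have km [measurable]: "k \<in> borel_measurable borel"
    using k(1) by (rule borel_measurable_continuous_onI)
  obtain N0 where N0: "\<And>x. pot (\<lambda>y. \<bar>k y\<bar>) x \<le> N0"
    using pot_compact_support(2)[OF km F k(3)] by auto
  \<comment> \<open>\<open>N\<close> bounds the norm of the operator \<open>T\<close> below; the
    maximum with 1 only ensures positivity.\<close>
  define N where "N = max N0 1"
  have N: "\<And>x. pot k x \<le> N" "0 < N" using N0 k(2) by (auto simp: N_def le_max_iff_disj)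
  have pk: "potable k" by (rule pot_compact_support(1)[OF km F k(3)])
  have um [measurable]: "apply_bcontfun u \<in> borel_measurable borel" for u :: "'a \<Rightarrow>\<^sub>C real"
    by (rule borel_measurable_continuous_onI) simp
  have un: "\<bar>u x\<bar> \<le> norm u" for u :: "'a \<Rightarrow>\<^sub>C real" and x
    using norm_bounded[of u x] by simp
  have kub: "\<bar>k y * u y\<bar> \<le> F * norm u" for u :: "'a \<Rightarrow>\<^sub>C real" and y
    unfolding abs_mult using F[of y] un[of u y] by (intro mult_mono) auto
  have pku: "potable (\<lambda>y. k y * u y)" for u :: "'a \<Rightarrow>\<^sub>C real"
    by (rule pot_compact_support(1)[where R = R, OF _ kub]) (auto simp: k(3))
  have potb: "\<bar>pot (\<lambda>y. k y * u y) x\<bar> \<le> N * c" if c: "\<And>y. \<bar>u y\<bar> \<le> c" for u :: "'a \<Rightarrow>\<^sub>C real" and x c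
  proof -
    have c0: "0 \<le> c" using c[of 0] by linarith
    have "\<bar>pot (\<lambda>y. k y * u y) x\<bar> \<le> c * pot (\<lambda>y. \<bar>k y\<bar>) x"
    proof -
      have eq: "pot (\<lambda>y. k y * u y) x = (\<integral>y. (rker (x - y) * u y) * k y \<partial>lborel)"
        unfolding pot_def by (simp add: mult_ac)
      show ?thesis
        unfolding eq
      proof (rule integral_kernel_le[OF pk])
        show "integrable lborel (\<lambda>y. (rker (x - y) * u y) * k y)"
          using potableD(2)[OF pku[of u], of x] by (simp add: mult_ac)
        show "\<bar>rker (x - y) * u y\<bar> \<le> c * rker (x - y)" for y
          using c[of y] by (simp add: abs_mult mult.commute mult_right_mono)
      qed
    qed
    also have "\<dots> \<le> c * N"
      using k(2) N c0 by (intro mult_left_mono) auto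
    finally show ?thesis by (simp add: mult.commute)
  qed
  define T where "T u = Bcontfun (pot (\<lambda>y. k y * apply_bcontfun u y))" for u :: "'a \<Rightarrow>\<^sub>C real"
  have T: "apply_bcontfun (T u) x = pot (\<lambda>y. k y * apply_bcontfun u y) x" for u x
    unfolding T_def
  proof (subst Bcontfun_inverse)
    show "pot (\<lambda>y. k y * apply_bcontfun u y) \<in> bcontfun"
      using isCont_pot[OF pku kub] potb[OF un]
      by (intro bcontfun_normI[of _ "N * norm u"]) (auto simp: continuous_on_eq_continuous_at)
  qed simp
  have T_diff: "T u - T v = T (u - v)" for u v
  proof (rule bcontfun_eqI)
    fix x
    show "apply_bcontfun (T u - T v) x = apply_bcontfun (T (u - v)) x"
      using pot_diff[OF pku[of u] pku[of v], of x] by (simp add: T right_diff_distrib)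
  qed
  have T_norm: "norm (T u) \<le> N * norm u" for u
    by (intro norm_bound) (simp add: T potb[OF un])
  \<comment> \<open>Solvability for every right-hand side, so that a solution map \<open>Q\<close>
    is available for the next step.\<close>
  define S where "S t \<longleftrightarrow> (\<forall>g. \<exists>u. u + t *\<^sub>R T u = g)" for t :: real
  have apriori: "norm u \<le> 2 * norm g" if "0 \<le> t" "u + t *\<^sub>R T u = g" for t u g
  proof (rule norm_bound)
    fix x
    have "\<bar>u x\<bar> \<le> 2 * norm g"
    proof (rule a_priori_bound[where k = "\<lambda>y. t * k y" and R = R and u = u and g = g])
      fix x
      have "apply_bcontfun (u + t *\<^sub>R T u) x = g x" using that by simp
      then show "u x + pot (\<lambda>y. t * k y * u y) x = g x"
        by (simp add: T mult.assoc pot_cmult)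
    qed (use k that un in \<open>auto intro: continuous_intros\<close>)
    then show "norm (u x) \<le> 2 * norm g" by simp
  qed
  \<comment> \<open>The a priori bound makes \<open>Q\<close> Lipschitz with constant 2, whatever
    \<open>t\<close> is. The equation at \<open>t + \<tau>\<close> reads
    \<open>u = Q (g - \<tau> *\<^sub>R T u)\<close>, a contraction as soon as
    \<open>2 * N * \<tau> < 1\<close>.\<close>
  have step: "S (t + \<tau>)" if S: "S t" and t: "0 \<le> t" "0 \<le> \<tau>" "2 * N * \<tau> < 1" for t \<tau>
    unfolding S_def
  proof
    fix g
    obtain Q where Q: "\<And>g. Q g + t *\<^sub>R T (Q g) = g" using S unfolding S_def by metis
    have Qd: "norm (Q a - Q b) \<le> 2 * norm (a - b)" for a b
    proof (rule apriori[OF t(1)])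
      show "Q a - Q b + t *\<^sub>R T (Q a - Q b) = a - b"
        using Q[of a] Q[of b] by (simp add: T_diff[symmetric] algebra_simps)
    qed
    have "\<exists>!u. Q (g - \<tau> *\<^sub>R T u) = u"
    proof (rule banach_fix_type[where c = "2 * N * \<tau>"], goal_cases)
      case 3
      show ?case
      proof (intro allI)
      fix u v
      have "dist (Q (g - \<tau> *\<^sub>R T u)) (Q (g - \<tau> *\<^sub>R T v)) \<le> 2 * norm ((g - \<tau> *\<^sub>R T u) - (g - \<tau> *\<^sub>R T v))"
        unfolding dist_norm by (rule Qd)
      also have "(g - \<tau> *\<^sub>R T u) - (g - \<tau> *\<^sub>R T v) = - (\<tau> *\<^sub>R T (u - v))"
        by (simp add: T_diff[symmetric] scaleR_diff_right)
      also have "2 * norm (- (\<tau> *\<^sub>R T (u - v))) \<le> 2 * (\<tau> * (N * norm (u - v)))"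
        using t T_norm[of "u - v"] by (simp add: mult_left_mono)
      finally show "dist (Q (g - \<tau> *\<^sub>R T u)) (Q (g - \<tau> *\<^sub>R T v)) \<le> 2 * N * \<tau> * dist u v"
        by (simp add: dist_norm mult_ac)
      qed
    qed (use t N in auto)
    then obtain u where "Q (g - \<tau> *\<^sub>R T u) = u" by blast
    then have "u + t *\<^sub>R T u = g - \<tau> *\<^sub>R T u" using Q[of "g - \<tau> *\<^sub>R T u"] by simp
    then show "\<exists>u. u + (t + \<tau>) *\<^sub>R T u = g"
      by (intro exI[of _ u]) (simp add: scaleR_left_distrib algebra_simps)
  qed
  \<comment> \<open>Steps of length \<open>1 / J\<close> are admissible at every stage, so
    \<open>J\<close> of them lead from \<open>t = 0\<close> to \<open>t = 1\<close>.\<close>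
  obtain J :: nat where J: "2 * N < real J" using reals_Archimedean2 by blast
  have J0: "0 < real J" using J N by linarith
  have "S (real j * (1 / real J))" for j
  proof (induction j)
    case 0
    show ?case by (auto simp: S_def)
  next
    case (Suc j)
    have "S (real j * (1 / real J) + 1 / real J)"
      by (rule step[OF Suc]) (use J J0 in \<open>auto simp: field_simps\<close>)
    then show ?case by (simp add: distrib_right add.commute add_divide_distrib)
  qed
  from this[of J] have "S 1" using J0 by simp
  then obtain u where u: "u + 1 *\<^sub>R T u = g" unfolding S_def by blast
  have "u x + pot (\<lambda>y. k y * u y) x = g x" for x
    using arg_cong[OF u, of "\<lambda>v. apply_bcontfun v x"] by (simp add: T)
  then show ?thesis by blast
qed

text \<open>Where \<open>u < 0\<close> the potential of \<open>k u\<close> exceeds 1, so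
  \<open>u\<close> is negative at the maximum of the potential as well, while
  \<open>pot_maximum\<close> makes \<open>k u\<close> positive there. Once \<open>u \<ge> 0\<close>
  is known the potential is nonnegative, and \<open>u \<le> 1\<close> follows.\<close>

lemma integral_equation_compact:
  assumes k: "continuous_on UNIV k" "\<And>y. 0 \<le> k y" "\<And>y. R \<le> norm y \<Longrightarrow> k y = 0"
  obtains u where "continuous_on UNIV u" "\<And>x. 0 \<le> u x" "\<And>x. u x \<le> 1"
    "\<And>x. u x + pot (\<lambda>y. k y * u y) x = 1"
proof -
  obtain v :: "'a \<Rightarrow>\<^sub>C real" where v: "\<And>x. v x + pot (\<lambda>y. k y * v y) x = const_bcontfun 1 x"
    using integral_equation_bcontfun[OF k] by blast
  define u where "u = apply_bcontfun v"
  have eq: "u x + pot (\<lambda>y. k y * u y) x = 1" for x using v[of x] by (simp add: u_def const_bcontfun.rep_eq)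
  have u: "continuous_on UNIV u" by (simp add: u_def)
  have f: "continuous_on UNIV (\<lambda>y. k y * u y)" "\<And>y. R \<le> norm y \<Longrightarrow> k y * u y = 0"
    using k u by (auto intro: continuous_intros)
  have nonneg: "0 \<le> u x" for x
  proof (rule ccontr)
    assume "\<not> 0 \<le> u x"
    then have "0 < pot (\<lambda>y. k y * u y) x" "1 < pot (\<lambda>y. k y * u y) x" using eq[of x] by auto
    from pot_maximum[OF f this(1)] obtain x0 where x0:
      "\<And>z. pot (\<lambda>y. k y * u y) z \<le> pot (\<lambda>y. k y * u y) x0" "0 < k x0 * u x0" by metis
    have "u x0 < 0" using x0(1)[of x] \<open>1 < _\<close> eq[of x0] by simp
    then have "k x0 * u x0 \<le> 0" using k(2) by (intro mult_nonneg_nonpos) auto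
    with x0 show False by simp
  qed
  have "u x \<le> 1" for x
    using eq[of x] pot_nonneg[of "\<lambda>y. k y * u y" x] k nonneg by simp
  with that u nonneg eq show ?thesis by blast
qed

text \<open>The potential of \<open>k' u' - k u\<close> is \<open>u - u'\<close>. At a negative
  minimum, \<open>u < u'\<close> and \<open>k \<le> k'\<close> make this density nonnegative,
  against \<open>pot_minimum\<close>. Consequently an increasing exhaustion of \<open>k\<close> has
  decreasing solutions.\<close>

lemma integral_equation_mono:
  assumes k: "continuous_on UNIV k" "\<And>y. 0 \<le> k y" "\<And>y. R \<le> norm y \<Longrightarrow> k y = 0"
    and k': "continuous_on UNIV k'" "\<And>y. k y \<le> k' y" "\<And>y. R \<le> norm y \<Longrightarrow> k' y = 0"
    and u: "continuous_on UNIV u" "\<And>x. u x + pot (\<lambda>y. k y * u y) x = 1"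
    and u': "continuous_on UNIV u'" "\<And>x. u' x + pot (\<lambda>y. k' y * u' y) x = 1" "\<And>x. 0 \<le> u' x"
  shows "u' x \<le> u x"
proof (rule ccontr)
  define f where "f y = k' y * u' y - k y * u y" for y
  have c1: "continuous_on UNIV (\<lambda>y. k y * u y)" "\<And>y. R \<le> norm y \<Longrightarrow> k y * u y = 0"
    and c2: "continuous_on UNIV (\<lambda>y. k' y * u' y)" "\<And>y. R \<le> norm y \<Longrightarrow> k' y * u' y = 0"
    using k k' u u' by (auto intro: continuous_intros)
  have p: "potable w" if "continuous_on UNIV w" "\<And>y. R \<le> norm y \<Longrightarrow> w y = 0" for w
    by (rule bounded_compact_support[OF that])
       (auto intro!: pot_compact_support(1)[OF borel_measurable_continuous_onI[OF that(1)] _ that(2)])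
  have f: "continuous_on UNIV f" "\<And>y. R \<le> norm y \<Longrightarrow> f y = 0"
    unfolding f_def using c1(1) c2(1) by (auto intro: continuous_intros simp: k(3) k'(3))
  have eq: "pot f z = u z - u' z" for z
    unfolding f_def using pot_diff[OF p[OF c2] p[OF c1], of z] u(2)[of z] u'(2)[of z] by simp
  assume "\<not> u' x \<le> u x"
  then have "pot f x < 0" by (simp add: eq)
  from pot_minimum[OF f this] obtain x0 where x0: "pot f x0 < 0" "f x0 < 0" by metis
  have "u x0 < u' x0" using x0(1) by (simp add: eq)
  then have "k x0 * u x0 \<le> k x0 * u' x0" using k(2) by (intro mult_left_mono) auto
  also have "\<dots> \<le> k' x0 * u' x0" using k'(2) u'(3) by (intro mult_right_mono) auto
  finally show False using x0(2) by (simp add: f_def)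
qed

text \<open>Monotonicity gives pointwise convergence without any compactness argument, and
  potability of \<open>k\<close> supplies the majorant \<open>rker (x - y) * k y\<close> that
  carries the equation to the limit. The limit is so far only measurable; its continuity comes from
  the regularity estimates.\<close>

theorem integral_equation:
  assumes k: "continuous_on UNIV k" "\<And>y. 0 \<le> k y" "potable k"
  obtains u where "u \<in> borel_measurable borel" "\<And>x. 0 \<le> u x" "\<And>x. u x \<le> 1"
    "\<And>x. u x + pot (\<lambda>y. k y * u y) x = 1"
proof -
  \<comment> \<open>Increasing in \<open>m\<close>, equal to 1 for \<open>norm y \<le> m - 1\<close>
    and to 0 for \<open>norm y \<ge> m\<close>.\<close>
  define cut where "cut m y = max 0 (min 1 (real m - norm y))" for m :: nat and y :: 'a
  have chi: "continuous_on UNIV (cut m)" "\<And>y. 0 \<le> cut m y" "\<And>y. cut m y \<le> 1" "\<And>y. real m \<le> norm y \<Longrightarrow> cut m y = 0" for m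
    unfolding cut_def[abs_def] by (auto intro!: continuous_intros)
  have chi_mono: "cut m y \<le> cut (Suc m) y" for m y by (auto simp: cut_def)
  define K where "K m y = cut m y * k y" for m y
  have K: "continuous_on UNIV (K m)" "\<And>y. 0 \<le> K m y" "\<And>y. real m \<le> norm y \<Longrightarrow> K m y = 0" for m
    unfolding K_def[abs_def] using chi k by (auto intro!: continuous_intros)
  have "\<exists>u. continuous_on UNIV u \<and> (\<forall>x. 0 \<le> u x) \<and> (\<forall>x. u x \<le> 1) \<and> (\<forall>x. u x + pot (\<lambda>y. K m y * u y) x = 1)" for m
    using integral_equation_compact[OF K] by metis
  then obtain U where U: "\<And>m. continuous_on UNIV (U m)" "\<And>m x. 0 \<le> U m x" "\<And>m x. U m x \<le> 1"
    "\<And>m x. U m x + pot (\<lambda>y. K m y * U m y) x = 1" by metis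
  have dec: "U (Suc m) x \<le> U m x" for m x
  proof (rule integral_equation_mono[where R = "real (Suc m)" and k = "K m" and k' = "K (Suc m)"])
    show "K m y \<le> K (Suc m) y" for y
      unfolding K_def using chi_mono k(2) by (intro mult_right_mono)
  qed (use K U in auto)
  have "decseq (\<lambda>m. U m x)" for x by (intro decseq_SucI dec)
  then have "\<exists>L. (\<lambda>m. U m x) \<longlonglongrightarrow> L" for x
    using decseq_convergent[of "\<lambda>m. U m x" 0] U(2) by metis
  then obtain u where u: "\<And>x. (\<lambda>m. U m x) \<longlonglongrightarrow> u x" by metis
  have um [measurable]: "u \<in> borel_measurable borel"
    by (rule borel_measurable_LIMSEQ_real[OF u]) (intro borel_measurable_continuous_onI U)
  have km [measurable]: "k \<in> borel_measurable borel" using k(1) by (rule borel_measurable_continuous_onI)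
  have Km [measurable]: "K m \<in> borel_measurable borel" for m by (intro borel_measurable_continuous_onI K)
  have Um [measurable]: "U m \<in> borel_measurable borel" for m by (intro borel_measurable_continuous_onI U)
  have Kl: "(\<lambda>m. K m y) \<longlonglongrightarrow> k y" for y
  proof (rule tendsto_eventually)
    obtain m0 :: nat where m0: "norm y + 1 < real m0" using reals_Archimedean2 by blast
    show "\<forall>\<^sub>F m in sequentially. K m y = k y"
      using eventually_ge_at_top[of m0]
    proof eventually_elim
      case (elim m)
      then have "real m0 \<le> real m" by simp
      then show ?case using m0 by (simp add: K_def cut_def)
    qed
  qed
  have 0: "0 \<le> u x" and 1: "u x \<le> 1" for x
    by (rule LIMSEQ_le_const[OF u], use U in blast) (rule LIMSEQ_le_const2[OF u], use U in blast)
  have "u x + pot (\<lambda>y. k y * u y) x = 1" for x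
  proof -
    have "(\<lambda>m. pot (\<lambda>y. K m y * U m y) x) \<longlonglongrightarrow> pot (\<lambda>y. k y * u y) x"
      unfolding pot_def
    proof (rule integral_dominated_convergence[where w = "\<lambda>y. rker (x - y) * k y"])
      show "integrable lborel (\<lambda>y. rker (x - y) * k y)" by (rule potableD(2)[OF k(3)])
      show "AE y in lborel. (\<lambda>m. rker (x - y) * (K m y * U m y)) \<longlonglongrightarrow> rker (x - y) * (k y * u y)"
        by (intro AE_I2 tendsto_intros Kl u)
      fix m
      show "AE y in lborel. norm (rker (x - y) * (K m y * U m y)) \<le> rker (x - y) * k y"
      proof (rule AE_I2)
        fix y
        have "K m y * U m y \<le> k y * 1"
          using U k(2)[of y] chi(2,3)[of m y] K by (intro mult_mono) (auto simp: K_def mult_left_le_one_le)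
        then show "norm (rker (x - y) * (K m y * U m y)) \<le> rker (x - y) * k y"
          using U(2) K(2) by (simp add: abs_mult mult_left_mono)
      qed
    qed measurable
    then have "(\<lambda>m. U m x + pot (\<lambda>y. K m y * U m y) x) \<longlonglongrightarrow> u x + pot (\<lambda>y. k y * u y) x"
      by (intro tendsto_add u)
    then show ?thesis unfolding U(4) by (simp add: LIMSEQ_const_iff)
  qed
  with that um 0 1 show ?thesis by blast
qed

end

section \<open>Absorption and bounded second differences\<close>

text \<open>Let \<open>d x\<close> be the distance to the boundary and \<open>A\<close> the supremum
  of \<open>d x ^ m * \<bar>w x\<bar>\<close>. On the ball of radius
  \<open>\<delta> = l * d x\<close> about \<open>x\<close> the distance is at least
  \<open>d x / 2\<close>, so \<open>A\<close> supplies the bound \<open>B\<close> there, and the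
  estimate returns \<open>A \<le> C0 * \<eta> ^ m + A / 2\<close>. The crude bound \<open>W\<close>
  makes \<open>A\<close> finite, which allows \<open>A / 2\<close> to be subtracted.
  \<open>C\<close> is fixed before \<open>w\<close> and \<open>\<eta>\<close>, hence is uniform in
  the step when \<open>w\<close> is a difference of a function.\<close>

lemma absorption:
  fixes x0 :: "'a::real_normed_vector"
  assumes "0 < \<rho>" "0 \<le> P" "0 \<le> Q" "0 < \<theta>" "0 \<le> W"
  shows "\<exists>C\<ge>0. \<forall>w \<eta>. 0 \<le> \<eta> \<longrightarrow> (\<forall>x. norm (x - x0) < \<rho> \<longrightarrow> \<bar>w x\<bar> \<le> W) \<longrightarrow>
      (\<forall>x \<delta> B. norm (x - x0) < \<rho> \<longrightarrow> 0 < \<delta> \<longrightarrow> 2 * \<eta> \<le> \<delta> \<longrightarrow> 2 * \<delta> \<le> \<rho> - norm (x - x0) \<longrightarrow> 0 \<le> B \<longrightarrow>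
        (\<forall>y. norm (x - y) < \<delta> \<longrightarrow> \<bar>w y\<bar> \<le> B) \<longrightarrow> \<bar>w x\<bar> \<le> P * (\<eta> / \<delta>) ^ m + Q * \<delta> powr \<theta> * B) \<longrightarrow>
      (\<forall>x. 2 * norm (x - x0) \<le> \<rho> \<longrightarrow> \<bar>w x\<bar> \<le> C * \<eta> ^ m)"
proof -
  \<comment> \<open>Makes \<open>Q * t powr \<theta> * 2 ^ m \<le> 1 / 2\<close>, where
    \<open>2 ^ m\<close> is the loss from \<open>d y \<ge> d x / 2\<close>; \<open>Q + 1\<close>
    covers \<open>Q = 0\<close>.\<close>
  define t where "t = (1 / (2 * 2 ^ m * (Q + 1))) powr (1 / \<theta>)"
  have t: "0 < t" "t powr \<theta> = 1 / (2 * 2 ^ m * (Q + 1))"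
    using assms by (simp_all add: t_def powr_powr)
  define l where "l = min (1 / 2) (t / \<rho>)"
  have l: "0 < l" "l \<le> 1 / 2" "l * \<rho> \<le> t"
  proof -
    show "0 < l" using t assms by (simp add: l_def)
    show "l \<le> 1 / 2" unfolding l_def by (rule min.cobounded1)
    have "l \<le> t / \<rho>" by (simp add: l_def)
    then show "l * \<rho> \<le> t" using assms by (simp add: field_simps)
  qed
  \<comment> \<open>The first summand serves points so close to the boundary that
    \<open>l * d x \<le> 2 * \<eta>\<close>, where only \<open>W\<close> is at hand; the second
    serves all other points.\<close>
  define C0 where "C0 = (2 / l) ^ m * W + P / l ^ m"
  have C0: "0 \<le> C0" using assms l by (simp add: C0_def)
  define C where "C = 2 * C0 / (\<rho> / 2) ^ m"
  have Cn: "0 \<le> C" using C0 assms by (simp add: C_def)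
  have main: "\<bar>w x\<bar> \<le> C * \<eta> ^ m"
    if eta: "0 \<le> \<eta>" and W0: "\<forall>x. norm (x - x0) < \<rho> \<longrightarrow> \<bar>w x\<bar> \<le> W"
      and est0: "\<forall>x \<delta> B. norm (x - x0) < \<rho> \<longrightarrow> 0 < \<delta> \<longrightarrow> 2 * \<eta> \<le> \<delta> \<longrightarrow> 2 * \<delta> \<le> \<rho> - norm (x - x0) \<longrightarrow> 0 \<le> B \<longrightarrow>
        (\<forall>y. norm (x - y) < \<delta> \<longrightarrow> \<bar>w y\<bar> \<le> B) \<longrightarrow> \<bar>w x\<bar> \<le> P * (\<eta> / \<delta>) ^ m + Q * \<delta> powr \<theta> * B"
      and x: "2 * norm (x - x0) \<le> \<rho>" for w \<eta> x
  proof -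
    note W = W0[rule_format] and est = est0[rule_format]
    define d where "d x = \<rho> - norm (x - x0)" for x
    define g where "g x = d x ^ m * \<bar>w x\<bar>" for x
    define A where "A = (SUP x\<in>ball x0 \<rho>. g x)"
    have ne: "ball x0 \<rho> \<noteq> {}" using assms by simp
    have bdd: "bdd_above (g ` ball x0 \<rho>)"
    proof (rule bdd_aboveI2)
      fix x assume "x \<in> ball x0 \<rho>"
      then have n: "norm (x - x0) < \<rho>" by (simp add: dist_norm norm_minus_commute)
      then have "0 \<le> d x" "d x \<le> \<rho>" by (auto simp: d_def)
      then show "g x \<le> \<rho> ^ m * W"
        unfolding g_def using W[OF n] assms by (intro mult_mono power_mono) auto
    qed
    have gA: "g x \<le> A" if "norm (x - x0) < \<rho>" for x
      unfolding A_def using that bdd by (intro cSUP_upper) (auto simp: dist_norm norm_minus_commute)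
    have "0 \<le> g x0" using assms by (simp add: g_def d_def)
    then have A0: "0 \<le> A" using gA[of x0] assms by simp
    have key: "g x \<le> C0 * \<eta> ^ m + A / 2" if n: "norm (x - x0) < \<rho>" for x
    proof -
      have d: "0 < d x" "d x \<le> \<rho>" using n by (auto simp: d_def)
      show ?thesis
      proof (cases "l * d x \<le> 2 * \<eta>")
        case True
        then have "d x \<le> 2 / l * \<eta>" using l by (simp add: field_simps)
        then have "g x \<le> (2 / l * \<eta>) ^ m * W"
          unfolding g_def using W[OF n] d assms l eta by (intro mult_mono power_mono) auto
        also have "\<dots> = ((2 / l) ^ m * W) * \<eta> ^ m" by (simp only: power_mult_distrib mult_ac)
        also have "\<dots> \<le> C0 * \<eta> ^ m"
          unfolding C0_def using assms l eta by (intro mult_right_mono) auto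
        finally show ?thesis using A0 by simp
      next
        case False
        define \<delta> where "\<delta> = l * d x"
        have del: "0 < \<delta>" "2 * \<eta> \<le> \<delta>" "2 * \<delta> \<le> d x"
          using False d l mult_right_mono[of l "1/2" "d x"] by (auto simp: \<delta>_def)
        define B where "B = A * 2 ^ m / d x ^ m"
        have B0: "0 \<le> B" using A0 d by (simp add: B_def)
        have "\<bar>w y\<bar> \<le> B" if y: "norm (x - y) < \<delta>" for y
        proof -
          have "norm (y - x0) \<le> norm (x - x0) + norm (x - y)"
            using norm_triangle_ineq4[of "x - x0" "x - y"] by simp
          then have dy: "d x / 2 \<le> d y" using y del by (simp add: d_def)
          then have "norm (y - x0) < \<rho>" using d by (simp add: d_def)
          have "(d x / 2) ^ m * \<bar>w y\<bar> \<le> g y"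
            unfolding g_def using dy d by (intro mult_right_mono power_mono) auto
          also have "\<dots> \<le> A" by (rule gA) fact
          finally show ?thesis using d by (simp add: B_def power_divide field_simps)
        qed
        from est[OF n del(1,2) del(3)[unfolded d_def] B0 this]
        have "\<bar>w x\<bar> \<le> P * (\<eta> / \<delta>) ^ m + Q * \<delta> powr \<theta> * B" by blast
        then have "g x \<le> d x ^ m * (P * (\<eta> / \<delta>) ^ m + Q * \<delta> powr \<theta> * B)"
          unfolding g_def using d by (intro mult_left_mono) auto
        also have "\<dots> = P / l ^ m * \<eta> ^ m + Q * \<delta> powr \<theta> * (2 ^ m * A)"
        proof -
          have "d x ^ m * (\<eta> / \<delta>) ^ m = \<eta> ^ m / l ^ m"
            using d l by (simp add: \<delta>_def power_divide power_mult_distrib)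
          moreover have "d x ^ m * B = 2 ^ m * A" using d by (simp add: B_def)
          moreover have "d x ^ m * (P * (\<eta> / \<delta>) ^ m + Q * \<delta> powr \<theta> * B)
              = P * (d x ^ m * (\<eta> / \<delta>) ^ m) + Q * \<delta> powr \<theta> * (d x ^ m * B)"
            by (simp only: distrib_left mult_ac)
          ultimately show ?thesis by simp
        qed
        also have "\<dots> \<le> C0 * \<eta> ^ m + A / 2"
        proof (rule add_mono)
          show "P / l ^ m * \<eta> ^ m \<le> C0 * \<eta> ^ m"
            unfolding C0_def using assms l eta by (intro mult_right_mono) auto
          have "\<delta> \<le> t" using l d by (auto simp: \<delta>_def intro: order_trans[OF mult_left_mono])
          then have "\<delta> powr \<theta> \<le> t powr \<theta>" using del assms by (intro powr_mono2) auto
          then have "Q * \<delta> powr \<theta> * (2 ^ m * A) \<le> Q * (1 / (2 * 2 ^ m * (Q + 1))) * (2 ^ m * A)"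
            unfolding t(2) using assms A0 by (intro mult_right_mono mult_left_mono) auto
          also have "\<dots> = (Q / (Q + 1)) * (A / 2)" by simp
          also have "\<dots> \<le> 1 * (A / 2)"
            using assms A0 by (intro mult_right_mono) auto
          finally show "Q * \<delta> powr \<theta> * (2 ^ m * A) \<le> A / 2" by simp
        qed
        finally show ?thesis .
      qed
    qed
    have "A \<le> C0 * \<eta> ^ m + A / 2"
      unfolding A_def by (rule cSUP_least[OF ne]) (use key[unfolded A_def] in \<open>auto simp: dist_norm norm_minus_commute\<close>)
    then have A: "A \<le> 2 * C0 * \<eta> ^ m" by simp
    have n: "norm (x - x0) < \<rho>" using x assms by simp
    have "(\<rho> / 2) ^ m * \<bar>w x\<bar> \<le> g x"
      unfolding g_def using x assms by (intro mult_right_mono power_mono) (auto simp: d_def)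
    also have "\<dots> \<le> 2 * C0 * \<eta> ^ m" using gA[OF n] A by simp
    finally show ?thesis using assms by (simp add: C_def field_simps)
  qed
  show ?thesis by (intro exI[of _ C] conjI Cn allI impI) (rule main)
qed

section \<open>From bounded second differences to a Lipschitz derivative\<close>

lemma geometric_increments_limit:
  fixes s :: "nat \<Rightarrow> real"
  assumes "\<And>j. \<bar>s (Suc j) - s j\<bar> \<le> c / 2 ^ j"
  shows "\<exists>l. s \<longlonglongrightarrow> l \<and> \<bar>l - s 0\<bar> \<le> 2 * c"
proof -
  have g: "(\<lambda>j. c * (1 / 2) ^ j) sums (c * 2)"
    using sums_mult[OF geometric_sums[of "1 / 2 :: real"], of c] by simp
  have le: "norm (s (Suc j) - s j) \<le> c * (1 / 2) ^ j" for j
    using assms[of j] by (simp only: real_norm_def power_one_over times_divide_eq_right mult_1_right)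
  have sm: "summable (\<lambda>j. s (Suc j) - s j)"
    by (rule summable_comparison_test[OF _ sums_summable[OF g]]) (use le in auto)
  define l where "l = s 0 + (\<Sum>j. s (Suc j) - s j)"
  have "(\<lambda>n. s 0 + (\<Sum>j<n. s (Suc j) - s j)) \<longlonglongrightarrow> l"
    unfolding l_def by (intro tendsto_add tendsto_const summable_LIMSEQ sm)
  then have "s \<longlonglongrightarrow> l" by (simp add: sum_lessThan_telescope)
  moreover have "norm (\<Sum>j. s (Suc j) - s j) \<le> (\<Sum>j. c * (1 / 2) ^ j)"
    by (rule norm_suminf_le[OF le sums_summable[OF g]])
  ultimately show ?thesis using sums_unique[OF g] by (auto simp: l_def)
qed

text \<open>For every \<open>N\<close>, \<open>N\<close> times the defect
  \<open>A (c *\<^sub>R h) - c * A h\<close> equals \<open>A (r *\<^sub>R h) - r * A h\<close> with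
  \<open>r\<close> the fractional part of \<open>N * c\<close>. The latter is bounded independently
  of \<open>N\<close>, so the defect vanishes.\<close>

lemma additive_bounded_linear:
  fixes A :: "'a::real_normed_vector \<Rightarrow> real"
  assumes add: "\<And>a b. A (a + b) = A a + A b" and bd: "\<And>h. \<bar>A h\<bar> \<le> C * norm h"
  shows "bounded_linear A"
proof -
  have A0: "A 0 = 0" using add[of 0 0] by simp
  have nat: "A (real n *\<^sub>R h) = real n * A h" for n h
    by (induction n) (simp_all add: A0 add scaleR_left_distrib distrib_right)
  have neg: "A (- h) = - A h" for h using add[of h "- h"] A0 by simp
  have int: "A (of_int i *\<^sub>R h) = of_int i * A h" for i h
  proof (cases "0 \<le> i")
    case True
    then show ?thesis using nat[of "nat i" h] by simp
  next
    case False
    have "of_int i *\<^sub>R h = - (real (nat (- i)) *\<^sub>R h)" using False by simp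
    then show ?thesis using nat[of "nat (- i)" h] False by (simp only: neg) simp
  qed
  have "A (c *\<^sub>R h) = c * A h" for c h
  proof (rule ccontr)
    assume "A (c *\<^sub>R h) \<noteq> c * A h"
    then have "0 < \<bar>A (c *\<^sub>R h) - c * A h\<bar>" by simp
    then obtain N where N: "\<bar>C * norm h\<bar> + \<bar>A h\<bar> < real N * \<bar>A (c *\<^sub>R h) - c * A h\<bar>"
      using reals_Archimedean3 by blast
    define i where "i = \<lfloor>real N * c\<rfloor>"
    define r where "r = real N * c - of_int i"
    have r: "0 \<le> r" "r \<le> 1" unfolding r_def i_def by linarith+
    have "real N * A (c *\<^sub>R h) = A (of_int i *\<^sub>R h + r *\<^sub>R h)"
      using nat[of N "c *\<^sub>R h"] by (simp add: r_def flip: scaleR_left_distrib)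
    also have "\<dots> = of_int i * A h + A (r *\<^sub>R h)" by (simp add: add int)
    finally have "real N * (A (c *\<^sub>R h) - c * A h) = A (r *\<^sub>R h) - r * A h"
      by (simp add: r_def algebra_simps)
    then have "real N * \<bar>A (c *\<^sub>R h) - c * A h\<bar> = \<bar>A (r *\<^sub>R h) - r * A h\<bar>"
      by (metis abs_mult abs_of_nat)
    also have "\<dots> \<le> \<bar>A (r *\<^sub>R h)\<bar> + r * \<bar>A h\<bar>"
      using r by (metis abs_mult abs_of_nonneg abs_triangle_ineq4)
    also have "\<dots> \<le> \<bar>C * norm h\<bar> + \<bar>A h\<bar>"
    proof (rule add_mono)
      have "\<bar>A (r *\<^sub>R h)\<bar> \<le> r * (C * norm h)" using bd[of "r *\<^sub>R h"] r by (simp add: mult.left_commute)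
      also have "\<dots> \<le> r * \<bar>C * norm h\<bar>" using r by (intro mult_left_mono) auto
      also have "\<dots> \<le> \<bar>C * norm h\<bar>" using r by (intro mult_left_le_one_le) auto
      finally show "\<bar>A (r *\<^sub>R h)\<bar> \<le> \<bar>C * norm h\<bar>" .
      show "r * \<bar>A h\<bar> \<le> \<bar>A h\<bar>" using r by (intro mult_left_le_one_le) auto
    qed
    finally show False using N by simp
  qed
  then show ?thesis
    by (intro bounded_linear_intro[where K = C]) (use add bd in \<open>auto simp: mult.commute\<close>)
qed

text \<open>Consecutive dyadic quotients \<open>s x h j\<close> differ by a rescaled second
  difference of order \<open>1 / 2 ^ j\<close>, so they converge, and the limit \<open>A x\<close>
  misses the increment of \<open>u\<close> by at most \<open>C * (norm h)\<^sup>2 / 2\<close> for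
  small \<open>h\<close>. Additivity and the Lipschitz bound both rest on mixed differences. The
  shrinking radii leave room for the shifts.\<close>

lemma second_difference_derivative:
  fixes u :: "'a::euclidean_space \<Rightarrow> real"
  assumes C: "0 \<le> C"
    and fst: "\<And>x h. norm (x - x0) \<le> 1 / 2 \<Longrightarrow> norm h \<le> 1 \<Longrightarrow> \<bar>u (x + h) - u x\<bar> \<le> C * norm h"
    and snd: "\<And>x h. norm (x - x0) \<le> 1 / 2 \<Longrightarrow> norm h \<le> 1 \<Longrightarrow> \<bar>u (x + h) + u (x - h) - 2 * u x\<bar> \<le> C * (norm h)\<^sup>2"
  shows "\<exists>A. (\<forall>x. norm (x - x0) \<le> 1 / 4 \<longrightarrow> (u has_derivative A x) (at x))
    \<and> (\<forall>x x' b. norm (x - x0) \<le> 1 / 16 \<longrightarrow> norm (x' - x0) \<le> 1 / 16 \<longrightarrow> norm b = 1 \<longrightarrow> \<bar>A x b - A x' b\<bar> \<le> 2 * C * norm (x - x'))"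
proof -
  \<comment> \<open>The pairs \<open>x\<close>, \<open>x + a + b\<close> and \<open>x + a\<close>,
    \<open>x + b\<close> share the midpoint \<open>c\<close>, so the mixed difference is the
    difference of two second differences at \<open>c\<close>, with steps \<open>p\<close> and
    \<open>q\<close>.\<close>
  have mixed: "\<bar>u (x + a + b) - u (x + a) - u (x + b) + u x\<bar> \<le> C * ((norm a)\<^sup>2 + (norm b)\<^sup>2) / 2"
    if x: "norm (x - x0) \<le> 1 / 4" and a: "norm a \<le> 1 / 8" "norm b \<le> 1 / 8" for x a b
  proof -
    define p where "p = (1 / 2) *\<^sub>R (a + b)"
    define q where "q = (1 / 2) *\<^sub>R (a - b)"
    define c where "c = x + p"
    have np: "norm p \<le> 1 / 8" "norm q \<le> 1 / 8"
      using norm_triangle_ineq[of a b] norm_triangle_ineq4[of a b] a by (auto simp: p_def q_def)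
    have nc: "norm (c - x0) \<le> 1 / 2"
      using norm_triangle_ineq[of "x - x0" p] x np by (simp add: c_def algebra_simps)
    have pq: "p + q = a" "p - q = b" "p + p = a + b"
      by (simp_all add: p_def q_def algebra_simps flip: scaleR_left_distrib)
    have e: "c + p = x + a + b" "c - p = x" "c + q = x + a" "c - q = x + b"
      using pq by (simp_all add: c_def add.assoc add_diff_eq)
    have "(norm p)\<^sup>2 + (norm q)\<^sup>2 = ((norm a)\<^sup>2 + (norm b)\<^sup>2) / 2"
      by (simp add: p_def q_def power2_norm_eq_inner inner_add inner_diff inner_commute power_divide algebra_simps)
    then have eq: "C * (norm p)\<^sup>2 + C * (norm q)\<^sup>2 = C * ((norm a)\<^sup>2 + (norm b)\<^sup>2) / 2"
      by (simp add: distrib_left[symmetric])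
    have "\<bar>u (x + a + b) + u x - 2 * u c\<bar> \<le> C * (norm p)\<^sup>2"
      using snd[OF nc, of p] np by (simp add: e)
    moreover have "\<bar>u (x + a) + u (x + b) - 2 * u c\<bar> \<le> C * (norm q)\<^sup>2"
      using snd[OF nc, of q] np by (simp add: e)
    ultimately show ?thesis using eq by linarith
  qed
  define s where "s x h j = 2 ^ j * (u (x + (1 / 2 ^ j) *\<^sub>R h) - u x)" for x h and j :: nat
  have small: "\<exists>l. s x h \<longlonglongrightarrow> l \<and> \<bar>l - (u (x + h) - u x)\<bar> \<le> C * (norm h)\<^sup>2 / 2"
    if x: "norm (x - x0) \<le> 1 / 4" and h: "norm h \<le> 1 / 8" for x h
  proof -
    have "\<bar>s x h (Suc j) - s x h j\<bar> \<le> (C * (norm h)\<^sup>2 / 4) / 2 ^ j" for j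
    proof -
      define g where "g = (1 / 2 ^ Suc j) *\<^sub>R h"
      have g2: "(1 / 2 ^ j) *\<^sub>R h = g + g" by (simp add: g_def flip: scaleR_left_distrib)
      have "1 / 2 ^ Suc j \<le> (1::real)"
        using one_le_power[of "2::real" "Suc j"] by (simp only: divide_le_eq_1_pos zero_less_power zero_less_numeral)
      then have "(1 / 2 ^ Suc j) * norm h \<le> 1 * norm h" by (intro mult_right_mono) auto
      then have "norm g \<le> norm h" by (simp add: g_def)
      then have ng: "norm g \<le> 1 / 8" using h by simp
      have "norm (x + g - x0) \<le> 1 / 2" using norm_triangle_ineq[of "x - x0" g] x ng by (simp add: algebra_simps)
      from snd[OF this, of g] ng have "\<bar>u (x + g + g) + u x - 2 * u (x + g)\<bar> \<le> C * (norm g)\<^sup>2" by simp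
      then have "2 ^ j * \<bar>u (x + g + g) + u x - 2 * u (x + g)\<bar> \<le> 2 ^ j * (C * (norm g)\<^sup>2)"
        by (intro mult_left_mono) auto
      also have "2 ^ j * \<bar>u (x + g + g) + u x - 2 * u (x + g)\<bar> = \<bar>2 ^ j * (- (u (x + g + g) + u x - 2 * u (x + g)))\<bar>"
        by (simp only: abs_mult abs_minus_cancel) simp
      also have "2 ^ j * (- (u (x + g + g) + u x - 2 * u (x + g))) = s x h (Suc j) - s x h j"
        unfolding s_def g_def[symmetric] g2 by (simp add: algebra_simps)
      also have "2 ^ j * (C * (norm g)\<^sup>2) = (C * (norm h)\<^sup>2 / 4) / 2 ^ j"
        by (simp add: g_def power_divide power2_eq_square)
      finally show ?thesis .
    qed
    from geometric_increments_limit[of "s x h", OF this] show ?thesis by (simp add: s_def)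
  qed
  \<comment> \<open>Halving \<open>h\<close> sufficiently often brings it into the range of
    \<open>small\<close>; this merely shifts and rescales the sequence.\<close>
  have conv: "\<exists>l. s x h \<longlonglongrightarrow> l" if x: "norm (x - x0) \<le> 1 / 4" for x h
  proof -
    obtain m :: nat where m: "norm h * 8 < 2 ^ m"
      using real_arch_pow[of 2 "norm h * 8"] by auto
    have "norm ((1 / 2 ^ m) *\<^sub>R h) \<le> 1 / 8" using m by (simp add: field_simps)
    from small[OF x this] obtain l where "s x ((1 / 2 ^ m) *\<^sub>R h) \<longlonglongrightarrow> l" by blast
    then have "(\<lambda>j. 2 ^ m * s x ((1 / 2 ^ m) *\<^sub>R h) j) \<longlonglongrightarrow> 2 ^ m * l" by (intro tendsto_intros)
    moreover have "2 ^ m * s x ((1 / 2 ^ m) *\<^sub>R h) j = s x h (j + m)" for j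
      by (simp add: s_def power_add mult.commute)
    ultimately have "(\<lambda>j. s x h (j + m)) \<longlonglongrightarrow> 2 ^ m * l" by simp
    then show ?thesis using LIMSEQ_offset by blast
  qed
  define A where "A x h = lim (s x h)" for x h
  have A: "s x h \<longlonglongrightarrow> A x h" if "norm (x - x0) \<le> 1 / 4" for x h
    using conv[OF that] unfolding A_def by (simp add: convergent_LIMSEQ_iff[symmetric] convergent_def)
  have A_small: "\<bar>A x h - (u (x + h) - u x)\<bar> \<le> C * (norm h)\<^sup>2 / 2"
    if "norm (x - x0) \<le> 1 / 4" "norm h \<le> 1 / 8" for x h
    using small[OF that] A[OF that(1), of h] LIMSEQ_unique by blast
  have ev: "\<forall>\<^sub>F j in sequentially. norm ((1 / 2 ^ j) *\<^sub>R h) \<le> 1 / 8" for h :: 'a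
  proof -
    have "(\<lambda>j. norm ((1 / 2 ^ j) *\<^sub>R h)) \<longlonglongrightarrow> norm (0 *\<^sub>R h)"
      by (intro tendsto_intros LIMSEQ_divide_realpow_zero) auto
    from order_tendstoD(2)[OF this, of "1 / 8"] show ?thesis
      by (auto elim: eventually_mono)
  qed
  have lin: "bounded_linear (A x)" if x: "norm (x - x0) \<le> 1 / 4" for x
  proof (rule additive_bounded_linear)
    fix a b
    have "(\<lambda>j. s x (a + b) j - s x a j - s x b j) \<longlonglongrightarrow> A x (a + b) - A x a - A x b"
      by (intro tendsto_intros A x)
    moreover have "(\<lambda>j. s x (a + b) j - s x a j - s x b j) \<longlonglongrightarrow> 0"
    proof (rule Lim_null_comparison)
      show "(\<lambda>j. C * ((norm a)\<^sup>2 + (norm b)\<^sup>2) / 2 / 2 ^ j) \<longlonglongrightarrow> 0"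
        by (rule LIMSEQ_divide_realpow_zero) simp
      show "\<forall>\<^sub>F j in sequentially. norm (s x (a + b) j - s x a j - s x b j) \<le> C * ((norm a)\<^sup>2 + (norm b)\<^sup>2) / 2 / 2 ^ j"
        using ev[of a] ev[of b]
      proof eventually_elim
        case (elim j)
        let ?a = "(1 / 2 ^ j) *\<^sub>R a" and ?b = "(1 / 2 ^ j) *\<^sub>R b"
        have "s x (a + b) j - s x a j - s x b j = 2 ^ j * (u (x + ?a + ?b) - u (x + ?a) - u (x + ?b) + u x)"
          by (simp add: s_def scaleR_right_distrib algebra_simps)
        then have "norm (s x (a + b) j - s x a j - s x b j) = 2 ^ j * \<bar>u (x + ?a + ?b) - u (x + ?a) - u (x + ?b) + u x\<bar>"
          by (simp add: abs_mult)
        also have "\<dots> \<le> 2 ^ j * (C * ((norm ?a)\<^sup>2 + (norm ?b)\<^sup>2) / 2)"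
          by (intro mult_left_mono mixed[OF x elim]) auto
        also have "\<dots> = C * ((norm a)\<^sup>2 + (norm b)\<^sup>2) / 2 / 2 ^ j"
          by (simp add: power_divide power2_eq_square add_divide_distrib[symmetric])
        finally show ?case .
      qed
    qed
    ultimately have "A x (a + b) - A x a - A x b = 0" by (rule LIMSEQ_unique)
    then show "A x (a + b) = A x a + A x b" by simp
  next
    fix h
    have "(\<lambda>j. \<bar>s x h j\<bar>) \<longlonglongrightarrow> \<bar>A x h\<bar>" by (intro tendsto_intros A x)
    moreover have "\<forall>\<^sub>F j in sequentially. \<bar>s x h j\<bar> \<le> C * norm h"
      using ev[of h]
    proof eventually_elim
      case (elim j)
      have "\<bar>s x h j\<bar> = 2 ^ j * \<bar>u (x + (1 / 2 ^ j) *\<^sub>R h) - u x\<bar>" by (simp add: s_def abs_mult)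
      also have "\<dots> \<le> 2 ^ j * (C * norm ((1 / 2 ^ j) *\<^sub>R h))"
      proof (rule mult_left_mono)
        show "\<bar>u (x + (1 / 2 ^ j) *\<^sub>R h) - u x\<bar> \<le> C * norm ((1 / 2 ^ j) *\<^sub>R h)"
          by (rule fst) (use x elim in linarith)+
      qed simp
      finally show ?case by simp
    qed
    ultimately show "\<bar>A x h\<bar> \<le> C * norm h" by (intro tendsto_upperbound) auto
  qed
  have der: "(u has_derivative A x) (at x)" if x: "norm (x - x0) \<le> 1 / 4" for x
  proof -
    have "((\<lambda>y. norm (u y - u x - A x (y - x)) / norm (y - x)) \<longlongrightarrow> 0) (at x)"
    proof (rule Lim_null_comparison[rotated])
    have "((\<lambda>y. C / 2 * norm (y - x)) \<longlongrightarrow> C / 2 * norm (x - x)) (at x)" by (intro tendsto_intros)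
    then show "((\<lambda>y. C / 2 * norm (y - x)) \<longlongrightarrow> 0) (at x)" by simp
    show "\<forall>\<^sub>F y in at x. norm (norm (u y - u x - A x (y - x)) / norm (y - x)) \<le> C / 2 * norm (y - x)"
      unfolding eventually_at
    proof (intro exI[of _ "1 / 8"] conjI ballI impI)
      fix y assume y: "y \<noteq> x \<and> dist y x < 1 / 8"
      then have n: "0 < norm (y - x)" "norm (y - x) \<le> 1 / 8" by (auto simp: dist_norm)
      then have "norm (u y - u x - A x (y - x)) \<le> C * (norm (y - x))\<^sup>2 / 2"
        using A_small[OF x n(2)] by (simp add: abs_minus_commute)
      then show "norm (norm (u y - u x - A x (y - x)) / norm (y - x)) \<le> C / 2 * norm (y - x)"
        using n by (simp add: divide_le_eq power2_eq_square)
    qed auto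
  qed
    then show ?thesis
      unfolding has_derivative_iff_norm using lin[OF x] by simp
  qed
  have lip: "\<bar>A x b - A x' b\<bar> \<le> 2 * C * norm (x - x')"
    if x: "norm (x - x0) \<le> 1 / 16" "norm (x' - x0) \<le> 1 / 16" and b: "norm b = 1" for x x' b
  proof (cases "x = x'")
    case False
    \<comment> \<open>With steps of length \<open>d\<close> all three errors are of order
      \<open>d\<^sup>2\<close>; dividing by \<open>d\<close> leaves the Lipschitz bound.\<close>
    define d where "d = norm (x' - x)"
    have d: "0 < d" "d \<le> 1 / 8"
      using False norm_triangle_ineq4[of "x' - x0" "x - x0"] x by (auto simp: d_def)
    have nb: "norm (d *\<^sub>R b) = d" using b d by simp
    have "\<bar>u (x + (x' - x) + d *\<^sub>R b) - u (x + (x' - x)) - u (x + d *\<^sub>R b) + u x\<bar> \<le> C * (d\<^sup>2 + d\<^sup>2) / 2"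
      using mixed[of x "x' - x" "d *\<^sub>R b"] x d nb by (simp add: d_def)
    then have m: "\<bar>u (x' + d *\<^sub>R b) - u x' - u (x + d *\<^sub>R b) + u x\<bar> \<le> C * d\<^sup>2" by simp
    have "\<bar>A x (d *\<^sub>R b) - (u (x + d *\<^sub>R b) - u x)\<bar> \<le> C * d\<^sup>2 / 2"
      using A_small[of x "d *\<^sub>R b"] x d nb by simp
    moreover have "\<bar>A x' (d *\<^sub>R b) - (u (x' + d *\<^sub>R b) - u x')\<bar> \<le> C * d\<^sup>2 / 2"
      using A_small[of x' "d *\<^sub>R b"] x d nb by simp
    ultimately have "\<bar>A x (d *\<^sub>R b) - A x' (d *\<^sub>R b)\<bar> \<le> 2 * (C * d\<^sup>2)" using m by linarith
    moreover have "A x (d *\<^sub>R b) = d * A x b" "A x' (d *\<^sub>R b) = d * A x' b"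
      using lin[of x] lin[of x'] x by (auto simp: linear_simps bounded_linear.linear linear_scale)
    ultimately have "d * \<bar>A x b - A x' b\<bar> \<le> d * (2 * C * d)"
      using d by (simp add: abs_mult power2_eq_square mult_ac flip: right_diff_distrib)
    then show ?thesis using d by (simp add: d_def norm_minus_commute)
  qed simp
  show ?thesis using der lip by blast
qed

lemma C11_loc_second_differences:
  fixes u :: "'a::euclidean_space \<Rightarrow> real"
  assumes "\<And>x0. \<exists>C. \<forall>x h. norm (x - x0) \<le> 1 / 2 \<longrightarrow> norm h \<le> 1 \<longrightarrow>
    \<bar>u (x + h) - u x\<bar> \<le> C * norm h \<and> \<bar>u (x + h) + u (x - h) - 2 * u x\<bar> \<le> C * (norm h)\<^sup>2"
  shows "u \<in> C11_loc"
proof -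
  have loc: "\<exists>C\<ge>0. (\<forall>x\<in>ball x0 (1 / 16). u differentiable (at x)) \<and>
      (\<forall>b\<in>Basis. C-lipschitz_on (ball x0 (1 / 16)) (\<lambda>x. frechet_derivative u (at x) b))" for x0
  proof -
    obtain C where C: "\<And>x h. norm (x - x0) \<le> 1 / 2 \<Longrightarrow> norm h \<le> 1 \<Longrightarrow>
      \<bar>u (x + h) - u x\<bar> \<le> C * norm h \<and> \<bar>u (x + h) + u (x - h) - 2 * u x\<bar> \<le> C * (norm h)\<^sup>2"
      using assms[of x0] by blast
    \<comment> \<open>The sign of \<open>C\<close> is unknown, and a Lipschitz constant has to be
      nonnegative.\<close>
    have C': "\<bar>u (x + h) - u x\<bar> \<le> max C 0 * norm h" "\<bar>u (x + h) + u (x - h) - 2 * u x\<bar> \<le> max C 0 * (norm h)\<^sup>2"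
      if "norm (x - x0) \<le> 1 / 2" "norm h \<le> 1" for x h
    proof -
      have "C * norm h \<le> max C 0 * norm h" "C * (norm h)\<^sup>2 \<le> max C 0 * (norm h)\<^sup>2"
        by (auto intro!: mult_right_mono)
      with C[OF that] show "\<bar>u (x + h) - u x\<bar> \<le> max C 0 * norm h" "\<bar>u (x + h) + u (x - h) - 2 * u x\<bar> \<le> max C 0 * (norm h)\<^sup>2"
        by linarith+
    qed
    obtain A where A: "\<And>x. norm (x - x0) \<le> 1 / 4 \<Longrightarrow> (u has_derivative A x) (at x)"
      "\<And>x x' b. norm (x - x0) \<le> 1 / 16 \<Longrightarrow> norm (x' - x0) \<le> 1 / 16 \<Longrightarrow> norm b = 1 \<Longrightarrow>
        \<bar>A x b - A x' b\<bar> \<le> 2 * max C 0 * norm (x - x')"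
      using second_difference_derivative[OF _ C'] by (metis max.cobounded2)
    have fd: "frechet_derivative u (at x) = A x" if "norm (x - x0) \<le> 1 / 4" for x
      using frechet_derivative_at[OF A(1)[OF that]] by simp
    show ?thesis
    proof (intro exI[of _ "2 * max C 0"] conjI ballI lipschitz_onI)
      fix x assume "x \<in> ball x0 (1 / 16)"
      then have "norm (x - x0) \<le> 1 / 4" by (simp add: dist_norm norm_minus_commute)
      then show "u differentiable at x" using A(1) by (auto simp: differentiable_def)
    next
      fix b x y :: 'a
      assume b: "b \<in> Basis" and "x \<in> ball x0 (1 / 16)" "y \<in> ball x0 (1 / 16)"
      then have n: "norm (x - x0) \<le> 1 / 16" "norm (y - x0) \<le> 1 / 16" by (auto simp: dist_norm norm_minus_commute)
      then show "dist (frechet_derivative u (at x) b) (frechet_derivative u (at y) b) \<le> 2 * max C 0 * dist x y"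
        using A(2)[OF n, of b] b by (simp add: fd dist_norm)
    qed auto
  qed
  have diff: "u differentiable (at x)" for x using loc[of x] by (metis centre_in_ball zero_less_divide_1_iff zero_less_numeral)
  have lip: "locally_Lipschitz (\<lambda>x. frechet_derivative u (at x) b)" if "b \<in> Basis" for b
    unfolding locally_Lipschitz_def using loc that by (metis zero_less_divide_1_iff zero_less_numeral)
  have "continuous_on UNIV (\<lambda>x. frechet_derivative u (at x) b)" if b: "b \<in> Basis" for b
    unfolding continuous_on_eq_continuous_at[OF open_UNIV]
  proof
    fix x
    obtain r L where "0 < r" "L-lipschitz_on (ball x r) (\<lambda>x. frechet_derivative u (at x) b)"
      using lip[OF b] unfolding locally_Lipschitz_def by blast
    then show "isCont (\<lambda>x. frechet_derivative u (at x) b) x"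
      using lipschitz_on_continuous_on by (metis centre_in_ball continuous_on_eq_continuous_at open_ball)
  qed
  then show ?thesis
    using diff lip by (simp add: C11_loc_def)
qed

section \<open>Differences of C^1 and C^2 functions on balls\<close>

lemma C_1_lipschitz:
  fixes f :: "'a::euclidean_space \<Rightarrow> real"
  assumes "C_k 1 f"
  shows "\<exists>L\<ge>0. \<forall>x\<in>cball 0 R. \<forall>y\<in>cball 0 R. \<bar>f x - f y\<bar> \<le> L * norm (x - y)"
proof -
  have d: "f differentiable (at x)" for x using assms by simp
  have c: "continuous_on UNIV (\<lambda>x. frechet_derivative f (at x) b)" if "b \<in> Basis" for b
    using assms that by simp
  have "\<exists>M. \<forall>x\<in>cball 0 R. \<bar>frechet_derivative f (at x) b\<bar> \<le> M" if "b \<in> Basis" for b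
  proof -
    have "bounded ((\<lambda>x. frechet_derivative f (at x) b) ` cball 0 R)"
      by (intro compact_imp_bounded compact_continuous_image continuous_on_subset[OF c[OF that]]) auto
    then show ?thesis by (auto simp: bounded_iff)
  qed
  then obtain M where M: "\<And>b x. b \<in> Basis \<Longrightarrow> x \<in> cball 0 R \<Longrightarrow> \<bar>frechet_derivative f (at x) b\<bar> \<le> M b" by metis
  define L where "L = (\<Sum>b\<in>(Basis::'a set). \<bar>M b\<bar>)"
  have L: "0 \<le> L" by (simp add: L_def sum_nonneg)
  have "norm (f x - f y) \<le> L * norm (x - y)" if "x \<in> cball 0 R" "y \<in> cball 0 R" for x y
  proof (rule differentiable_bound[of "cball 0 R" f "\<lambda>x. frechet_derivative f (at x)"])
    fix x assume x: "x \<in> cball (0::'a) R"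
    have D: "(f has_derivative frechet_derivative f (at x)) (at x)"
      using d frechet_derivative_works by blast
    then show "(f has_derivative frechet_derivative f (at x)) (at x within cball 0 R)"
      by (rule has_derivative_at_withinI)
    interpret bounded_linear "frechet_derivative f (at x)" using D by (rule has_derivative_bounded_linear)
    show "onorm (frechet_derivative f (at x)) \<le> L"
    proof (rule onorm_le)
      fix v :: 'a
      have "frechet_derivative f (at x) v = (\<Sum>b\<in>Basis. (v \<bullet> b) * frechet_derivative f (at x) b)"
        by (subst euclidean_representation[of v, symmetric]) (simp add: sum scaleR)
      also have "norm \<dots> \<le> (\<Sum>b\<in>Basis. \<bar>M b\<bar> * norm v)"
      proof (rule sum_norm_le)
        fix b :: 'a assume b: "b \<in> Basis"
        have "\<bar>v \<bullet> b\<bar> * \<bar>frechet_derivative f (at x) b\<bar> \<le> norm v * \<bar>M b\<bar>"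
          using Basis_le_norm[OF b, of v] M[OF b x] by (intro mult_mono) auto
        then show "norm ((v \<bullet> b) * frechet_derivative f (at x) b) \<le> \<bar>M b\<bar> * norm v"
          by (simp add: abs_mult mult.commute)
      qed
      also have "\<dots> = L * norm v" by (simp add: L_def sum_distrib_right)
      finally show "norm (frechet_derivative f (at x) v) \<le> L * norm v" .
    qed
  qed (use that in auto)
  with L show ?thesis by auto
qed

text \<open>The second difference is \<open>q x - q (x - h)\<close> for
  \<open>q y = f (y + h) - f y\<close>. The derivative of \<open>q\<close> is a difference of
  derivatives, hence of size \<open>norm h\<close>, and the mean value inequality supplies the other
  factor. The radii \<open>R + 1\<close> and \<open>R + 2\<close> make room for one and two
  shifts.\<close>

lemma C_2_differences:
  fixes f :: "'a::euclidean_space \<Rightarrow> real"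
  assumes "C_k 2 f"
  shows "\<exists>L\<ge>0. \<forall>x h. norm x \<le> R \<longrightarrow> norm h \<le> 1 \<longrightarrow> \<bar>f x\<bar> \<le> L \<and> \<bar>f (x + h) - f x\<bar> \<le> L * norm h
    \<and> \<bar>f (x + h) + f (x - h) - 2 * f x\<bar> \<le> L * (norm h)\<^sup>2"
proof -
  have two: "C_k (Suc (Suc 0)) f" using assms by (simp add: numeral_2_eq_2)
  have one: "C_k 1 f"
    using two by (auto intro!: continuous_at_imp_continuous_on differentiable_imp_continuous_within)
  have d: "f differentiable (at x)" for x using two by simp
  have cf: "continuous_on UNIV f"
    by (intro continuous_at_imp_continuous_on ballI differentiable_imp_continuous_within d)
  obtain L1 where L1: "0 \<le> L1" "\<And>x y. x \<in> cball 0 (R + 1) \<Longrightarrow> y \<in> cball 0 (R + 1) \<Longrightarrow> \<bar>f x - f y\<bar> \<le> L1 * norm (x - y)"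
    using C_1_lipschitz[OF one, of "R + 1"] by blast
  have "bounded (f ` cball 0 R)"
    by (intro compact_imp_bounded compact_continuous_image continuous_on_subset[OF cf]) auto
  then obtain L0 where L0: "\<forall>z\<in>f ` cball 0 R. norm z \<le> L0" unfolding bounded_iff by blast
  have "\<exists>L\<ge>0. \<forall>x\<in>cball 0 (R + 2). \<forall>y\<in>cball 0 (R + 2). \<bar>frechet_derivative f (at x) b - frechet_derivative f (at y) b\<bar> \<le> L * norm (x - y)" if "b \<in> Basis" for b
    by (rule C_1_lipschitz) (use two that in simp)
  then obtain M where M: "\<And>b. b \<in> Basis \<Longrightarrow> 0 \<le> M b" "\<And>b x y. b \<in> Basis \<Longrightarrow> x \<in> cball 0 (R + 2) \<Longrightarrow> y \<in> cball 0 (R + 2) \<Longrightarrow>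
      \<bar>frechet_derivative f (at x) b - frechet_derivative f (at y) b\<bar> \<le> M b * norm (x - y)" by metis
  define L2 where "L2 = (\<Sum>b\<in>(Basis::'a set). M b)"
  have L2: "0 \<le> L2" unfolding L2_def by (intro sum_nonneg M)
  have sec: "\<bar>f (x + h) + f (x - h) - 2 * f x\<bar> \<le> L2 * (norm h)\<^sup>2" if x: "norm x \<le> R" and h: "norm h \<le> 1" for x h
  proof -
    let ?D = "\<lambda>y. frechet_derivative f (at y)"
    define q where "q y = f (y + h) - f y" for y
    have "norm (q x - q (x - h)) \<le> (L2 * norm h) * norm (x - (x - h))"
    proof (rule differentiable_bound[of "cball 0 (R + 1)" q "\<lambda>y v. ?D (y + h) v - ?D y v"])
      fix y assume y: "y \<in> cball (0::'a) (R + 1)"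
      have D: "(f has_derivative ?D z) (at z)" for z
        using d frechet_derivative_works by blast
      have "((\<lambda>y. y + h) has_derivative (\<lambda>v. v)) (at y)"
        by (auto intro!: derivative_eq_intros)
      from has_derivative_compose[OF this D]
      have "((\<lambda>y. f (y + h)) has_derivative ?D (y + h)) (at y)" .
      then have "(q has_derivative (\<lambda>v. ?D (y + h) v - ?D y v)) (at y)"
        unfolding q_def[abs_def] by (intro has_derivative_diff D)
      then show "(q has_derivative (\<lambda>v. ?D (y + h) v - ?D y v)) (at y within cball 0 (R + 1))"
        by (rule has_derivative_at_withinI)
      interpret a: bounded_linear "?D (y + h)" using D by (rule has_derivative_bounded_linear)
      interpret b: bounded_linear "?D y" using D by (rule has_derivative_bounded_linear)
      have in_ball: "y + h \<in> cball 0 (R + 2)" "y \<in> cball 0 (R + 2)"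
        using y h norm_triangle_ineq[of y h] by auto
      show "onorm (\<lambda>v. ?D (y + h) v - ?D y v) \<le> L2 * norm h"
      proof (rule onorm_le)
        fix v :: 'a
        have "?D (y + h) v - ?D y v = (\<Sum>c\<in>Basis. (v \<bullet> c) * (?D (y + h) c - ?D y c))"
          by (subst (1 2) euclidean_representation[of v, symmetric])
             (simp add: a.sum a.scaleR b.sum b.scaleR right_diff_distrib sum_subtractf)
        also have "norm \<dots> \<le> (\<Sum>c\<in>Basis. M c * norm h * norm v)"
        proof (rule sum_norm_le)
          fix c :: 'a assume c: "c \<in> Basis"
          have "\<bar>v \<bullet> c\<bar> * \<bar>?D (y + h) c - ?D y c\<bar> \<le> norm v * (M c * norm h)"
            using Basis_le_norm[OF c, of v] M(2)[OF c in_ball] by (intro mult_mono) auto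
          then show "norm ((v \<bullet> c) * (?D (y + h) c - ?D y c)) \<le> M c * norm h * norm v"
            by (simp add: abs_mult mult.commute)
        qed
        also have "\<dots> = L2 * norm h * norm v" by (simp add: L2_def sum_distrib_right)
        finally show "norm (?D (y + h) v - ?D y v) \<le> L2 * norm h * norm v" .
      qed
    qed (use x h norm_triangle_ineq4[of x h] in auto)
    then show ?thesis by (simp add: q_def power2_eq_square mult.assoc algebra_simps)
  qed
  show ?thesis
  proof (intro exI[of _ "max (max L0 L1) L2"] conjI allI impI)
    fix x h :: 'a assume x: "norm x \<le> R" and h: "norm h \<le> 1"
    show "\<bar>f x\<bar> \<le> max (max L0 L1) L2" using L0 x by (auto simp: le_max_iff_disj)
    have "\<bar>f (x + h) - f x\<bar> \<le> L1 * norm h"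
      using L1(2)[of "x + h" x] x h norm_triangle_ineq[of x h] by auto
    also have "\<dots> \<le> max (max L0 L1) L2 * norm h" by (intro mult_right_mono) auto
    finally show "\<bar>f (x + h) - f x\<bar> \<le> max (max L0 L1) L2 * norm h" .
    have "L2 * (norm h)\<^sup>2 \<le> max (max L0 L1) L2 * (norm h)\<^sup>2" by (intro mult_right_mono) auto
    with sec[OF x h] show "\<bar>f (x + h) + f (x - h) - 2 * f x\<bar> \<le> max (max L0 L1) L2 * (norm h)\<^sup>2" by linarith
  qed (use L2 in auto)
qed

lemma lborel_reflect:
  fixes f :: "'a::euclidean_space \<Rightarrow> real"
  assumes "f \<in> borel_measurable borel"
  shows "integrable lborel (\<lambda>x. f (c - x)) \<longleftrightarrow> integrable lborel f"
    and "(\<integral>x. f (c - x) \<partial>lborel) = (\<integral>x. f x \<partial>lborel)"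
proof -
  have eq: "(lborel :: 'a measure) = distr lborel borel (\<lambda>x. c - x)"
    using lborel_affine[of "-1" c] by (simp add: density_1)
  show "integrable lborel (\<lambda>x. f (c - x)) \<longleftrightarrow> integrable lborel f"
    by (subst (2) eq) (use assms in \<open>simp add: integrable_distr_eq\<close>)
  show "(\<integral>x. f (c - x) \<partial>lborel) = (\<integral>x. f x \<partial>lborel)"
    by (subst (2) eq) (use assms in \<open>simp add: integral_distr\<close>)
qed

context riesz_order
begin

section \<open>Regularity of the solution\<close>

text \<open>For \<open>norm y > 2 * r\<close> one has \<open>norm (x - y) \<ge> norm y / 2\<close>,
  so the kernel seen from \<open>x\<close> is comparable to the one seen from 0, and finiteness of
  the potential at the origin suffices. For the remaining \<open>y\<close> the density is bounded by
  continuity.\<close>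

lemma pot_locally_bounded:
  assumes k: "potable k" "\<And>x. 0 \<le> k x" and cont: "continuous_on UNIV k"
  shows "\<exists>M\<ge>0. \<forall>x. norm x \<le> R \<longrightarrow> pot k x \<le> M"
proof -
  have [measurable]: "k \<in> borel_measurable borel" using k by (simp add: potable_def)
  define r where "r = max R 1"
  have r: "0 < r" "R \<le> r" by (auto simp: r_def)
  have "bounded (k ` cball 0 (2 * r))"
    by (intro compact_imp_bounded compact_continuous_image continuous_on_subset[OF cont]) auto
  then obtain K0 where K0: "\<forall>z\<in>k ` cball 0 (2 * r). norm z \<le> K0" unfolding bounded_iff by blast
  define K where "K = max K0 0"
  have "k y \<le> K0" if "norm y \<le> 2 * r" for y
    using bspec[OF K0, of "k y"] that by auto
  then have K: "0 \<le> K" "\<And>y. norm y \<le> 2 * r \<Longrightarrow> k y \<le> K" by (auto simp: K_def le_max_iff_disj)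
  obtain A where A: "0 < A" "\<And>r x. 0 < r \<Longrightarrow>
    (\<integral>\<^sup>+y. ennreal (rker (x - y)) * indicator {y. norm (x - y) < r} y \<partial>lborel) \<le> ennreal (A * r powr (2 * \<beta>))"
    using nn_integral_rker_ball by blast
  define s where "s = real DIM('a) - 2 * \<beta>"
  have s: "0 < s" using beta by (simp add: s_def)
  have rs: "rker z = norm z powr (- s)" for z by (simp add: rker_def s_def)
  define M where "M = K * (A * (4 * r) powr (2 * \<beta>)) + 2 powr s * pot k 0"
  have p0: "0 \<le> pot k x" for x using k by (intro pot_nonneg)
  have M0: "0 \<le> M" unfolding M_def using K A p0[of 0] by simp
  have pe: "(\<integral>\<^sup>+y. ennreal (rker (x - y) * k y) \<partial>lborel) = ennreal (pot k x)" for x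
    unfolding pot_def using k by (intro nn_integral_eq_integral potableD(2)) auto
  have "pot k x \<le> M" if x: "norm x \<le> R" for x
  proof -
    have "(\<integral>\<^sup>+y. ennreal (rker (x - y) * k y) \<partial>lborel)
        \<le> (\<integral>\<^sup>+y. ennreal K * (ennreal (rker (x - y)) * indicator {y. norm (x - y) < 4 * r} y) + ennreal (2 powr s) * ennreal (rker (0 - y) * k y) \<partial>lborel)"
    proof (rule nn_integral_mono)
      fix y
      show "ennreal (rker (x - y) * k y) \<le> ennreal K * (ennreal (rker (x - y)) * indicator {y. norm (x - y) < 4 * r} y) + ennreal (2 powr s) * ennreal (rker (0 - y) * k y)"
      proof (cases "norm y \<le> 2 * r")
        case True
        then have "norm (x - y) < 4 * r" using norm_triangle_ineq4[of x y] x r by simp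
        moreover have "ennreal (rker (x - y) * k y) \<le> ennreal (K * rker (x - y))"
          using K(2)[OF True] by (intro ennreal_leI) (simp add: mult.commute mult_right_mono)
        ultimately show ?thesis using K by (simp add: ennreal_mult' add_increasing2)
      next
        case False
        have "norm y / 2 \<le> norm (x - y)"
          using norm_triangle_ineq2[of y x] x r False by (simp add: norm_minus_commute)
        then have "rker (x - y) \<le> (norm y / 2) powr (- s)"
          unfolding rs using False s r by (intro powr_mono2') auto
        also have "\<dots> = 2 powr s * rker (0 - y)"
        proof -
          have "inverse (2 powr (- s)) = 2 powr s" by (simp only: powr_minus inverse_inverse_eq)
          moreover have "(norm y / 2) powr (- s) = norm y powr (- s) / 2 powr (- s)"
            by (rule powr_divide)
          ultimately show ?thesis
            by (simp only: rs diff_0 norm_minus_cancel divide_inverse mult.commute)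
        qed
        finally have "rker (x - y) * k y \<le> 2 powr s * (rker (0 - y) * k y)"
          unfolding mult.assoc[symmetric] by (rule mult_right_mono[OF _ k(2)])
        then show ?thesis by (simp add: ennreal_mult'[symmetric] ennreal_leI add_increasing)
      qed
    qed
    also have "\<dots> = ennreal K * (\<integral>\<^sup>+y. ennreal (rker (x - y)) * indicator {y. norm (x - y) < 4 * r} y \<partial>lborel) + ennreal (2 powr s) * ennreal (pot k 0)"
      unfolding pe[of 0, symmetric] by (subst nn_integral_add) (simp_all add: nn_integral_cmult del: diff_0)
    also have "\<dots> \<le> ennreal K * ennreal (A * (4 * r) powr (2 * \<beta>)) + ennreal (2 powr s) * ennreal (pot k 0)"
      using r by (intro add_right_mono mult_left_mono A(2)) auto
    also have "\<dots> = ennreal M"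
      unfolding M_def using K A p0[of 0] by (simp add: ennreal_mult'[symmetric])
    finally have "ennreal (pot k x) \<le> ennreal M" by (simp only: pe)
    then show ?thesis using M0 by (simp add: ennreal_le_iff)
  qed
  with M0 show ?thesis by blast
qed

text \<open>Local C^{1,1} bounds in the form of differences. Steps up to length 1 start from every
  point of the ball, so the bounds reach slightly beyond it.\<close>

definition locally_C11 :: "('a \<Rightarrow> real) \<Rightarrow> bool" where
  "locally_C11 k \<longleftrightarrow> (\<forall>R. \<exists>L\<ge>0. \<forall>x h. norm x \<le> R \<longrightarrow> norm h \<le> 1 \<longrightarrow> \<bar>k x\<bar> \<le> L \<and> \<bar>k (x + h) - k x\<bar> \<le> L * norm h
    \<and> \<bar>k (x + h) + k (x - h) - 2 * k x\<bar> \<le> L * (norm h)\<^sup>2)"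

text \<open>If \<open>B\<close> bounds the difference of \<open>u\<close> nearby, that of
  \<open>k u\<close> is at most \<open>L * B + L * norm h\<close>: the first term is absorbed, the
  second is data. The crude bound \<open>W = 1\<close> comes from \<open>0 \<le> u \<le> 1\<close>,
  so the argument starts from a merely measurable \<open>u\<close>.\<close>

lemma solution_first_differences:
  assumes k: "potable k" "\<And>x. 0 \<le> k x" "continuous_on UNIV k" "locally_C11 k"
    and u: "u \<in> borel_measurable borel" "\<And>x. 0 \<le> u x" "\<And>x. u x \<le> 1"
    and eq: "\<And>x. u x + pot (\<lambda>y. k y * u y) x = 1"
  shows "\<exists>C\<ge>0. \<forall>x h. norm (x - x0) \<le> 2 \<longrightarrow> norm h \<le> 1 \<longrightarrow> \<bar>u (x + h) - u x\<bar> \<le> C * norm h"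
proof -
  define f where "f y = k y * u y" for y
  have km: "k \<in> borel_measurable borel" using k by (simp add: potable_def)
  have fk: "\<bar>f y\<bar> \<le> k y" for y
    using k(2)[of y] u by (simp add: f_def abs_mult mult_left_le)
  have pf: "potable f"
    using fk k(2) km u(1) by (intro potable_bound[OF k(1)]) (auto simp: f_def[abs_def])
  have eq': "u x = 1 - pot f x" for x using eq[of x] unfolding f_def[abs_def] by linarith
  obtain C where C: "0 < C"
    "\<And>f x h \<delta> B. potable f \<Longrightarrow> 0 < \<delta> \<Longrightarrow> 2 * norm h \<le> \<delta> \<Longrightarrow> 0 \<le> B \<Longrightarrow>
      (\<And>y. norm (x - y) < \<delta> \<Longrightarrow> \<bar>f (y + h) - f y\<bar> \<le> B) \<Longrightarrow>
      \<bar>pot f (x + h) - pot f x\<bar> \<le> C * (norm h / \<delta>) * pot (\<lambda>y. \<bar>f y\<bar>) x + C * \<delta> powr (2 * \<beta>) * B"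
    using pot_differences by metis
  \<comment> \<open>Room for the ball of radius 4 about \<open>x0\<close>, for
    \<open>\<delta> \<le> 4\<close>, and for one shift by \<open>h\<close>.\<close>
  define R where "R = norm x0 + 10"
  obtain L where L: "0 \<le> L" "\<And>x h. norm x \<le> R \<Longrightarrow> norm h \<le> 1 \<Longrightarrow> \<bar>k x\<bar> \<le> L \<and> \<bar>k (x + h) - k x\<bar> \<le> L * norm h"
    using k(4) unfolding locally_C11_def by meson
  obtain M where M: "0 \<le> M" "\<And>x. norm x \<le> R \<Longrightarrow> pot k x \<le> M"
    using pot_locally_bounded[OF k(1,2,3)] by blast
  have pM: "pot (\<lambda>y. \<bar>f y\<bar>) x \<le> M" if "norm x \<le> R" for x
    using pot_mono[OF potable_abs[OF pf] k(1) fk, of x] M(2)[OF that] by linarith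
  \<comment> \<open>The first summand comes from the far part of the kernel, the second from the
    term with \<open>L * norm h\<close>, rewritten as a multiple of \<open>norm h / \<delta>\<close>
    by means of \<open>\<delta> \<le> 4\<close>.\<close>
  define P where "P = C * M + C * 4 powr (2 * \<beta>) * (L * 4)"
  define Q where "Q = C * L"
  have PQ: "0 \<le> P" "0 \<le> Q" using C L M by (auto simp: P_def Q_def)
  obtain C' where C': "0 \<le> C'" "\<And>w \<eta> x. 0 \<le> \<eta> \<Longrightarrow> (\<forall>x. norm (x - x0) < 4 \<longrightarrow> \<bar>w x\<bar> \<le> 1) \<Longrightarrow>
      (\<forall>x \<delta> B. norm (x - x0) < 4 \<longrightarrow> 0 < \<delta> \<longrightarrow> 2 * \<eta> \<le> \<delta> \<longrightarrow> 2 * \<delta> \<le> 4 - norm (x - x0) \<longrightarrow> 0 \<le> B \<longrightarrow>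
        (\<forall>y. norm (x - y) < \<delta> \<longrightarrow> \<bar>w y\<bar> \<le> B) \<longrightarrow> \<bar>w x\<bar> \<le> P * (\<eta> / \<delta>) ^ 1 + Q * \<delta> powr (2 * \<beta>) * B) \<Longrightarrow>
      2 * norm (x - x0) \<le> 4 \<Longrightarrow> \<bar>w x\<bar> \<le> C' * \<eta> ^ 1"
    using absorption[of 4 P Q "2 * \<beta>" 1 x0 1] PQ beta by auto
  have "\<bar>u (x + h) - u x\<bar> \<le> C' * norm h" if x: "norm (x - x0) \<le> 2" and h: "norm h \<le> 1" for x h
  proof -
    have "\<bar>u (x + h) - u x\<bar> \<le> C' * norm h ^ 1"
    proof (rule C'(2)[of "norm h" "\<lambda>x. u (x + h) - u x"])
      show "\<forall>x. norm (x - x0) < 4 \<longrightarrow> \<bar>u (x + h) - u x\<bar> \<le> 1"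
        using u(2,3) by (smt (verit))
      show "\<forall>x \<delta> B. norm (x - x0) < 4 \<longrightarrow> 0 < \<delta> \<longrightarrow> 2 * norm h \<le> \<delta> \<longrightarrow> 2 * \<delta> \<le> 4 - norm (x - x0) \<longrightarrow> 0 \<le> B \<longrightarrow>
        (\<forall>y. norm (x - y) < \<delta> \<longrightarrow> \<bar>u (y + h) - u y\<bar> \<le> B) \<longrightarrow> \<bar>u (x + h) - u x\<bar> \<le> P * (norm h / \<delta>) ^ 1 + Q * \<delta> powr (2 * \<beta>) * B"
      proof (intro allI impI)
        fix x \<delta> B
        assume x: "norm (x - x0) < 4" and d: "0 < \<delta>" "2 * norm h \<le> \<delta>" "2 * \<delta> \<le> 4 - norm (x - x0)" and B: "0 \<le> B"
          and w: "\<forall>y. norm (x - y) < \<delta> \<longrightarrow> \<bar>u (y + h) - u y\<bar> \<le> B"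
        have xR: "norm x \<le> norm x0 + 4" using x norm_triangle_ineq2[of x x0] by simp
        have d4: "\<delta> \<le> 4" using d norm_ge_zero[of "x - x0"] by linarith
        have "\<bar>pot f (x + h) - pot f x\<bar> \<le> C * (norm h / \<delta>) * pot (\<lambda>y. \<bar>f y\<bar>) x + C * \<delta> powr (2 * \<beta>) * (L * (B + norm h))"
        proof (rule C(2)[OF pf d(1,2)])
          show "0 \<le> L * (B + norm h)" using L B by simp
          fix y assume y: "norm (x - y) < \<delta>"
          have "norm y \<le> norm x + norm (x - y)" using norm_triangle_ineq4[of x "x - y"] by simp
          then have yR: "norm y \<le> R - 1" using xR y d4 by (simp add: R_def)
          have yh: "norm (y + h) \<le> R" using norm_triangle_ineq[of y h] yR h by simp
          have "f (y + h) - f y = k (y + h) * (u (y + h) - u y) + (k (y + h) - k y) * u y"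
            by (simp add: f_def algebra_simps)
          moreover have "\<bar>k (y + h) * (u (y + h) - u y)\<bar> \<le> L * B"
            unfolding abs_mult using L yh h w y B by (intro mult_mono) auto
          moreover have "\<bar>(k (y + h) - k y) * u y\<bar> \<le> (L * norm h) * 1"
            unfolding abs_mult using L yR h u by (intro mult_mono) auto
          ultimately show "\<bar>f (y + h) - f y\<bar> \<le> L * (B + norm h)"
            by (simp add: distrib_left)
        qed
        moreover have "C * (norm h / \<delta>) * pot (\<lambda>y. \<bar>f y\<bar>) x \<le> C * (norm h / \<delta>) * M"
          using C d xR by (intro mult_left_mono pM) (auto simp: R_def)
        moreover have "C * \<delta> powr (2 * \<beta>) * (L * norm h) \<le> C * 4 powr (2 * \<beta>) * (L * 4) * (norm h / \<delta>)"
        proof -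
          have "C * \<delta> powr (2 * \<beta>) * (L * norm h) = C * \<delta> powr (2 * \<beta>) * (L * \<delta>) * (norm h / \<delta>)"
            using d by simp
          also have "\<dots> \<le> C * 4 powr (2 * \<beta>) * (L * 4) * (norm h / \<delta>)"
            using C L d d4 beta by (intro mult_right_mono mult_mono mult_left_mono powr_mono2) auto
          finally show ?thesis .
        qed
        ultimately have "\<bar>pot f (x + h) - pot f x\<bar> \<le> P * (norm h / \<delta>) + Q * \<delta> powr (2 * \<beta>) * B"
          unfolding P_def Q_def by (simp only: distrib_left distrib_right mult_ac)
        then show "\<bar>u (x + h) - u x\<bar> \<le> P * (norm h / \<delta>) ^ 1 + Q * \<delta> powr (2 * \<beta>) * B"
          by (simp add: eq' abs_minus_commute)
      qed
    qed (use x in auto)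
    then show ?thesis by simp
  qed
  with C'(1) show ?thesis by blast
qed

text \<open>In the product rule for the second difference of \<open>k u\<close> the mixed terms are
  products of first differences; the preceding lemma makes them \<open>O((norm h)\<^sup>2)\<close>.
  The term with the second difference of \<open>u\<close> is the one to be absorbed.\<close>

lemma solution_second_differences:
  assumes k: "potable k" "\<And>x. 0 \<le> k x" "continuous_on UNIV k" "locally_C11 k"
    and u: "u \<in> borel_measurable borel" "\<And>x. 0 \<le> u x" "\<And>x. u x \<le> 1"
    and eq: "\<And>x. u x + pot (\<lambda>y. k y * u y) x = 1"
  shows "\<exists>C. \<forall>x h. norm (x - x0) \<le> 1 / 2 \<longrightarrow> norm h \<le> 1 \<longrightarrow>
    \<bar>u (x + h) - u x\<bar> \<le> C * norm h \<and> \<bar>u (x + h) + u (x - h) - 2 * u x\<bar> \<le> C * (norm h)\<^sup>2"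
proof -
  define f where "f y = k y * u y" for y
  have km: "k \<in> borel_measurable borel" using k by (simp add: potable_def)
  have fk: "\<bar>f y\<bar> \<le> k y" for y
    using k(2)[of y] u by (simp add: f_def abs_mult mult_left_le)
  have pf: "potable f"
    using fk k(2) km u(1) by (intro potable_bound[OF k(1)]) (auto simp: f_def[abs_def])
  have eq': "u x = 1 - pot f x" for x using eq[of x] unfolding f_def[abs_def] by linarith
  obtain C where C: "0 < C"
    "\<And>f x h \<delta> B. potable f \<Longrightarrow> 0 < \<delta> \<Longrightarrow> 2 * norm h \<le> \<delta> \<Longrightarrow> 0 \<le> B \<Longrightarrow>
      (\<And>y. norm (x - y) < \<delta> \<Longrightarrow> \<bar>f (y + h) + f (y - h) - 2 * f y\<bar> \<le> B) \<Longrightarrow>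
      \<bar>pot f (x + h) + pot f (x - h) - 2 * pot f x\<bar> \<le> C * (norm h / \<delta>)\<^sup>2 * pot (\<lambda>y. \<bar>f y\<bar>) x + C * \<delta> powr (2 * \<beta>) * B"
    using pot_differences by metis
  obtain C1 where C1: "0 \<le> C1" "\<And>x h. norm (x - x0) \<le> 2 \<Longrightarrow> norm h \<le> 1 \<Longrightarrow> \<bar>u (x + h) - u x\<bar> \<le> C1 * norm h"
    using solution_first_differences[OF k u eq] by blast
  define R where "R = norm x0 + 10"
  obtain L where L: "0 \<le> L" "\<And>x h. norm x \<le> R \<Longrightarrow> norm h \<le> 1 \<Longrightarrow> \<bar>k x\<bar> \<le> L \<and> \<bar>k (x + h) - k x\<bar> \<le> L * norm h
      \<and> \<bar>k (x + h) + k (x - h) - 2 * k x\<bar> \<le> L * (norm h)\<^sup>2"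
    using k(4) unfolding locally_C11_def by meson
  obtain M where M: "0 \<le> M" "\<And>x. norm x \<le> R \<Longrightarrow> pot k x \<le> M"
    using pot_locally_bounded[OF k(1,2,3)] by blast
  have pM: "pot (\<lambda>y. \<bar>f y\<bar>) x \<le> M" if "norm x \<le> R" for x
    using pot_mono[OF potable_abs[OF pf] k(1) fk, of x] M(2)[OF that] by linarith
  \<comment> \<open>\<open>L\<close> stems from the second difference of \<open>k\<close>, and
    \<open>L * C1\<close> from each of the two mixed terms.\<close>
  define E where "E = L + 2 * (L * C1)"
  define P where "P = C * M + C * E"
  define Q where "Q = C * L"
  have E: "0 \<le> E" using L C1 by (simp add: E_def)
  have PQ: "0 \<le> P" "0 \<le> Q" using C L M E by (auto simp: P_def Q_def)
  obtain C' where C': "0 \<le> C'" "\<And>w \<eta> x. 0 \<le> \<eta> \<Longrightarrow> (\<forall>x. norm (x - x0) < 1 \<longrightarrow> \<bar>w x\<bar> \<le> 2) \<Longrightarrow>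
      (\<forall>x \<delta> B. norm (x - x0) < 1 \<longrightarrow> 0 < \<delta> \<longrightarrow> 2 * \<eta> \<le> \<delta> \<longrightarrow> 2 * \<delta> \<le> 1 - norm (x - x0) \<longrightarrow> 0 \<le> B \<longrightarrow>
        (\<forall>y. norm (x - y) < \<delta> \<longrightarrow> \<bar>w y\<bar> \<le> B) \<longrightarrow> \<bar>w x\<bar> \<le> P * (\<eta> / \<delta>) ^ 2 + Q * \<delta> powr (2 * \<beta>) * B) \<Longrightarrow>
      2 * norm (x - x0) \<le> 1 \<Longrightarrow> \<bar>w x\<bar> \<le> C' * \<eta> ^ 2"
    using absorption[of 1 P Q "2 * \<beta>" 2 x0 2] PQ beta by auto
  have main: "\<bar>u (x + h) + u (x - h) - 2 * u x\<bar> \<le> C' * norm h ^ 2" if x: "norm (x - x0) \<le> 1 / 2" and h: "norm h \<le> 1" for x h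
  proof (rule C'(2)[of "norm h" "\<lambda>x. u (x + h) + u (x - h) - 2 * u x"])
    show "\<forall>x. norm (x - x0) < 1 \<longrightarrow> \<bar>u (x + h) + u (x - h) - 2 * u x\<bar> \<le> 2"
      using u(2,3) by (smt (verit))
    show "\<forall>x \<delta> B. norm (x - x0) < 1 \<longrightarrow> 0 < \<delta> \<longrightarrow> 2 * norm h \<le> \<delta> \<longrightarrow> 2 * \<delta> \<le> 1 - norm (x - x0) \<longrightarrow> 0 \<le> B \<longrightarrow>
      (\<forall>y. norm (x - y) < \<delta> \<longrightarrow> \<bar>u (y + h) + u (y - h) - 2 * u y\<bar> \<le> B) \<longrightarrow>
      \<bar>u (x + h) + u (x - h) - 2 * u x\<bar> \<le> P * (norm h / \<delta>) ^ 2 + Q * \<delta> powr (2 * \<beta>) * B"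
    proof (intro allI impI)
      fix x \<delta> B
      assume x: "norm (x - x0) < 1" and d: "0 < \<delta>" "2 * norm h \<le> \<delta>" "2 * \<delta> \<le> 1 - norm (x - x0)" and B: "0 \<le> B"
        and w: "\<forall>y. norm (x - y) < \<delta> \<longrightarrow> \<bar>u (y + h) + u (y - h) - 2 * u y\<bar> \<le> B"
      have xR: "norm x \<le> norm x0 + 1" using x norm_triangle_ineq2[of x x0] by simp
      have d4: "\<delta> \<le> 1" using d norm_ge_zero[of "x - x0"] by linarith
      define H where "H = (norm h)\<^sup>2"
      have H: "0 \<le> H" by (simp add: H_def)
      have "\<bar>pot f (x + h) + pot f (x - h) - 2 * pot f x\<bar> \<le> C * (norm h / \<delta>)\<^sup>2 * pot (\<lambda>y. \<bar>f y\<bar>) x + C * \<delta> powr (2 * \<beta>) * (L * B + E * H)"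
      proof (rule C(2)[OF pf d(1,2)])
        show "0 \<le> L * B + E * H" using L B E H by simp
        fix y assume y: "norm (x - y) < \<delta>"
        have "norm y \<le> norm x + norm (x - y)" using norm_triangle_ineq4[of x "x - y"] by simp
        then have yR: "norm y \<le> R" using xR y d4 by (simp add: R_def)
        have "norm (y - x0) \<le> norm (x - x0) + norm (x - y)" using norm_triangle_ineq4[of "x - x0" "x - y"] by simp
        then have y2: "norm (y - x0) \<le> 2" using x y d4 by simp
        have h': "norm (- h) \<le> 1" using h by simp
        have "f (y + h) + f (y - h) - 2 * f y = k y * (u (y + h) + u (y - h) - 2 * u y)
          + (k (y + h) + k (y - h) - 2 * k y) * u y
          + (k (y + h) - k y) * (u (y + h) - u y) + (k (y - h) - k y) * (u (y - h) - u y)"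
          by (simp add: f_def algebra_simps)
        moreover have "\<bar>k y * (u (y + h) + u (y - h) - 2 * u y)\<bar> \<le> L * B"
          unfolding abs_mult using L yR h w y B by (intro mult_mono) auto
        moreover have "\<bar>(k (y + h) + k (y - h) - 2 * k y) * u y\<bar> \<le> (L * H) * 1"
          unfolding abs_mult H_def using L yR h u by (intro mult_mono) auto
        moreover have "\<bar>(k (y + h) - k y) * (u (y + h) - u y)\<bar> \<le> (L * norm h) * (C1 * norm h)"
          unfolding abs_mult using L yR h C1 y2 by (intro mult_mono) auto
        moreover have "\<bar>(k (y - h) - k y) * (u (y - h) - u y)\<bar> \<le> (L * norm h) * (C1 * norm h)"
          unfolding abs_mult using L(1) L(2)[OF yR h'] C1(1) C1(2)[OF y2 h'] by (intro mult_mono) auto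
        moreover have "(L * norm h) * (C1 * norm h) = L * C1 * H"
          by (simp add: H_def power2_eq_square mult_ac)
        ultimately have "\<bar>f (y + h) + f (y - h) - 2 * f y\<bar> \<le> L * B + L * H + 2 * (L * C1 * H)"
          by linarith
        then show "\<bar>f (y + h) + f (y - h) - 2 * f y\<bar> \<le> L * B + E * H"
          by (simp add: E_def algebra_simps)
      qed
      moreover have "C * (norm h / \<delta>)\<^sup>2 * pot (\<lambda>y. \<bar>f y\<bar>) x \<le> C * (norm h / \<delta>)\<^sup>2 * M"
        using C d xR by (intro mult_left_mono pM) (auto simp: R_def)
      moreover have "C * \<delta> powr (2 * \<beta>) * (E * H) \<le> C * 1 * (E * (norm h / \<delta>)\<^sup>2)"
      proof -
        have "\<delta> powr (2 * \<beta>) \<le> 1" using d d4 beta by (intro powr_le1) auto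
        moreover have "norm h \<le> norm h / \<delta>" using d d4 by (simp add: le_divide_eq mult_left_le)
        then have "H \<le> (norm h / \<delta>)\<^sup>2" unfolding H_def by (intro power_mono) auto
        ultimately show ?thesis using C E H by (intro mult_mono mult_left_mono) auto
      qed
      ultimately have "\<bar>pot f (x + h) + pot f (x - h) - 2 * pot f x\<bar> \<le> P * (norm h / \<delta>)\<^sup>2 + Q * \<delta> powr (2 * \<beta>) * B"
        unfolding P_def Q_def by (simp only: distrib_left distrib_right mult_ac mult_1_left)
      moreover have "u (x + h) + u (x - h) - 2 * u x = - (pot f (x + h) + pot f (x - h) - 2 * pot f x)"
        by (simp add: eq')
      ultimately show "\<bar>u (x + h) + u (x - h) - 2 * u x\<bar> \<le> P * (norm h / \<delta>) ^ 2 + Q * \<delta> powr (2 * \<beta>) * B"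
        by (simp only: abs_minus_cancel)
    qed
  qed (use x in auto)
  show ?thesis
  proof (intro exI[of _ "max C1 C'"] allI impI conjI)
    fix x h :: 'a assume x: "norm (x - x0) \<le> 1 / 2" and h: "norm h \<le> 1"
    have "C1 * norm h \<le> max C1 C' * norm h" "C' * (norm h)\<^sup>2 \<le> max C1 C' * (norm h)\<^sup>2"
      by (auto intro!: mult_right_mono)
    with C1(2)[of x h] main[OF x h] x h
    show "\<bar>u (x + h) - u x\<bar> \<le> max C1 C' * norm h" "\<bar>u (x + h) + u (x - h) - 2 * u x\<bar> \<le> max C1 C' * (norm h)\<^sup>2"
      by linarith+
  qed
qed


section \<open>The principal value\<close>

text \<open>As the cut decreases to 0 the weights increase, so monotone convergence applies; the
  limit is the mixture of \<open>subord_powr\<close> with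
  \<open>\<gamma> = - \<beta>\<close>.\<close>

lemma jumpr_tendsto:
  assumes S: "\<And>n. 0 < S n" "decseq S" "S \<longlonglongrightarrow> 0" and z: "z \<noteq> 0"
  shows "(\<lambda>n. jumpr (S n) z) \<longlonglongrightarrow> subord_const DIM('a) (- \<beta>) * norm z powr (- real DIM('a) - 2 * \<beta>)"
proof -
  have "(\<lambda>n. jump (S n) z) \<longlonglongrightarrow> subord (\<lambda>t. t powr (- \<beta> - 1)) z"
    unfolding jump_def subord_def
  proof (rule nn_integral_LIMSEQ)
    show "incseq (\<lambda>n t. ennreal (indicator {S n<..} t * t powr (- \<beta> - 1)) * ennreal (heat t z))"
    proof (rule incseq_SucI, rule le_funI)
      fix n t
      show "ennreal (indicator {S n<..} t * t powr (- \<beta> - 1)) * ennreal (heat t z)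
        \<le> ennreal (indicator {S (Suc n)<..} t * t powr (- \<beta> - 1)) * ennreal (heat t z)"
        using decseq_SucD[OF S(2), of n] by (intro mult_right_mono ennreal_leI) (auto simp: indicator_def)
    qed
    fix t
    show "(\<lambda>n. ennreal (indicator {S n<..} t * t powr (- \<beta> - 1)) * ennreal (heat t z)) \<longlonglongrightarrow> ennreal (t powr (- \<beta> - 1)) * ennreal (heat t z)"
    proof (cases "0 < t")
      case True
      show ?thesis
      proof (rule tendsto_eventually)
        show "\<forall>\<^sub>F n in sequentially. ennreal (indicator {S n<..} t * t powr (- \<beta> - 1)) * ennreal (heat t z) = ennreal (t powr (- \<beta> - 1)) * ennreal (heat t z)"
          using order_tendstoD(2)[OF S(3) True] by eventually_elim simp
      qed
    qed simp
  qed measurable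
  also have "subord (\<lambda>t. t powr (- \<beta> - 1)) z = ennreal (subord_const DIM('a) (- \<beta>) * norm z powr (- real DIM('a) - 2 * \<beta>))"
  proof -
    have e: "2 * - \<beta> - real DIM('a) = - real DIM('a) - 2 * \<beta>" by simp
    show ?thesis using subord_powr[of "- \<beta>" z, unfolded e] beta z by simp
  qed
  finally have "(\<lambda>n. ennreal (jumpr (S n) z)) \<longlonglongrightarrow> ennreal (subord_const DIM('a) (- \<beta>) * norm z powr (- real DIM('a) - 2 * \<beta>))"
    using ennreal_jumpr[OF S(1) z] by simp
  then show ?thesis
    using subord_const_pos[of "- \<beta>" "DIM('a)"] beta by (subst (asm) tendsto_ennreal_iff) auto
qed

lemma jumpr_le:
  assumes "0 < \<epsilon>" "z \<noteq> 0"
  shows "jumpr \<epsilon> z \<le> subord_const DIM('a) (- \<beta>) * norm z powr (- real DIM('a) - 2 * \<beta>)"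
proof -
  have "jump \<epsilon> z \<le> subord (\<lambda>t. t powr (- \<beta> - 1)) z"
    unfolding jump_def by (intro subord_mono) (auto simp: indicator_def)
  also have "\<dots> = ennreal (subord_const DIM('a) (- \<beta>) * norm z powr (- real DIM('a) - 2 * \<beta>))"
  proof -
    have e: "2 * - \<beta> - real DIM('a) = - real DIM('a) - 2 * \<beta>" by simp
    show ?thesis using subord_powr[of "- \<beta>" z, unfolded e] beta assms by simp
  qed
  finally show ?thesis
    using subord_const_pos[of "- \<beta>" "DIM('a)"] beta by (simp add: ennreal_jumpr[OF assms, symmetric] ennreal_le_iff)
qed

text \<open>Quadratic vanishing at the origin compensates the singularity because
  \<open>\<beta> < 1\<close>; boundedness suffices at infinity because
  \<open>\<beta> > 0\<close>.\<close>

lemma integrable_levy: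
  fixes D :: "'a \<Rightarrow> real"
  assumes [measurable]: "D \<in> borel_measurable borel" and C: "\<And>z. \<bar>D z\<bar> \<le> C" "\<And>z. norm z \<le> 1 \<Longrightarrow> \<bar>D z\<bar> \<le> C * (norm z)\<^sup>2"
  shows "integrable lborel (\<lambda>z. D z * norm z powr (- real DIM('a) - 2 * \<beta>))"
proof -
  let ?n = "real DIM('a)"
  have C0: "0 \<le> C" using C(1)[of 0] by linarith
  \<comment> \<open>The natural exponent is \<open>1 - \<beta>\<close>, but
    \<open>nn_integral_power_ball\<close> asks for \<open>\<gamma> < n / 2\<close>, which fails for
    it in dimension one; \<open>n / 4\<close> enforces that condition.\<close>
  define \<gamma> where "\<gamma> = min (1 - \<beta>) (?n / 4)"
  have \<gamma>: "0 < \<gamma>" "\<gamma> < ?n / 2" "\<gamma> \<le> 1 - \<beta>" using beta by (auto simp: \<gamma>_def min_def)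
  obtain A where A: "\<And>r. 0 < r \<Longrightarrow>
    (\<integral>\<^sup>+z. ennreal (norm (z::'a) powr (2 * \<gamma> - ?n)) * indicator {z. norm z < r} z \<partial>lborel) \<le> ennreal (A * r powr (2 * \<gamma>))"
    using nn_integral_power_ball[OF \<gamma>(1,2)] by metis
  have out: "(\<integral>\<^sup>+z. ennreal (norm (z::'a) powr (- ?n - 2 * \<beta>)) * indicator {z. 1 \<le> norm z} z \<partial>lborel) < \<infinity>"
    using beta by (intro nn_integral_power_outside) auto
  have "(\<integral>\<^sup>+z. ennreal (norm (D z * norm z powr (- ?n - 2 * \<beta>))) \<partial>lborel)
      \<le> (\<integral>\<^sup>+z. ennreal C * (ennreal (norm (z::'a) powr (2 * \<gamma> - ?n)) * indicator {z. norm z < 1} z)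
        + ennreal C * (ennreal (norm z powr (- ?n - 2 * \<beta>)) * indicator {z. 1 \<le> norm z} z) \<partial>lborel)"
  proof (rule nn_integral_mono)
    fix z :: 'a
    show "ennreal (norm (D z * norm z powr (- ?n - 2 * \<beta>)))
      \<le> ennreal C * (ennreal (norm z powr (2 * \<gamma> - ?n)) * indicator {z. norm z < 1} z)
        + ennreal C * (ennreal (norm z powr (- ?n - 2 * \<beta>)) * indicator {z. 1 \<le> norm z} z)"
    proof (cases "norm z < 1")
      case True
      have "norm (D z * norm z powr (- ?n - 2 * \<beta>)) \<le> C * norm z powr (2 * \<gamma> - ?n)"
      proof (cases "z = 0")
        case False
        have "norm (D z * norm z powr (- ?n - 2 * \<beta>)) \<le> C * (norm z)\<^sup>2 * norm z powr (- ?n - 2 * \<beta>)"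
          using C(2)[of z] True by (simp add: abs_mult mult_right_mono)
        also have "\<dots> = C * norm z powr (2 + (- ?n - 2 * \<beta>))"
          unfolding powr_add using False by simp
        also have "\<dots> \<le> C * norm z powr (2 * \<gamma> - ?n)"
          using True False \<gamma> C0 by (intro mult_left_mono powr_mono') auto
        finally show ?thesis .
      qed simp
      then show ?thesis using True C0 by (simp add: ennreal_mult'[symmetric] ennreal_leI)
    next
      case False
      have "norm (D z * norm z powr (- ?n - 2 * \<beta>)) \<le> C * norm z powr (- ?n - 2 * \<beta>)"
        using C(1)[of z] by (simp add: abs_mult mult_right_mono)
      then show ?thesis using False C0 by (simp add: ennreal_mult'[symmetric] ennreal_leI)
    qed
  qed
  also have "\<dots> = ennreal C * (\<integral>\<^sup>+z. ennreal (norm (z::'a) powr (2 * \<gamma> - ?n)) * indicator {z. norm z < 1} z \<partial>lborel)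
      + ennreal C * (\<integral>\<^sup>+z. ennreal (norm (z::'a) powr (- ?n - 2 * \<beta>)) * indicator {z. 1 \<le> norm z} z \<partial>lborel)"
    by (subst nn_integral_add) (simp_all add: nn_integral_cmult)
  also have "\<dots> < \<infinity>"
    using out le_less_trans[OF A[of 1]] by (simp add: ennreal_mult_less_top)
  finally show ?thesis by (intro integrableI_bounded) auto
qed

text \<open>The smooth truncation \<open>jumpr\<close> and the sharp truncation of the principal value have the same limit,
  because the symmetrised integrand is absolutely integrable.\<close>

lemma principal_value:
  assumes k: "potable k" "\<And>x. 0 \<le> k x" "continuous_on UNIV k"
    and u: "continuous_on UNIV u" "\<And>x. 0 \<le> u x" "\<And>x. u x \<le> 1"
    and eq: "\<And>x. u x + pot (\<lambda>y. k y * u y) x = 1"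
    and snd: "\<And>h. norm h \<le> 1 \<Longrightarrow> \<bar>u (x + h) + u (x - h) - 2 * u x\<bar> \<le> C * (norm h)\<^sup>2"
  shows "\<forall>\<epsilon>>0. integrable lborel (\<lambda>y. indicator {y. norm (x - y) > \<epsilon>} y * frac_quotient (2 * \<beta>) u x y)"
    and "((\<lambda>\<epsilon>. \<integral>y. indicator {y. norm (x - y) > \<epsilon>} y * frac_quotient (2 * \<beta>) u x y \<partial>lborel)
      \<longlongrightarrow> - (resid_mass / (subord_const DIM('a) \<beta> * subord_const DIM('a) (- \<beta>))) * (k x * u x)) (at_right 0)"
proof -
  let ?n = "real DIM('a)"
  let ?\<kappa> = "subord_const DIM('a) (- \<beta>)" and ?g = "subord_const DIM('a) \<beta>"
  have kap: "0 < ?\<kappa>" using beta by (intro subord_const_pos) auto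
  have um [measurable]: "u \<in> borel_measurable borel" using u(1) by (rule borel_measurable_continuous_onI)
  have ub: "\<bar>u a - u b\<bar> \<le> 1" for a b using u(2,3) by (smt (verit))
  define w where "w z = norm z powr (- ?n - 2 * \<beta>)" for z :: 'a
  have w_eq: "w z = 1 / norm z powr (?n + 2 * \<beta>)" for z
  proof -
    have "- ?n - 2 * \<beta> = - (?n + 2 * \<beta>)" by simp
    then show ?thesis by (simp only: w_def powr_minus_divide)
  qed
  have wm [measurable]: "w \<in> borel_measurable borel" unfolding w_def[abs_def] by measurable
  have w0: "0 \<le> w z" "w (- z) = w z" for z by (simp_all add: w_def)
  \<comment> \<open>The negative of the second difference at \<open>x\<close>: bounded because
    \<open>u\<close> lies in [0, 1], and quadratic near 0 by the last hypothesis.\<close>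
  define D where "D z = 2 * u x - u (x + z) - u (x - z)" for z
  have Dm [measurable]: "D \<in> borel_measurable borel" unfolding D_def[abs_def] by measurable
  define C' where "C' = max C 2"
  have D: "\<bar>D z\<bar> \<le> C'" "norm z \<le> 1 \<Longrightarrow> \<bar>D z\<bar> \<le> C' * (norm z)\<^sup>2" for z
  proof -
    have "\<bar>D z\<bar> \<le> 2" using ub[of x "x + z"] ub[of x "x - z"] by (simp add: D_def)
    then show "\<bar>D z\<bar> \<le> C'" by (simp add: C'_def)
    assume "norm z \<le> 1"
    then have "\<bar>D z\<bar> \<le> C * (norm z)\<^sup>2" using snd[of z] by (simp add: D_def)
    also have "\<dots> \<le> C' * (norm z)\<^sup>2" by (intro mult_right_mono) (auto simp: C'_def)
    finally show "\<bar>D z\<bar> \<le> C' * (norm z)\<^sup>2" .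
  qed
  have Dw: "integrable lborel (\<lambda>z. D z * w z)"
    unfolding w_def by (rule integrable_levy[OF Dm D])
  \<comment> \<open>For an even integrable kernel, averaging over \<open>y = x - z\<close> and
    \<open>y = x + z\<close> replaces the first difference by \<open>D / 2\<close>. This identity
    serves the sharp truncation as well as \<open>jumpr\<close>.\<close>
  have symm: "integrable lborel (\<lambda>y. m (x - y) * (u x - u y)) \<and>
      (\<integral>y. m (x - y) * (u x - u y) \<partial>lborel) = 1 / 2 * (\<integral>z. m z * D z \<partial>lborel)"
    if m [measurable]: "m \<in> borel_measurable borel" and m0: "\<And>z. m (- z) = m z"
      and mi: "integrable lborel m" for m :: "'a \<Rightarrow> real"
  proof -
    have i1: "integrable lborel (\<lambda>z. m z * (u x - u (x - z)))"
      by (rule Bochner_Integration.integrable_bound[OF mi]) (auto simp: abs_mult mult_left_le ub)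
    have i2: "integrable lborel (\<lambda>z. m z * (u x - u (x + z)))"
      by (rule Bochner_Integration.integrable_bound[OF mi]) (auto simp: abs_mult mult_left_le ub)
    have r1: "(\<lambda>y. m (x - y) * (u x - u y)) = (\<lambda>y. (\<lambda>z. m z * (u x - u (x - z))) (x - y))" by auto
    have r2: "(\<lambda>z. m z * (u x - u (x + z))) = (\<lambda>z. (\<lambda>z. m z * (u x - u (x - z))) (0 - z))" by (auto simp: m0)
    have e1: "(\<integral>y. m (x - y) * (u x - u y) \<partial>lborel) = (\<integral>z. m z * (u x - u (x - z)) \<partial>lborel)"
      unfolding r1 by (rule lborel_reflect) measurable
    have e2: "(\<integral>z. m z * (u x - u (x + z)) \<partial>lborel) = (\<integral>z. m z * (u x - u (x - z)) \<partial>lborel)"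
      unfolding r2 by (rule lborel_reflect) measurable
    have "(\<integral>z. m z * D z \<partial>lborel) = (\<integral>z. m z * (u x - u (x - z)) + m z * (u x - u (x + z)) \<partial>lborel)"
      by (simp add: D_def algebra_simps)
    also have "\<dots> = 2 * (\<integral>z. m z * (u x - u (x - z)) \<partial>lborel)"
      using i1 i2 e2 by simp
    finally have "(\<integral>y. m (x - y) * (u x - u y) \<partial>lborel) = 1 / 2 * (\<integral>z. m z * D z \<partial>lborel)"
      using e1 by simp
    moreover have "integrable lborel (\<lambda>y. m (x - y) * (u x - u y))"
      unfolding r1 by (subst lborel_reflect) (use i1 in auto)
    ultimately show ?thesis by blast
  qed
  have quot: "indicator {y. norm (x - y) > \<epsilon>} y * frac_quotient (2 * \<beta>) u x y
      = (\<lambda>z. indicator {z. norm z > \<epsilon>} z * w z) (x - y) * (u x - u y)" for \<epsilon> y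
    by (simp add: frac_quotient_def w_eq indicator_def)
  have cut: "integrable lborel (\<lambda>z. indicator {z. norm z > \<epsilon>} z * w z)" if e: "0 < \<epsilon>" for \<epsilon>
  proof (rule integrableI_bounded)
    have "(\<integral>\<^sup>+z. ennreal (norm (indicator {z. norm z > \<epsilon>} z * w z)) \<partial>lborel)
      \<le> (\<integral>\<^sup>+z. ennreal (norm (z::'a) powr (- ?n - 2 * \<beta>)) * indicator {z. \<epsilon> \<le> norm z} z \<partial>lborel)"
      by (intro nn_integral_mono) (auto simp: w_def indicator_def)
    also have "\<dots> < \<infinity>" using beta e by (intro nn_integral_power_outside) auto
    finally show "(\<integral>\<^sup>+z. ennreal (norm (indicator {z. norm z > \<epsilon>} z * w z)) \<partial>lborel) < \<infinity>" .
  qed measurable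
  have cutm: "(\<lambda>z. indicator {z. norm z > \<epsilon>} z * w z) \<in> borel_measurable borel" for \<epsilon> by measurable
  have cuts: "(\<lambda>z. indicator {z. norm z > \<epsilon>} z * w z) (- z) = (\<lambda>z. indicator {z. norm z > \<epsilon>} z * w z) z" for \<epsilon> z
    by (simp add: w0 indicator_def)
  note cs = symm[OF cutm cuts cut]
  show "\<forall>\<epsilon>>0. integrable lborel (\<lambda>y. indicator {y. norm (x - y) > \<epsilon>} y * frac_quotient (2 * \<beta>) u x y)"
    unfolding quot using cs by blast
  define l where "l = 1 / 2 * (\<integral>z. D z * w z \<partial>lborel)"
  have conv: "((\<lambda>\<epsilon>. \<integral>y. indicator {y. norm (x - y) > \<epsilon>} y * frac_quotient (2 * \<beta>) u x y \<partial>lborel) \<longlongrightarrow> l) (at_right 0)"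
  proof (rule tendsto_at_right_sequentially[of 0 1])
    fix S :: "nat \<Rightarrow> real" assume S: "\<And>n. 0 < S n" "\<And>n. S n < 1" "decseq S" "S \<longlonglongrightarrow> 0"
    have "(\<lambda>n. \<integral>z. (indicator {z. norm z > S n} z * w z) * D z \<partial>lborel) \<longlonglongrightarrow> (\<integral>z. D z * w z \<partial>lborel)"
    proof (rule integral_dominated_convergence[where w = "\<lambda>z. \<bar>D z * w z\<bar>"])
      show "AE z in lborel. (\<lambda>n. (indicator {z. norm z > S n} z * w z) * D z) \<longlonglongrightarrow> D z * w z"
        using AE_lborel_singleton[of "0::'a"]
      proof eventually_elim
        case (elim z)
        then have "0 < norm z" by simp
        from order_tendstoD(2)[OF S(4) this]
        have "\<forall>\<^sub>F n in sequentially. (indicator {z. norm z > S n} z * w z) * D z = D z * w z"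
          by eventually_elim simp
        then show ?case by (rule tendsto_eventually)
      qed
    qed (use integrable_abs[OF Dw] in \<open>auto simp: indicator_def mult.commute\<close>)
    then have "(\<lambda>n. 1 / 2 * (\<integral>z. (indicator {z. norm z > S n} z * w z) * D z \<partial>lborel)) \<longlonglongrightarrow> l"
      unfolding l_def by (intro tendsto_intros)
    then show "(\<lambda>n. \<integral>y. indicator {y. norm (x - y) > S n} y * frac_quotient (2 * \<beta>) u x y \<partial>lborel) \<longlonglongrightarrow> l"
      by (simp only: quot conjunct2[OF cs[OF S(1)]])
  qed simp
  define f where "f y = k y * u y" for y
  have km: "k \<in> borel_measurable borel" using k by (simp add: potable_def)
  have pf: "potable f"
    using km um k(2) u by (intro potable_bound[OF k(1)]) (auto simp: f_def[abs_def] abs_mult mult_left_le)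
  have cf: "isCont f x"
    using k(3) u(1) unfolding f_def[abs_def] by (auto simp: continuous_on_eq_continuous_at intro: continuous_intros)
  have pu: "pot f x - pot f y = - (u x - u y)" for y
    using eq[of x] eq[of y] unfolding f_def[abs_def] by linarith
  define S where "S n = 1 / real (Suc n)" for n
  have S: "\<And>n. 0 < S n" "decseq S" "S \<longlonglongrightarrow> 0"
    unfolding S_def using LIMSEQ_Suc[OF lim_1_over_n[where 'a = real]] by (auto simp: decseq_def frac_le)
  have Sf: "filterlim S (at_right 0) sequentially"
    unfolding filterlim_at using S by (auto intro!: always_eventually less_imp_neq[symmetric] less_imp_le)
  have "(\<lambda>n. \<integral>y. jumpr (S n) (x - y) * (pot f x - pot f y) \<partial>lborel) \<longlonglongrightarrow> resid_mass / ?g * f x"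
    by (rule filterlim_compose[OF jumpr_pot_tendsto(2)[OF pf cf] Sf])
  then have "(\<lambda>n. - (\<integral>y. jumpr (S n) (x - y) * (u x - u y) \<partial>lborel)) \<longlonglongrightarrow> resid_mass / ?g * f x"
    by (simp only: pu mult_minus_right Bochner_Integration.integral_minus)
  from tendsto_minus[OF this]
  have lim1: "(\<lambda>n. \<integral>y. jumpr (S n) (x - y) * (u x - u y) \<partial>lborel) \<longlonglongrightarrow> - (resid_mass / ?g * f x)" by simp
  have ji: "integrable lborel (jumpr \<epsilon>)" if "0 < \<epsilon>" for \<epsilon>
    using jumpr_integral(1)[OF that, of 0] by simp
  have "(\<lambda>n. \<integral>z. jumpr (S n) z * D z \<partial>lborel) \<longlonglongrightarrow> (\<integral>z. (?\<kappa> * w z) * D z \<partial>lborel)"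
  proof (rule integral_dominated_convergence[where w = "\<lambda>z. ?\<kappa> * \<bar>D z * w z\<bar>"])
    show "AE z in lborel. (\<lambda>n. jumpr (S n) z * D z) \<longlonglongrightarrow> (?\<kappa> * w z) * D z"
      using AE_lborel_singleton[of "0::'a"]
    proof eventually_elim
      case (elim z)
      show ?case unfolding w_def by (intro tendsto_intros jumpr_tendsto S elim)
    qed
    show "AE z in lborel. norm (jumpr (S n) z * D z) \<le> ?\<kappa> * \<bar>D z * w z\<bar>" for n
      using AE_lborel_singleton[of "0::'a"]
    proof eventually_elim
      case (elim z)
      have "norm (jumpr (S n) z * D z) = jumpr (S n) z * \<bar>D z\<bar>" by (simp add: abs_mult)
      also have "\<dots> \<le> (?\<kappa> * w z) * \<bar>D z\<bar>"
        unfolding w_def by (intro mult_right_mono jumpr_le S elim) auto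
      finally show ?case using w0(1)[of z] by (simp add: abs_mult mult_ac)
    qed
  qed (use Dw in auto)
  then have lim2: "(\<lambda>n. 1 / 2 * (\<integral>z. jumpr (S n) z * D z \<partial>lborel)) \<longlonglongrightarrow> 1 / 2 * (\<integral>z. ?\<kappa> * (D z * w z) \<partial>lborel)"
    by (intro tendsto_intros) (simp add: mult_ac)
  have e1: "1 / 2 * (\<integral>z. ?\<kappa> * (D z * w z) \<partial>lborel) = ?\<kappa> * l" by (simp add: l_def)
  have e2: "1 / 2 * (\<integral>z. jumpr (S n) z * D z \<partial>lborel) = (\<integral>y. jumpr (S n) (x - y) * (u x - u y) \<partial>lborel)" for n
    using symm[OF borel_measurable_jumpr _ ji[OF S(1)]] by simp
  \<comment> \<open>The jump kernels tend to \<open>?\<kappa>\<close> times the kernel of the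
    principal value, so the same sequence of integrals has this limit and the one known for
    potentials.\<close>
  have "?\<kappa> * l = - (resid_mass / ?g * f x)"
    by (rule LIMSEQ_unique[OF lim2[unfolded e1 e2] lim1])
  then have "l = - (resid_mass / (?g * ?\<kappa>)) * (k x * u x)"
  proof -
    assume "?\<kappa> * l = - (resid_mass / ?g * f x)"
    then have "(?\<kappa> * l) / ?\<kappa> = - (resid_mass / ?g * f x) / ?\<kappa>" by (rule arg_cong)
    then show ?thesis using kap by (simp add: f_def)
  qed
  with conv show "((\<lambda>\<epsilon>. \<integral>y. indicator {y. norm (x - y) > \<epsilon>} y * frac_quotient (2 * \<beta>) u x y \<partial>lborel)
      \<longlongrightarrow> - (resid_mass / (?g * ?\<kappa>)) * (k x * u x)) (at_right 0)" by simp
qed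

lemma bounded_in_L_space:
  fixes u :: "'a \<Rightarrow> real"
  assumes [measurable]: "u \<in> borel_measurable borel" and ub: "\<And>x. \<bar>u x\<bar> \<le> 1"
  shows "u \<in> L_space (2 * \<beta>)"
proof -
  let ?n = "real DIM('a)"
  have "set_integrable lebesgue K u" if "compact K" for K
  proof -
    have fin: "emeasure lborel K < \<infinity>" using that by (intro emeasure_bounded_finite compact_imp_bounded)
    have [measurable]: "K \<in> sets borel" using that by (intro borel_closed compact_imp_closed)
    have "integrable lborel (\<lambda>x. indicator K x :: real)"
      using fin by (simp add: integrable_indicator_iff)
    then have "integrable lborel (\<lambda>x. indicator K x *\<^sub>R u x)"
      by (rule Bochner_Integration.integrable_bound) (auto simp: indicator_def ub)
    then show ?thesis unfolding set_integrable_def by (subst integrable_completion) auto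
  qed
  moreover have "(\<integral>\<^sup>+x. ennreal (\<bar>u x\<bar> / (1 + norm x powr (?n + 2 * \<beta>))) \<partial>lebesgue) < \<infinity>"
  proof -
    have [measurable]: "cball (0::'a) 1 \<in> sets borel" by (intro borel_closed closed_cball)
    have "(\<integral>\<^sup>+x. ennreal (\<bar>u x\<bar> / (1 + norm x powr (?n + 2 * \<beta>))) \<partial>lborel)
      \<le> (\<integral>\<^sup>+x. indicator (cball (0::'a) 1) x + ennreal (norm x powr (- ?n - 2 * \<beta>)) * indicator {x. 1 \<le> norm x} x \<partial>lborel)"
    proof (rule nn_integral_mono)
      fix x :: 'a
      have den: "0 \<le> norm x powr (?n + 2 * \<beta>)" by simp
      show "ennreal (\<bar>u x\<bar> / (1 + norm x powr (?n + 2 * \<beta>)))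
        \<le> indicator (cball 0 1) x + ennreal (norm x powr (- ?n - 2 * \<beta>)) * indicator {x. 1 \<le> norm x} x"
      proof (cases "norm x \<le> 1")
        case True
        have "\<bar>u x\<bar> / (1 + norm x powr (?n + 2 * \<beta>)) \<le> 1 / 1"
          using den ub[of x] by (intro frac_le) auto
        then have "ennreal (\<bar>u x\<bar> / (1 + norm x powr (?n + 2 * \<beta>))) \<le> 1"
          by (simp only: ennreal_le_1 div_by_1)
        then show ?thesis using True by (simp add: add_increasing2)
      next
        case False
        have "\<bar>u x\<bar> / (1 + norm x powr (?n + 2 * \<beta>)) \<le> 1 / norm x powr (?n + 2 * \<beta>)"
          using False ub[of x] by (intro frac_le) auto
        also have "\<dots> = norm x powr (- (?n + 2 * \<beta>))" by (simp only: powr_minus_divide)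
        also have "- (?n + 2 * \<beta>) = - ?n - 2 * \<beta>" by simp
        finally show ?thesis using False by (simp add: ennreal_leI)
      qed
    qed
    also have "\<dots> = emeasure lborel (cball (0::'a) 1) + (\<integral>\<^sup>+x. ennreal (norm (x::'a) powr (- ?n - 2 * \<beta>)) * indicator {x. 1 \<le> norm x} x \<partial>lborel)"
      by (subst nn_integral_add) auto
    also have "\<dots> < \<infinity>"
      using nn_integral_power_outside[of "2 * \<beta>" 1, where 'a = 'a] emeasure_bounded_finite[OF bounded_cball[of "0::'a" 1]] beta
      by (simp add: less_top[symmetric])
    finally show ?thesis by (simp add: nn_integral_completion)
  qed
  ultimately show ?thesis by (simp add: L_space_def L1_loc_def)
qed

end

section \<open>Matching the constants and assembling the solution\<close>

theorem theorem2:
  fixes \<alpha> :: real and k :: "real ^ 'n \<Rightarrow> real"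
  assumes "0 < \<alpha>" and "\<alpha> < 2" and "\<alpha> < real CARD('n)"
    and "smooth k"
    and "\<forall>x. 0 \<le> k x"
    and "\<exists>x. k x \<noteq> 0"
    and "\<forall>x. (\<integral>\<^sup>+ y. ennreal (riesz_kernel \<alpha> x y * k y) \<partial>lebesgue) < \<infinity>"
  shows "\<exists>u \<in> E_space \<alpha>.
    (\<forall>x. 0 \<le> u x) \<and> (\<exists>x. u x \<noteq> 0) \<and>
    (\<forall>x. frac_laplacian_exists \<alpha> u x \<and> frac_laplacian \<alpha> u x + k x * u x = 0)"
proof -
  define \<beta> where "\<beta> = \<alpha> / 2"
  interpret riesz_order \<beta> "TYPE(real ^ 'n)"
    by unfold_locales (use assms in \<open>auto simp: \<beta>_def\<close>)
  have al: "\<alpha> = 2 * \<beta>" by (simp add: \<beta>_def)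
  let ?n = "DIM(real ^ 'n)"
  let ?g = "subord_const ?n \<beta>" and ?\<kappa> = "subord_const ?n (- \<beta>)"
  define c0 where "c0 = frac_laplacian_const ?n \<alpha>"
  have c0: "0 < c0"
  proof -
    have "0 < Gamma ((real ?n + \<alpha>) / 2)" using assms by (intro Gamma_real_pos) auto
    \<comment> \<open>At a pole \<open>Gamma\<close> would take the default value 0 and the constant
      would not be positive; but \<open>\<alpha> / 2\<close> lies strictly between 0 and 1.\<close>
    moreover have "- \<alpha> / 2 \<notin> \<int>\<^sub>\<le>\<^sub>0"
    proof
      assume "- \<alpha> / 2 \<in> \<int>\<^sub>\<le>\<^sub>0"
      then obtain j :: nat where "- \<alpha> / 2 = - real j" by (auto elim: nonpos_Ints_cases')
      then have "\<alpha> = 2 * real j" by simp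
      with assms(1,2) show False by (cases j) auto
    qed
    then have "0 < \<bar>Gamma (- \<alpha> / 2)\<bar>" by (simp add: Gamma_nonzero)
    ultimately show ?thesis unfolding c0_def frac_laplacian_const_def by (intro divide_pos_pos mult_pos_pos) auto
  qed
  have kap: "0 < ?\<kappa>" using beta by (intro subord_const_pos) auto
  have g: "0 < ?g" by (rule gc_pos)
  \<comment> \<open>The limit in \<open>principal_value\<close> carries the factor
    \<open>resid_mass / (?g * ?\<kappa>)\<close> and the fractional Laplacian the factor
    \<open>c0\<close>; solving with \<open>K = c * k\<close> in place of \<open>k\<close> cancels
    both.\<close>
  define c where "c = ?g * ?\<kappa> / (c0 * resid_mass)"
  have c: "0 < c" using c0 kap g resid_mass_pos by (simp add: c_def)
  define K where "K x = c * k x" for x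
  have ck: "continuous_on UNIV k" using assms(4) by (metis C_k.simps(1) smooth_def)
  have K0: "0 \<le> K x" for x using c assms(5) by (simp add: K_def)
  have cK: "continuous_on UNIV K" unfolding K_def using ck by (intro continuous_intros)
  have km [measurable]: "k \<in> borel_measurable borel" using ck by (rule borel_measurable_continuous_onI)
  have Km: "K \<in> borel_measurable borel" using cK by (rule borel_measurable_continuous_onI)
  define rc where "rc = riesz_const ?n \<alpha>"
  have rc: "0 < rc"
    unfolding rc_def riesz_const_def using assms by (intro divide_pos_pos mult_pos_pos Gamma_real_pos) auto
  have pk: "potable k"
    unfolding potable_def
  proof (intro conjI allI km)
    fix x
    \<comment> \<open>This holds on the diagonal too, where both sides are 0:
      \<open>0 powr s = 0\<close>, and division by 0 gives 0.\<close>
    have eq: "riesz_kernel \<alpha> x y * k y = rc * (rker (x - y) * k y)" for y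
    proof -
      have "2 * \<beta> - real ?n = - (real ?n - \<alpha>)" by (simp add: al)
      then have "rker (x - y) = 1 / norm (x - y) powr (real ?n - \<alpha>)"
        unfolding rker_def by (simp only: powr_minus_divide)
      then show ?thesis by (simp add: riesz_kernel_def rc_def)
    qed
    have "(\<integral>\<^sup>+y. ennreal (rc * (rker (x - y) * k y)) \<partial>lborel) < \<infinity>"
      using assms(7)[rule_format, of x] unfolding eq nn_integral_completion .
    then have "integrable lborel (\<lambda>y. rc * (rker (x - y) * k y))"
      using rc assms(5) by (intro integrableI_nonneg) auto
    then show "integrable lborel (\<lambda>y. rker (x - y) * k y)" using rc by simp
  qed
  have pK: "potable K"
    unfolding potable_def K_def using potableD(2)[OF pk] Km[unfolded K_def[abs_def]]
    by (simp add: mult.left_commute[of _ c])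
  have lK: "locally_C11 K"
    unfolding locally_C11_def
  proof
    fix R
    obtain L where L: "0 \<le> L" "\<And>x h. norm x \<le> R \<Longrightarrow> norm h \<le> 1 \<Longrightarrow> \<bar>k x\<bar> \<le> L \<and> \<bar>k (x + h) - k x\<bar> \<le> L * norm h
      \<and> \<bar>k (x + h) + k (x - h) - 2 * k x\<bar> \<le> L * (norm h)\<^sup>2"
      using C_2_differences[of k R] assms(4) unfolding smooth_def by blast
    show "\<exists>L\<ge>0. \<forall>x h. norm x \<le> R \<longrightarrow> norm h \<le> 1 \<longrightarrow> \<bar>K x\<bar> \<le> L \<and> \<bar>K (x + h) - K x\<bar> \<le> L * norm h
      \<and> \<bar>K (x + h) + K (x - h) - 2 * K x\<bar> \<le> L * (norm h)\<^sup>2"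
    proof (intro exI[of _ "c * L"] conjI allI impI)
      fix x h :: "real ^ 'n" assume xh: "norm x \<le> R" "norm h \<le> 1"
      have sc: "\<bar>c * a\<bar> \<le> c * L * b" if "\<bar>a\<bar> \<le> L * b" for a b
        using that c by (simp add: abs_mult mult.assoc)
      have "K (x + h) - K x = c * (k (x + h) - k x)"
        "K (x + h) + K (x - h) - 2 * K x = c * (k (x + h) + k (x - h) - 2 * k x)"
        by (simp_all add: K_def algebra_simps)
      then show "\<bar>K (x + h) - K x\<bar> \<le> c * L * norm h" "\<bar>K (x + h) + K (x - h) - 2 * K x\<bar> \<le> c * L * (norm h)\<^sup>2"
        using L(2)[OF xh] sc by metis+
      show "\<bar>K x\<bar> \<le> c * L" using L(2)[OF xh] sc[of "k x" 1] by (simp add: K_def)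
    qed (use c L in simp)
  qed
  obtain u where u: "u \<in> borel_measurable borel" "\<And>x. 0 \<le> u x" "\<And>x. u x \<le> 1"
    and eq: "\<And>x. u x + pot (\<lambda>y. K y * u y) x = 1"
    using integral_equation[OF cK K0 pK] by metis
  note sd = solution_second_differences[OF pK K0 cK lK u eq]
  have C11: "u \<in> C11_loc" by (rule C11_loc_second_differences[OF sd])
  have cu: "continuous_on UNIV u"
    using C11 by (auto simp: C11_loc_def intro!: continuous_at_imp_continuous_on differentiable_imp_continuous_within)
  have "u \<in> L_space \<alpha>"
    unfolding al using u by (intro bounded_in_L_space) auto
  with C11 have E: "u \<in> E_space \<alpha>" by (simp add: E_space_def)
  have ne: "\<exists>x. u x \<noteq> 0"
  proof (rule ccontr)
    assume "\<not> (\<exists>x. u x \<noteq> 0)"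
    then have "u x = 0" for x by blast
    then have "pot (\<lambda>y. K y * u y) 0 = 0" by (simp add: pot_def)
    with eq[of 0] \<open>\<And>x. u x = 0\<close> show False by simp
  qed
  have "frac_laplacian_exists \<alpha> u x \<and> frac_laplacian \<alpha> u x + k x * u x = 0" for x
  proof -
    obtain C where C: "\<And>h. norm h \<le> 1 \<Longrightarrow> \<bar>u (x + h) + u (x - h) - 2 * u x\<bar> \<le> C * (norm h)\<^sup>2"
      using sd[of x] by (metis diff_self norm_zero zero_le_divide_1_iff zero_le_numeral)
    note pv = principal_value[OF pK K0 cK cu u(2,3) eq C]
    \<comment> \<open>Borel measurability of the truncated quotient allows \<open>lebesgue\<close>
      to be exchanged for \<open>lborel\<close>, over which \<open>principal_value\<close> is
      stated.\<close>
    have qm: "(\<lambda>y. indicator {y. norm (x - y) > \<epsilon>} y *\<^sub>R frac_quotient \<alpha> u x y) \<in> borel_measurable lborel" for \<epsilon>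
      unfolding frac_quotient_def using u(1) by measurable
    have 1: "set_integrable lebesgue {y. norm (x - y) > \<epsilon>} (frac_quotient \<alpha> u x)" if "0 < \<epsilon>" for \<epsilon>
      unfolding set_integrable_def integrable_completion[OF qm]
      using pv(1) that by (simp add: al)
    have tr: "frac_truncated \<alpha> u x \<epsilon> = (\<integral>y. indicator {y. norm (x - y) > \<epsilon>} y * frac_quotient (2 * \<beta>) u x y \<partial>lborel)" for \<epsilon>
      unfolding frac_truncated_def set_lebesgue_integral_def integral_completion[OF qm] by (simp add: al)
    define l where "l = - (resid_mass / (?g * ?\<kappa>)) * (K x * u x)"
    have lim: "(frac_truncated \<alpha> u x \<longlongrightarrow> l) (at_right 0)"
      unfolding tr l_def by (rule pv(2))
    then have "Lim (at_right 0) (frac_truncated \<alpha> u x) = l"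
      by (intro tendsto_Lim) auto
    then have "frac_laplacian \<alpha> u x = c0 * l" by (simp add: frac_laplacian_def c0_def)
    also have "\<dots> = - (k x * u x)"
    proof -
      have "c0 * (resid_mass / (?g * ?\<kappa>)) * c = 1"
        using c0 kap g resid_mass_pos by (simp add: c_def)
      then show ?thesis
        unfolding l_def K_def by (metis mult.assoc mult.left_commute mult_1 mult_minus_left mult_minus_right)
    qed
    finally show ?thesis
      using 1 lim by (auto simp: frac_laplacian_exists_def)
  qed
  with E u(2) ne show ?thesis by blast
qed

end
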